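(* Let $G$ be a compactly generated locally compact metabelian group. Then (1) the union $\mathrm{W}(G)$ of all compact normal subgroups of $G$ is a compact normal subgroup (so $G$ has a maximal compact normal subgroup), and $\mathrm{W}(G/\mathrm{W}(G))$ is trivial; (2) if $\mathrm{W}(G)$ is trivial and $G$ is totally disconnected, then the derived subgroup $[G,G]$ is closed.
   Context: A locally compact group is metabelian if its derived subgroup $[G,G]$ is abelian. Compactly generated means generated as an abstract group by a compact subset. *)

theory Defs
  imports "HOL-Analysis.Analysis" "HOL-Algebra.Algebra"
begin

definition topological_group :: "('a, 'b) monoid_scheme \<Rightarrow> 'a topology \<Rightarrow> bool" where
  "topological_group G T \<longleftrightarrow> group G \<and> topspace T = carrier G \<and>
     continuous_map (prod_topology T T) T (\<lambda>(x, y). x \<otimes>\<^bsub>G\<^esub> y) \<and>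
     continuous_map T T (\<lambda>x. inv\<^bsub>G\<^esub> x)"

definition lc_group :: "('a, 'b) monoid_scheme \<Rightarrow> 'a topology \<Rightarrow> bool" where
  "lc_group G T \<longleftrightarrow> topological_group G T \<and> Hausdorff_space T \<and> locally_compact_space T"

definition compactly_generated :: "('a, 'b) monoid_scheme \<Rightarrow> 'a topology \<Rightarrow> bool" where
  "compactly_generated G T \<longleftrightarrow> (\<exists>K. K \<subseteq> carrier G \<and> compactin T K \<and> generate G K = carrier G)"

definition metabelian :: "('a, 'b) monoid_scheme \<Rightarrow> bool" where
  "metabelian G \<longleftrightarrow> (\<forall>x\<in>derived G (carrier G). \<forall>y\<in>derived G (carrier G).
       x \<otimes>\<^bsub>G\<^esub> y = y \<otimes>\<^bsub>G\<^esub> x)"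

definition W_sub :: "('a, 'b) monoid_scheme \<Rightarrow> 'a topology \<Rightarrow> 'a set" where
  "W_sub G T = \<Union>{K. K \<lhd> G \<and> compactin T K}"

definition quotient_group_topology :: "('a, 'b) monoid_scheme \<Rightarrow> 'a topology \<Rightarrow> 'a set \<Rightarrow> 'a set topology" where
  "quotient_group_topology G T H =
     topology (\<lambda>U. U \<subseteq> rcosets\<^bsub>G\<^esub> H \<and> openin T (\<Union>U))"

definition totally_disconnected_space :: "'a topology \<Rightarrow> bool" where
  "totally_disconnected_space T \<longleftrightarrow> (\<forall>S. connectedin T S \<longrightarrow> (\<exists>a. S \<subseteq> {a}))"

end

theory Submission
  imports Defs "HOL-Library.Multiset_Order"
begin

text \<open>
Call a subset bounded if it lies in a compact set.

In a compactly generated locally compact abelian group the elements generating a bounded subgroup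
form a bounded set: write the group as a bounded set times \<open>\<langle>F\<rangle>\<close> with \<open>F\<close> finite and minimal. By
minimality the powers of \<open>g \<in> F\<close> leave every bounded set modulo \<open>\<langle>F - {g}\<rangle>\<close>, so the exponent of
\<open>g\<close> is a quasi-homomorphism to the integers, and these are uniformly bounded on bounded elements.

Let \<open>A\<close> be the closure of \<open>[G,G]\<close> and \<open>U\<close> an open, compactly generated subgroup of \<open>A\<close>. Up to the
normaliser of \<open>U\<close>, which is open, conjugation on \<open>A\<close> is an action of finitely many commuting
operators, and the translates of \<open>U\<close> generate \<open>A\<close>. Hilbert's basis argument, with Dickson's lemma
applied to groups of leading coefficients in \<open>U\<close>, shows that the union of the compact normal
subgroups of \<open>G\<close> inside \<open>A\<close> is contained in \<open>K U\<close> for one of them, \<open>K\<close>; hence it is bounded. After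
dividing by this union, the remaining compact normal subgroups are central, and the same argument
applies to the closure of \<open>A W(G)\<close>, which is \<open>A\<close> times a compact set.

If \<open>G\<close> is totally disconnected, take \<open>U\<close> compact. Since \<open>W(G)\<close> is trivial, so is the intersection
of the conjugates of \<open>U\<close>. The dual argument, with groups of trailing coefficients, which decrease
and are finite modulo \<open>U\<close>, shows that an open subgroup of \<open>U\<close> consists of products of commutators;
so \<open>[G,G]\<close> is open in \<open>A\<close>.
\<close>

text \<open>The obstacle is that \<open>A\<close> is in general compactly generated only together
  with the conjugation action, not as a group, so the theorem on bounded elements cannot be applied
  to it directly; the module argument first reduces the question to \<open>U\<close>. Coefficients
  from \<open>U\<close> need not satisfy any chain condition either. What saves the argument is the
  subgroup \<open>V\<close> of those \<open>u\<close> in \<open>U\<close> whose images under all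
  chosen operators are again in \<open>U\<close>. It lies in every group of leading coefficients of
  positive degree, since \<open>u\<close> is then a leading coefficient of the identity, while
  \<open>U\<close> modulo \<open>V\<close> is finitely generated because \<open>V\<close> is
  relatively open. For the second part, \<open>x\<close> in \<open>A\<close> is regarded as the
  family of its coordinates \<open>T \<beta> x\<close> modulo \<open>U\<close>, much like a formal
  power series; if W(G) is trivial, only the identity has all coordinates trivial. Factors
  \<open>T {#j#} v \<otimes> inv v\<close>, which are commutators, push the first nontrivial
  coordinate further and further out. All corrections stay in one compact subgroup, so that this
  process has a limit.\<close>

lemma mem_set_mult_iff: "x \<in> A <#>\<^bsub>G\<^esub> B \<longleftrightarrow> (\<exists>a\<in>A. \<exists>b\<in>B. x = a \<otimes>\<^bsub>G\<^esub> b)"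
  by (auto simp: set_mult_def)

lemma mem_set_multE:
  assumes "x \<in> A <#>\<^bsub>G\<^esub> B"
  obtains a b where "a \<in> A" "b \<in> B" "x = a \<otimes>\<^bsub>G\<^esub> b"
  using assms by (auto simp: set_mult_def)

lemma mem_set_multI: "a \<in> A \<Longrightarrow> b \<in> B \<Longrightarrow> a \<otimes>\<^bsub>G\<^esub> b \<in> A <#>\<^bsub>G\<^esub> B"
  by (auto simp: set_mult_def)

lemma (in comm_group) generate_insert_decomp:
  assumes "g \<in> carrier G" "F \<subseteq> carrier G" "y \<in> generate G (insert g F)"
  obtains k :: int and d where "d \<in> generate G F" "y = g [^] k \<otimes> d"
proof -
  let ?H = "generate G {g} <#> generate G F"
  have H: "subgroup ?H G" using assms by (intro mult_subgroups generate_is_subgroup) auto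
  have "insert g F \<subseteq> ?H"
  proof
    fix z assume z: "z \<in> insert g F"
    then have zC: "z \<in> carrier G" using assms by auto
    have "z = g \<Longrightarrow> z \<otimes> \<one> \<in> ?H" "z \<in> F \<Longrightarrow> \<one> \<otimes> z \<in> ?H"
      by (intro mem_set_multI; auto intro: generate.one generate.incl)+
    then show "z \<in> ?H" using z zC by auto
  qed
  then have "y \<in> ?H" using assms(3) generate_subgroup_incl[OF _ H] by blast
  then show thesis using that generate_pow[OF assms(1)] by (auto simp: mem_set_mult_iff)
qed

section \<open>Bounded elements in abelian groups with a bornology\<close>

lemma (in group) int_pow_diff_eq:
  fixes i j :: int
  assumes "x [^] i = c \<otimes> x [^] j" "x \<in> carrier G" "c \<in> carrier G"
  shows "x [^] (i - j) = c"
  using assms by (simp add: int_pow_diff m_assoc)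

text \<open>\<open>\<B>\<close> stands for the relatively compact sets and \<open>N\<close> for a relatively compact neighbourhood of the
identity; total boundedness with respect to this single \<open>N\<close> replaces all further topology, so that the
results apply to abelian quotients by subgroups that are not closed or not compact.\<close>

locale bornological_group = comm_group G for G (structure) +
  fixes \<B> :: "'a set set" and N :: "'a set"
  assumes bdd_carrier: "S \<in> \<B> \<Longrightarrow> S \<subseteq> carrier G"
    and bdd_subset: "S \<in> \<B> \<Longrightarrow> Y \<subseteq> S \<Longrightarrow> Y \<in> \<B>"
    and bdd_finite: "finite F \<Longrightarrow> F \<subseteq> carrier G \<Longrightarrow> F \<in> \<B>"
    and bdd_mult: "S \<in> \<B> \<Longrightarrow> Y \<in> \<B> \<Longrightarrow> S <#> Y \<in> \<B>"
    and bdd_inv: "S \<in> \<B> \<Longrightarrow> m_inv G ` S \<in> \<B>"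
    and bdd_Un: "S \<in> \<B> \<Longrightarrow> Y \<in> \<B> \<Longrightarrow> S \<union> Y \<in> \<B>"
    and bdd_unit: "N \<in> \<B>"
    and totally_bdd: "S \<in> \<B> \<Longrightarrow> \<exists>F. finite F \<and> F \<subseteq> S \<and> S \<subseteq> F <#> N"
begin

text \<open>Pigeonhole over the finitely many translates of \<open>N\<close> that cover
  \<open>S\<close>: two return times using the same translate differ by a time at which the power
  lies in the inverse of \<open>N\<close> times \<open>N\<close>, modulo \<open>D\<close>. The
  returns thus reach a set independent of \<open>S\<close>, as late as desired.\<close>

lemma recurrent_arbitrarily_late:
  assumes D: "subgroup D G" and x: "x \<in> carrier G" and S: "S \<in> \<B>"
    and inf: "infinite {n::nat. x [^] n \<in> S <#> D}"
  shows "\<exists>n>M. x [^] (n::nat) \<in> ((m_inv G ` N) <#> N) <#> D"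
proof -
  interpret D: subgroup D G by (rule D)
  obtain F where F: "finite F" "F \<subseteq> S" "S \<subseteq> F <#> N" using totally_bdd[OF S] by blast
  let ?R = "{n::nat. x [^] n \<in> S <#> D}"
  have NC: "N \<subseteq> carrier G" using bdd_unit bdd_carrier by blast
  have FC: "F \<subseteq> carrier G" using F S bdd_carrier by blast
  have "\<forall>n\<in>?R. \<exists>f\<in>F. \<exists>u\<in>N. \<exists>d\<in>D. x [^] n = f \<otimes> u \<otimes> d"
    using F(3) by (fastforce simp: mem_set_mult_iff)
  then obtain f where f: "\<And>n. n \<in> ?R \<Longrightarrow> f n \<in> F \<and> (\<exists>u\<in>N. \<exists>d\<in>D. x [^] n = f n \<otimes> u \<otimes> d)"
    by metis
  have "finite (f ` ?R)" using f F(1) by (meson finite_subset image_subsetI)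
  then obtain n0 where n0: "n0 \<in> ?R" and inf': "infinite {n\<in>?R. f n = f n0}"
    using pigeonhole_infinite[OF inf] by blast
  obtain n where n: "n \<in> ?R" "f n = f n0" "n > n0 + M"
    using inf' unfolding infinite_nat_iff_unbounded by blast
  obtain u d where u: "u \<in> N" "d \<in> D" "x [^] n = f n0 \<otimes> u \<otimes> d" using f[OF n(1)] n(2) by metis
  obtain v e where v: "v \<in> N" "e \<in> D" "x [^] n0 = f n0 \<otimes> v \<otimes> e" using f[OF n0] by metis
  have C: "f n0 \<in> carrier G" "u \<in> carrier G" "v \<in> carrier G" "d \<in> carrier G" "e \<in> carrier G"
    using u v NC FC f[OF n0] by auto
  have "x [^] (n - n0) \<otimes> x [^] n0 = x [^] n"
    using x n(3) by (simp add: nat_pow_mult)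
  also have "\<dots> = (inv v \<otimes> u \<otimes> (d \<otimes> inv e)) \<otimes> (f n0 \<otimes> v \<otimes> e)"
  proof -
    have "(inv v \<otimes> u \<otimes> (d \<otimes> inv e)) \<otimes> (f n0 \<otimes> v \<otimes> e)
        = (f n0 \<otimes> u \<otimes> d) \<otimes> (inv v \<otimes> v) \<otimes> (inv e \<otimes> e)"
      using C by (simp only: m_ac m_closed inv_closed int_pow_closed)
    then show ?thesis using C u by simp
  qed
  finally have "x [^] (n - n0) = inv v \<otimes> u \<otimes> (d \<otimes> inv e)"
    unfolding v(3)[symmetric] using C x by (subst (asm) right_cancel) auto
  moreover have "inv v \<otimes> u \<otimes> (d \<otimes> inv e) \<in> ((m_inv G ` N) <#> N) <#> D"
    using u v by (intro mem_set_multI imageI) auto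
  ultimately show ?thesis using n(3) by (intro exI[of _ "n - n0"]) auto
qed

text \<open>Recurrence of the powers of \<open>x\<close> to one bounded set makes the return times syndetic.\<close>

lemma recurrent_imp_bounded_mod:
  assumes D: "subgroup D G" and x: "x \<in> carrier G" and S: "S \<in> \<B>"
    and inf: "infinite {n::nat. x [^] n \<in> S <#> D}"
  shows "\<exists>Y\<in>\<B>. \<forall>k::int. x [^] k \<in> Y <#> D"
proof -
  interpret D: subgroup D G by (rule D)
  have NC: "N \<subseteq> carrier G" using bdd_unit bdd_carrier by blast
  define NN where "NN = (m_inv G ` N) <#> N"
  \<comment> \<open>\<open>V\<close> has to hold both the late returns in \<open>NN\<close> and the
    elements \<open>inv w \<otimes> u\<close> that arise in \<open>descend\<close>.\<close>
  define V where "V = ((m_inv G ` NN) <#> N) \<union> NN"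
  have NNB: "NN \<in> \<B>" unfolding NN_def by (intro bdd_mult bdd_inv bdd_unit)
  have VB: "V \<in> \<B>" unfolding V_def by (intro bdd_Un bdd_mult bdd_inv bdd_unit NNB)
  have NNC: "NN \<subseteq> carrier G" and VC: "V \<subseteq> carrier G" using NNB VB bdd_carrier by auto
  have late: "\<exists>n>M. x [^] (n::nat) \<in> NN <#> D" for M
    unfolding NN_def by (rule recurrent_arbitrarily_late[OF assms])
  \<comment> \<open>Only the part of \<open>V\<close> met by powers of \<open>x\<close> modulo
    \<open>D\<close> is covered, so that every center in \<open>F\<close> is itself such a power up
    to \<open>D\<close>.\<close>
  define Y where "Y = {y\<in>V. \<exists>k::int. \<exists>d\<in>D. y = x [^] k \<otimes> d}"
  have "Y \<in> \<B>" using VB bdd_subset by (auto simp: Y_def)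
  then obtain F where F: "finite F" "F \<subseteq> Y" "Y \<subseteq> F <#> N" using totally_bdd by blast
  have "\<forall>z\<in>F. \<exists>n::nat. n > 0 \<and> (\<exists>w\<in>NN. \<exists>d\<in>D. z = x [^] int n \<otimes> inv w \<otimes> d)"
  proof
    fix z assume "z \<in> F"
    then obtain k :: int and d where kd: "d \<in> D" "z = x [^] k \<otimes> d" using F(2) unfolding Y_def by blast
    \<comment> \<open>A late return with \<open>m\<close> beyond the absolute value of
      \<open>k\<close> turns the exponent into the positive number \<open>k + m\<close>, at the cost
      of the factor \<open>inv w\<close>.\<close>
    obtain m :: nat where m: "m > nat \<bar>k\<bar>" "x [^] m \<in> NN <#> D" using late by blast
    then obtain w e where we: "w \<in> NN" "e \<in> D" "x [^] m = w \<otimes> e" by (blast elim: mem_set_multE)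
    have C: "w \<in> carrier G" "d \<in> carrier G" "e \<in> carrier G" using we kd NNC by auto
    define n where "n = nat (k + int m)"
    have n: "n > 0" "int n = k + int m" using m by (auto simp: n_def)
    have "x [^] int n = x [^] k \<otimes> (w \<otimes> e)"
      using x n by (simp add: int_pow_mult int_pow_int flip: we(3))
    then have "x [^] int n \<otimes> inv w \<otimes> (inv e \<otimes> d) = x [^] k \<otimes> d \<otimes> (w \<otimes> inv w) \<otimes> (e \<otimes> inv e)"
      using C x by (simp only: m_ac m_closed inv_closed int_pow_closed)
    then have "z = x [^] int n \<otimes> inv w \<otimes> (inv e \<otimes> d)" using C x kd by simp
    then show "\<exists>n::nat. n > 0 \<and> (\<exists>w\<in>NN. \<exists>d\<in>D. z = x [^] int n \<otimes> inv w \<otimes> d)"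
      using n we kd by blast
  qed
  then obtain n :: "'a \<Rightarrow> nat" where n:
    "\<And>z. z \<in> F \<Longrightarrow> n z > 0 \<and> (\<exists>w\<in>NN. \<exists>d\<in>D. z = x [^] int (n z) \<otimes> inv w \<otimes> d)"
    by metis
  define M where "M = Max (insert 1 (n ` F))"
  have M: "n z \<le> M" if "z \<in> F" for z using that F(1) by (auto simp: M_def)
  define P where "P = {k::int. x [^] k \<in> V <#> D}"
  \<comment> \<open>A positive step of at most \<open>M\<close> leads from any element of
    \<open>P\<close> down to another one; together with arbitrarily large elements this bounds the
    gaps of \<open>P\<close>.\<close>
  have descend: "\<exists>m::nat. 0 < m \<and> m \<le> M \<and> k - int m \<in> P" if kP: "k \<in> P" for k
  proof -
    obtain v d where vd: "v \<in> V" "d \<in> D" "x [^] k = v \<otimes> d"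
      using kP unfolding P_def by (blast elim: mem_set_multE)
    have C: "v \<in> carrier G" "d \<in> carrier G" using vd VC by auto
    have "v = x [^] k \<otimes> inv d" using vd C by (simp add: m_assoc)
    then have "v \<in> Y" unfolding Y_def using vd(1,2) D.m_inv_closed by blast
    then obtain z u where zu: "z \<in> F" "u \<in> N" "v = z \<otimes> u" using F(3) by (blast elim: mem_set_multE)
    obtain w e where we: "w \<in> NN" "e \<in> D" "z = x [^] int (n z) \<otimes> inv w \<otimes> e" using n[OF zu(1)] by blast
    have C': "u \<in> carrier G" "w \<in> carrier G" "e \<in> carrier G" using zu we NC NNC by auto
    have "x [^] k = x [^] int (n z) \<otimes> inv w \<otimes> e \<otimes> u \<otimes> d"
      unfolding vd(3) zu(3) by (subst we(3)) (rule refl)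
    also have "\<dots> = ((inv w \<otimes> u) \<otimes> (e \<otimes> d)) \<otimes> x [^] int (n z)"
      using C C' x by (simp only: m_ac m_closed inv_closed int_pow_closed)
    finally have "x [^] (k - int (n z)) = (inv w \<otimes> u) \<otimes> (e \<otimes> d)"
      using x C C' by (simp add: int_pow_diff_eq)
    moreover have "inv w \<otimes> u \<in> V" using we zu by (auto simp: V_def mem_set_mult_iff)
    ultimately have "k - int (n z) \<in> P" unfolding P_def using we(2) vd(2)
      by (simp add: mem_set_multI)
    then show ?thesis using n[OF zu(1)] M[OF zu(1)] by blast
  qed
  have close: "\<exists>l\<in>P. k \<le> l \<and> l \<le> k + int M" for k
  proof -
    obtain m :: nat where m: "m > nat \<bar>k\<bar>" "x [^] m \<in> NN <#> D" using late by blast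
    have "int m \<in> P" using m(2) by (auto simp: P_def V_def mem_set_mult_iff int_pow_int)
    then have ex: "\<exists>j::nat. k + int j \<in> P" using m(1) by (intro exI[of _ "nat (int m - k)"]) auto
    \<comment> \<open>The first element of \<open>P\<close> from \<open>k\<close> on. Were it more
      than \<open>M\<close> away, \<open>descend\<close> would produce an earlier one that is still
      beyond \<open>k\<close>.\<close>
    define j where "j = (LEAST j::nat. k + int j \<in> P)"
    have j: "k + int j \<in> P" unfolding j_def using ex by (rule LeastI_ex)
    obtain i :: nat where i: "0 < i" "i \<le> M" "k + int j - int i \<in> P" using descend[OF j] by blast
    have "j \<le> M"
    proof (rule ccontr)
      assume "\<not> j \<le> M"
      then have "k + int (j - i) \<in> P" using i by (simp add: of_nat_diff algebra_simps)
      then have "j \<le> j - i" unfolding j_def by (rule Least_le)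
      then show False using i \<open>\<not> j \<le> M\<close> by simp
    qed
    then show ?thesis using j by (intro bexI[of _ "k + int j"]) auto
  qed
  let ?Y = "(\<lambda>i::int. x [^] i) ` {- int M..0} <#> V"
  have "?Y \<in> \<B>" using x by (intro bdd_mult bdd_finite VB) auto
  moreover have "x [^] k \<in> ?Y <#> D" for k :: int
  proof -
    obtain l where l: "l \<in> P" "k \<le> l" "l \<le> k + int M" using close by blast
    obtain v d where vd: "v \<in> V" "d \<in> D" "x [^] l = v \<otimes> d"
      using l(1) unfolding P_def by (blast elim: mem_set_multE)
    have "x [^] k = x [^] (k - l) \<otimes> x [^] l" using x by (simp flip: int_pow_mult)
    also have "\<dots> = x [^] (k - l) \<otimes> v \<otimes> d" using vd VC x by (auto simp: m_assoc)
    finally show ?thesis using vd l by (simp add: mem_set_multI)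
  qed
  ultimately show ?thesis by blast
qed

lemma generate_Diff_decomp:
  assumes "g \<in> F" "F \<subseteq> carrier G" "y \<in> generate G F"
  obtains k :: int and d where "d \<in> generate G (F - {g})" "y = g [^] k \<otimes> d"
proof -
  have "insert g (F - {g}) = F" using assms by auto
  then show thesis using generate_insert_decomp[of g "F - {g}" y] assms that by auto
qed

lemma generate_finite_eq_finprod:
  assumes "finite F" "F \<subseteq> carrier G" "y \<in> generate G F"
  shows "\<exists>m :: 'a \<Rightarrow> int. y = finprod G (\<lambda>g. g [^] m g) F"
  using assms
proof (induction F arbitrary: y rule: finite_induct)
  case empty
  then show ?case by (simp add: generate_empty)
next
  case (insert g F)
  obtain k :: int and d where kd: "d \<in> generate G F" "y = g [^] k \<otimes> d"
    using insert.prems by (auto elim: generate_insert_decomp)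
  obtain m :: "'a \<Rightarrow> int" where m: "d = finprod G (\<lambda>g. g [^] m g) F"
    using insert.IH kd(1) insert.prems by auto
  have "finprod G (\<lambda>h. h [^] (m(g := k)) h) (insert g F) = g [^] k \<otimes> finprod G (\<lambda>h. h [^] (m(g := k)) h) F"
    using insert by (subst finprod_insert) auto
  also have "finprod G (\<lambda>h. h [^] (m(g := k)) h) F = d"
    unfolding m using insert by (intro finprod_cong') auto
  finally show ?case using kd by metis
qed

text \<open>Total boundedness of the singleton of the identity already forces this, since the
  centers of the covering are taken from the covered set.\<close>

lemma one_in_unit: "\<one> \<in> N"
proof -
  have "{\<one>} \<in> \<B>" by (rule bdd_finite) auto
  then obtain F where "F \<subseteq> {\<one>}" "{\<one>} \<subseteq> F <#> N" using totally_bdd by blast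
  then obtain n where "n \<in> N" "\<one> = \<one> \<otimes> n" by (auto simp: mem_set_mult_iff)
  then show ?thesis using bdd_carrier[OF bdd_unit] by auto
qed

text \<open>Cover \<open>?Y <#> N\<close> by translates of \<open>N\<close> with centers in a finite
  \<open>F\<close>. A factor from \<open>?Y\<close> in front of an element of \<open>N\<close> is
  then traded for a factor from \<open>F\<close>, and by commutativity this factor can be moved into
  the generated subgroup; so \<open>N <#> generate G F\<close> absorbs all generators.\<close>

lemma finitely_generated_mod_bounded:
  assumes S: "S \<in> \<B>" and gen: "generate G S = carrier G"
  shows "\<exists>F. finite F \<and> F \<subseteq> carrier G \<and> carrier G \<subseteq> N <#> generate G F"
proof -
  have SC: "S \<subseteq> carrier G" using S bdd_carrier by blast
  have NC: "N \<subseteq> carrier G" using bdd_unit bdd_carrier by blast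
  let ?Y = "S \<union> m_inv G ` S"
  have "?Y <#> N \<in> \<B>" by (intro bdd_Un bdd_mult bdd_inv bdd_unit S)
  then obtain F where F: "finite F" "F \<subseteq> ?Y <#> N" "?Y <#> N \<subseteq> F <#> N" using totally_bdd by blast
  have "?Y <#> N \<subseteq> carrier G" using SC NC by (intro set_mult_closed) auto
  then have FC: "F \<subseteq> carrier G" using F(2) by blast
  let ?R = "N <#> generate G F"
  have step: "y \<otimes> r \<in> ?R" if y: "y \<in> ?Y" and r: "r \<in> ?R" for y r
  proof -
    obtain n h where nh: "n \<in> N" "h \<in> generate G F" "r = n \<otimes> h"
      using r by (blast elim: mem_set_multE)
    have "y \<otimes> n \<in> F <#> N" using F(3) mem_set_multI[OF y nh(1)] by blast
    then obtain f n' where fn: "f \<in> F" "n' \<in> N" "y \<otimes> n = f \<otimes> n'" by (blast elim: mem_set_multE)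
    have hC: "h \<in> carrier G" using nh FC generate_in_carrier by blast
    have C: "y \<in> carrier G" "n \<in> carrier G" "f \<in> carrier G" "n' \<in> carrier G"
      using y SC NC FC nh fn by auto
    have "y \<otimes> r = (y \<otimes> n) \<otimes> h" using nh C hC by (simp add: m_assoc)
    also have "\<dots> = n' \<otimes> (f \<otimes> h)" using fn C hC by (simp add: m_ac)
    finally show ?thesis using fn nh by (simp add: mem_set_multI generate.eng generate.incl)
  qed
  have RC: "?R \<subseteq> carrier G" using NC generate_incl[OF FC] by (rule set_mult_closed)
  have "h \<otimes> r \<in> ?R" if "h \<in> generate G S" "r \<in> ?R" for h r
    using that
  proof (induction h arbitrary: r rule: generate.induct)
    case (eng h1 h2)
    have "h1 \<in> carrier G" "h2 \<in> carrier G" "r \<in> carrier G"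
      using eng SC generate_in_carrier RC by auto
    then show ?case using eng by (simp add: m_assoc)
  qed (use RC step in auto)
  moreover have "\<one> \<otimes> \<one> \<in> ?R" by (intro mem_set_multI one_in_unit generate.one)
  ultimately have "carrier G \<subseteq> ?R" using gen by fastforce
  then show ?thesis using F(1) FC by blast
qed

end

text \<open>Beyond \<open>C\<close> the absolute value grows by at least one with each doubling,
  which contradicts boundedness. The point is that the resulting bound \<open>C\<close> does not
  involve \<open>C'\<close>.\<close>

lemma abs_le_if_bounded_doubling:
  fixes m :: "nat \<Rightarrow> int"
  assumes "\<And>k. \<bar>m (Suc k) - 2 * m k\<bar> \<le> C" "\<And>k. \<bar>m k\<bar> \<le> C'"
  shows "\<bar>m 0\<bar> \<le> C"
proof (rule ccontr)
  assume *: "\<not> ?thesis"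
  have "C + 1 + int k \<le> \<bar>m k\<bar>" for k
  proof (induction k)
    case (Suc k)
    then show ?case using assms(1)[of k] by simp
  qed (use * in auto)
  from this[of "nat C'"] assms(2)[of "nat C'"] assms(1)[of 0] show False by (auto split: if_splits)
qed

context bornological_group
begin

text \<open>Finiteness is only assumed for natural exponents; enlarging \<open>Y\<close> by its
  inverses reduces a negative exponent to a positive one.\<close>

lemma exponent_bounded:
  assumes D: "subgroup D G" and g: "g \<in> carrier G"
    and fin: "\<And>Y. Y \<in> \<B> \<Longrightarrow> finite {n::nat. g [^] n \<in> Y <#> D}" and Y: "Y \<in> \<B>"
  shows "\<exists>C::int. \<forall>m::int. g [^] m \<in> Y <#> D \<longrightarrow> \<bar>m\<bar> \<le> C"
proof -
  interpret D: subgroup D G by (rule D)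
  let ?Y = "Y \<union> m_inv G ` Y"
  let ?S = "{n::nat. g [^] n \<in> ?Y <#> D}"
  have YC: "Y \<subseteq> carrier G" using Y bdd_carrier by blast
  have "finite ?S" by (intro fin bdd_Un bdd_inv Y)
  then obtain C where C: "\<forall>n\<in>?S. n \<le> C" unfolding finite_nat_set_iff_bounded_le by (elim exE)
  have "\<bar>m\<bar> \<le> int C" if m: "g [^] m \<in> Y <#> D" for m :: int
  proof -
    obtain y d where yd: "y \<in> Y" "d \<in> D" "g [^] m = y \<otimes> d" using m by (blast elim: mem_set_multE)
    have "nat \<bar>m\<bar> \<in> ?S"
    proof (cases "m \<ge> 0")
      case True
      then have "g [^] nat \<bar>m\<bar> = y \<otimes> d" using yd int_pow_int[of G g "nat \<bar>m\<bar>"] by simp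
      moreover have "y \<otimes> d \<in> ?Y <#> D" using yd by (intro mem_set_multI) auto
      ultimately show ?thesis by simp
    next
      case False
      then have "g [^] nat \<bar>m\<bar> = g [^] (- m)" using int_pow_int[of G g "nat \<bar>m\<bar>"] by simp
      also have "\<dots> = inv y \<otimes> inv d" using yd g YC D.subset by (auto simp: int_pow_neg inv_mult)
      finally have "g [^] nat \<bar>m\<bar> = inv y \<otimes> inv d" .
      moreover have "inv y \<otimes> inv d \<in> ?Y <#> D" using yd by (intro mem_set_multI) auto
      ultimately show ?thesis by simp
    qed
    then have "nat \<bar>m\<bar> \<le> C" using C by blast
    then show ?thesis by simp
  qed
  then show ?thesis by blast
qed

theorem bounded_elements_bounded:
  assumes S: "S \<in> \<B>" and gen: "generate G S = carrier G"
  shows "{b \<in> carrier G. range (\<lambda>n::nat. b [^] n) \<in> \<B>} \<in> \<B>"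
proof -
  define good where "good F \<longleftrightarrow> finite F \<and> F \<subseteq> carrier G \<and> (\<exists>B\<in>\<B>. carrier G \<subseteq> B <#> generate G F)" for F
  have "\<exists>F. good F" using finitely_generated_mod_bounded[OF assms] bdd_unit by (auto simp: good_def)
  then obtain F where F: "good F" and least: "\<And>F'. good F' \<Longrightarrow> card F \<le> card F'"
    using ex_has_least_nat[of good _ card] by blast
  have finF: "finite F" and FC: "F \<subseteq> carrier G" using F by (auto simp: good_def)
  obtain B where B: "B \<in> \<B>" and cov: "carrier G \<subseteq> B <#> generate G F" using F by (auto simp: good_def)
  have BC: "B \<subseteq> carrier G" using B bdd_carrier by blast
  define D where "D g = generate G (F - {g})" for g
  have D: "subgroup (D g) G" for g unfolding D_def using FC by (intro generate_is_subgroup) auto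
  \<comment> \<open>Otherwise the powers of \<open>g\<close> all lie in a bounded set modulo
    \<open>D g\<close>, and \<open>g\<close> could be removed from \<open>F\<close>.\<close>
  have fin: "finite {n::nat. g [^] n \<in> Y <#> D g}" if g: "g \<in> F" and Y: "Y \<in> \<B>" for g Y
  proof (rule ccontr)
    assume inf: "infinite {n::nat. g [^] n \<in> Y <#> D g}"
    have gC: "g \<in> carrier G" using g FC by auto
    obtain Z where Z: "Z \<in> \<B>" "\<And>k::int. g [^] k \<in> Z <#> D g"
      using recurrent_imp_bounded_mod[OF D gC Y inf] by blast
    have ZC: "Z \<subseteq> carrier G" using Z bdd_carrier by blast
    have "carrier G \<subseteq> (B <#> Z) <#> D g"
    proof
      fix x assume "x \<in> carrier G"
      then obtain \<beta> y where \<beta>: "\<beta> \<in> B" "y \<in> generate G F" "x = \<beta> \<otimes> y"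
        using subsetD[OF cov] by (blast elim: mem_set_multE)
      obtain k :: int and d where kd: "d \<in> D g" "y = g [^] k \<otimes> d"
        using generate_Diff_decomp[OF g FC \<beta>(2)] unfolding D_def by blast
      obtain z e where ze: "z \<in> Z" "e \<in> D g" "g [^] k = z \<otimes> e" using Z(2)[of k] by (blast elim: mem_set_multE)
      have "\<beta> \<in> carrier G" "z \<in> carrier G" "e \<in> carrier G" "d \<in> carrier G"
        using \<beta> BC ze ZC kd subgroup.subset[OF D] by auto
      then have "x = (\<beta> \<otimes> z) \<otimes> (e \<otimes> d)" using \<beta> kd ze by (simp add: m_assoc)
      then show "x \<in> (B <#> Z) <#> D g"
        using \<beta> ze kd subgroup.m_closed[OF D] by (auto intro!: mem_set_multI)
    qed
    then have "good (F - {g})" using finF FC bdd_mult[OF B Z(1)] by (auto simp: good_def D_def)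
    then have "card F \<le> card (F - {g})" by (rule least)
    then show False using g finF by (metis card_Diff1_less not_le)
  qed
  define bdd where "bdd = {b \<in> carrier G. range (\<lambda>n::nat. b [^] n) \<in> \<B>}"
  \<comment> \<open>The order of the quantifiers matters: \<open>C\<close> is fixed before
    \<open>b\<close> and comes from the defect of doubling alone. The bound \<open>C'\<close> below
    depends on the powers of \<open>b\<close> and only serves to exclude growth.\<close>
  have "\<exists>C::int. \<forall>b\<in>bdd. \<forall>\<beta>\<in>B. \<forall>d\<in>D g. \<forall>m::int. b = \<beta> \<otimes> (g [^] m \<otimes> d) \<longrightarrow> \<bar>m\<bar> \<le> C" if g: "g \<in> F" for g
  proof -
    interpret D: subgroup "D g" G by (rule D)
    have gC: "g \<in> carrier G" using g FC by auto
    note eb = exponent_bounded[OF D gC fin[OF g]]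
    \<comment> \<open>One inverted factor comes from the decomposition of the doubled power, two
      more from squaring the previous one.\<close>
    have "(m_inv G ` B) <#> (B <#> B) \<in> \<B>" by (intro bdd_mult bdd_inv B)
    then obtain C :: int where C: "\<And>m::int. g [^] m \<in> ((m_inv G ` B) <#> (B <#> B)) <#> D g \<Longrightarrow> \<bar>m\<bar> \<le> C"
      using eb by blast
    have "\<bar>m\<bar> \<le> C" if b: "b \<in> bdd" "\<beta> \<in> B" "d \<in> D g" "b = \<beta> \<otimes> (g [^] m \<otimes> d)" for b \<beta> d and m :: int
    proof -
      have bC: "b \<in> carrier G" using b by (simp add: bdd_def)
      have "(m_inv G ` B) <#> range (\<lambda>n::nat. b [^] n) \<in> \<B>" using b by (intro bdd_mult bdd_inv B) (simp add: bdd_def)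
      then obtain C' :: int where C': "\<And>m::int. g [^] m \<in> ((m_inv G ` B) <#> range (\<lambda>n::nat. b [^] n)) <#> D g \<Longrightarrow> \<bar>m\<bar> \<le> C'"
        using eb by blast
      \<comment> \<open>The clause for \<open>k = 0\<close> retains the given decomposition of
        \<open>b\<close>, so the bound holds for every exponent \<open>m\<close> that can occur, not
        just for a chosen one.\<close>
      have "\<forall>k. \<exists>m'::int. \<exists>\<beta>'\<in>B. \<exists>d'\<in>D g. b [^] (2 ^ k :: nat) = \<beta>' \<otimes> (g [^] m' \<otimes> d') \<and> (k = 0 \<longrightarrow> m' = m)"
      proof
        fix k
        show "\<exists>m'::int. \<exists>\<beta>'\<in>B. \<exists>d'\<in>D g. b [^] (2 ^ k :: nat) = \<beta>' \<otimes> (g [^] m' \<otimes> d') \<and> (k = 0 \<longrightarrow> m' = m)"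
        proof (cases k)
          case 0
          then show ?thesis using b bC by auto
        next
          case (Suc j)
          obtain \<beta>' y where \<beta>: "\<beta>' \<in> B" "y \<in> generate G F" "b [^] (2 ^ k :: nat) = \<beta>' \<otimes> y"
            using subsetD[OF cov nat_pow_closed[OF bC]] by (blast elim: mem_set_multE)
          obtain l :: int and d where kd: "d \<in> D g" "y = g [^] l \<otimes> d"
            using generate_Diff_decomp[OF g FC \<beta>(2)] unfolding D_def by blast
          then show ?thesis using \<beta> Suc by auto
        qed
      qed
      then obtain m' :: "nat \<Rightarrow> int" and \<beta>' d' where dec:
        "\<And>k. \<beta>' k \<in> B \<and> d' k \<in> D g \<and> b [^] (2 ^ k :: nat) = \<beta>' k \<otimes> (g [^] m' k \<otimes> d' k) \<and> (k = 0 \<longrightarrow> m' k = m)"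
        by metis
      have dC: "\<beta>' k \<in> carrier G" "d' k \<in> carrier G" for k using dec[of k] BC by auto
      have m1: "\<bar>m' k\<bar> \<le> C'" for k
      proof (rule C')
        have "(inv (\<beta>' k) \<otimes> b [^] (2 ^ k :: nat)) \<otimes> inv (d' k)
            = (inv (\<beta>' k) \<otimes> \<beta>' k) \<otimes> g [^] m' k \<otimes> (d' k \<otimes> inv (d' k))"
          unfolding dec[of k, THEN conjunct2, THEN conjunct2, THEN conjunct1]
          using dC[of k] gC by (simp only: m_ac m_closed inv_closed int_pow_closed)
        then have eq: "g [^] m' k = (inv (\<beta>' k) \<otimes> b [^] (2 ^ k :: nat)) \<otimes> inv (d' k)"
          using dC[of k] gC by simp
        show "g [^] m' k \<in> ((m_inv G ` B) <#> range (\<lambda>n::nat. b [^] n)) <#> D g"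
          unfolding eq using dec[of k] by (intro mem_set_multI imageI rangeI) auto
      qed
      have m2: "\<bar>m' (Suc k) - 2 * m' k\<bar> \<le> C" for k
      proof (rule C)
        have "b [^] (2 ^ Suc k :: nat) = b [^] (2 ^ k :: nat) \<otimes> b [^] (2 ^ k :: nat)"
          using bC by (simp add: nat_pow_mult mult_2)
        then have eq: "\<beta>' (Suc k) \<otimes> (g [^] m' (Suc k) \<otimes> d' (Suc k))
            = (\<beta>' k \<otimes> (g [^] m' k \<otimes> d' k)) \<otimes> (\<beta>' k \<otimes> (g [^] m' k \<otimes> d' k))"
          using dec[of k] dec[of "Suc k"] by simp
        let ?b = "inv (\<beta>' (Suc k)) \<otimes> (\<beta>' k \<otimes> \<beta>' k)" and ?d = "inv (d' (Suc k)) \<otimes> (d' k \<otimes> d' k)"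
        have "?b \<otimes> ?d \<otimes> (g [^] m' k \<otimes> g [^] m' k)
            = inv (\<beta>' (Suc k)) \<otimes> inv (d' (Suc k)) \<otimes> ((\<beta>' k \<otimes> (g [^] m' k \<otimes> d' k)) \<otimes> (\<beta>' k \<otimes> (g [^] m' k \<otimes> d' k)))"
          using dC[of k] dC[of "Suc k"] gC by (simp only: m_ac m_closed inv_closed int_pow_closed)
        also have "\<dots> = inv (\<beta>' (Suc k)) \<otimes> inv (d' (Suc k)) \<otimes> (\<beta>' (Suc k) \<otimes> (g [^] m' (Suc k) \<otimes> d' (Suc k)))"
          unfolding eq ..
        also have "\<dots> = (inv (\<beta>' (Suc k)) \<otimes> \<beta>' (Suc k)) \<otimes> g [^] m' (Suc k) \<otimes> (inv (d' (Suc k)) \<otimes> d' (Suc k))"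
          using dC[of "Suc k"] gC by (simp only: m_ac m_closed inv_closed int_pow_closed)
        also have "\<dots> = g [^] m' (Suc k)" using dC[of "Suc k"] gC by simp
        finally have "g [^] m' (Suc k) = ?b \<otimes> ?d \<otimes> g [^] (2 * m' k)"
          unfolding mult_2 int_pow_mult[OF gC] by (rule sym)
        then have eq: "g [^] (m' (Suc k) - 2 * m' k) = ?b \<otimes> ?d"
          using gC dC[of k] dC[of "Suc k"] by (intro int_pow_diff_eq) simp_all
        show "g [^] (m' (Suc k) - 2 * m' k) \<in> ((m_inv G ` B) <#> (B <#> B)) <#> D g"
          unfolding eq using dec[of k] dec[of "Suc k"] by (intro mem_set_multI imageI) auto
      qed
      have "\<bar>m' 0\<bar> \<le> C" using m1 m2 by (rule abs_le_if_bounded_doubling[of m' C C', rotated])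
      then show ?thesis using dec[of 0] by simp
    qed
    then show ?thesis by blast
  qed
  then obtain C :: "'a \<Rightarrow> int" where C:
    "\<And>g b \<beta> d m. g \<in> F \<Longrightarrow> b \<in> bdd \<Longrightarrow> \<beta> \<in> B \<Longrightarrow> d \<in> D g \<Longrightarrow> b = \<beta> \<otimes> (g [^] m \<otimes> d) \<Longrightarrow> \<bar>m\<bar> \<le> C g"
    by metis
  let ?E = "(\<lambda>m. finprod G (\<lambda>g. g [^] (m g :: int)) F) ` (PiE F (\<lambda>g. {- C g..C g}))"
  have "bdd \<subseteq> B <#> ?E"
  proof
    fix b assume b: "b \<in> bdd"
    then obtain \<beta> y where \<beta>: "\<beta> \<in> B" "y \<in> generate G F" "b = \<beta> \<otimes> y"
      using subsetD[OF cov, of b] by (auto simp: bdd_def elim: mem_set_multE)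
    obtain m :: "'a \<Rightarrow> int" where m: "y = finprod G (\<lambda>g. g [^] m g) F"
      using generate_finite_eq_finprod[OF finF FC \<beta>(2)] by blast
    \<comment> \<open>A single expansion of \<open>y\<close> serves all \<open>g\<close> at once,
      because the remaining factors form an element of \<open>D g\<close>.\<close>
    have "\<bar>m g\<bar> \<le> C g" if g: "g \<in> F" for g
    proof (rule C[OF g b \<beta>(1)])
      let ?d = "finprod G (\<lambda>g. g [^] m g) (F - {g})"
      have "h \<in> D g \<Longrightarrow> h [^] (k::int) \<in> D g" for h k by (rule subgroup_int_pow_closed[OF D])
      moreover have "h \<in> D g" if "h \<in> F - {g}" for h using that by (simp add: D_def generate.incl)
      ultimately have mem: "h [^] m h \<in> D g" if "h \<in> F - {g}" for h using that by blast
      have "finprod G (\<lambda>g. g [^] m g) F' \<in> D g" if "F' \<subseteq> F - {g}" for F'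
        using finite_subset[OF that finite_Diff[OF finF]] that
      proof (induction F' rule: finite_induct)
        case (insert h F')
        then show ?case using mem FC by (subst finprod_insert) (auto simp: subgroup.m_closed[OF D])
      qed (simp add: subgroup.one_closed[OF D])
      then show "?d \<in> D g" by blast
      have "y = finprod G (\<lambda>g. g [^] m g) (insert g (F - {g}))" using m g by (simp add: insert_absorb)
      also have "\<dots> = g [^] m g \<otimes> ?d" using finF FC g by (subst finprod_insert) auto
      finally show "b = \<beta> \<otimes> (g [^] m g \<otimes> ?d)" using \<beta> by simp
    qed
    then have "restrict m F \<in> PiE F (\<lambda>g. {- C g..C g})" by (force simp: abs_le_iff)
    moreover have "y = finprod G (\<lambda>g. g [^] restrict m F g) F"
      unfolding m using FC by (intro finprod_cong') auto
    ultimately have "y \<in> ?E" by (intro image_eqI[of _ _ "restrict m F"])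
    then show "b \<in> B <#> ?E" unfolding \<beta>(3) by (intro mem_set_multI \<beta>(1))
  qed
  moreover have "?E \<in> \<B>"
    using finF FC by (intro bdd_finite finite_imageI finite_PiE) (auto intro!: finprod_closed)
  ultimately show ?thesis unfolding bdd_def using B bdd_mult bdd_subset by blast
qed

end

section \<open>Monomials and chain conditions\<close>

text \<open>A multiset of indices encodes the exponent of a monomial in commuting variables; unlike the plain
multiset order, the graded one has finite initial segments.\<close>

definition deglex :: "nat multiset \<Rightarrow> nat multiset \<Rightarrow> bool" (infix \<open>\<triangleleft>\<close> 50) where
  "\<alpha> \<triangleleft> \<beta> \<longleftrightarrow> size \<alpha> < size \<beta> \<or> size \<alpha> = size \<beta> \<and> \<alpha> < \<beta>"

lemma deglex_irrefl: "\<not> \<alpha> \<triangleleft> \<alpha>"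
  by (simp add: deglex_def)

lemma deglex_trans: "\<alpha> \<triangleleft> \<beta> \<Longrightarrow> \<beta> \<triangleleft> \<gamma> \<Longrightarrow> \<alpha> \<triangleleft> \<gamma>"
  by (auto simp: deglex_def)

lemma deglex_linear: "\<alpha> \<triangleleft> \<beta> \<or> \<alpha> = \<beta> \<or> \<beta> \<triangleleft> \<alpha>"
  unfolding deglex_def by (metis linorder_less_linear)

lemma deglex_add: "\<alpha> \<triangleleft> \<beta> \<Longrightarrow> \<alpha> + \<gamma> \<triangleleft> \<beta> + \<gamma>"
  by (auto simp: deglex_def)

lemma not_deglex_empty: "\<not> \<alpha> \<triangleleft> {#}"
  by (auto simp: deglex_def)

lemma deglex_if_size_less: "size \<alpha> < size \<beta> \<Longrightarrow> \<alpha> \<triangleleft> \<beta>"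
  by (simp add: deglex_def)

lemma wfp_deglex: "wfp (\<triangleleft>)"
proof -
  have "wf (inv_image (less_than <*lex*> {(\<alpha>, \<beta> :: nat multiset). \<alpha> < \<beta>}) (\<lambda>\<alpha>. (size \<alpha>, \<alpha>)))"
    by (intro wf_inv_image wf_lex_prod wf_less_than wf)
  also have "inv_image (less_than <*lex*> {(\<alpha>, \<beta> :: nat multiset). \<alpha> < \<beta>}) (\<lambda>\<alpha>. (size \<alpha>, \<alpha>))
      = {(\<alpha>, \<beta>). \<alpha> \<triangleleft> \<beta>}"
    by (auto simp: deglex_def)
  finally show ?thesis by (simp add: wfp_def)
qed

lemma finite_deglex_below:
  assumes "finite J"
  shows "finite {\<beta>. set_mset \<beta> \<subseteq> J \<and> \<beta> \<triangleleft> \<alpha>}"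
proof (rule finite_subset)
  show "{\<beta>. set_mset \<beta> \<subseteq> J \<and> \<beta> \<triangleleft> \<alpha>} \<subseteq> (\<Union>n\<le>size \<alpha>. {\<beta>. set_mset \<beta> \<subseteq> J \<and> size \<beta> = n})"
    by (auto simp: deglex_def)
  show "finite (\<Union>n\<le>size \<alpha>. {\<beta>. set_mset \<beta> \<subseteq> J \<and> size \<beta> = n})"
    using finite_multisets_of_size[OF assms] by (simp add: multisets_of_size_def)
qed

text \<open>A decreasing sequence of naturals is constant from the place where its minimum is
  attained.\<close>

lemma nat_seq_incseq_subseq:
  fixes s :: "nat \<Rightarrow> nat"
  shows "\<exists>r. strict_mono r \<and> incseq (\<lambda>n. s (r n))"
proof -
  obtain r where r: "strict_mono r" "monoseq (\<lambda>n. s (r n))" using seq_monosub by blast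
  show ?thesis
  proof (cases "incseq (\<lambda>n. s (r n))")
    case False
    then have dec: "decseq (\<lambda>n. s (r n))" using r(2) by (auto simp: monoseq_iff)
    obtain N where N: "\<And>n. s (r N) \<le> s (r n)"
      using ex_has_least_nat[of "\<lambda>_. True" 0 "\<lambda>n. s (r n)"] by auto
    have "s (r (n + N)) = s (r N)" for n
      using N[of "n + N"] decseqD[OF dec, of N "n + N"] by simp
    moreover have "strict_mono (\<lambda>n. r (n + N))" using r(1) by (simp add: strict_mono_def)
    ultimately show ?thesis by (intro exI[of _ "\<lambda>n. r (n + N)"]) (simp add: incseq_def)
  qed (use r in blast)
qed

text \<open>Dickson's lemma in the form of a monotone subsequence, obtained by thinning out once per
  variable; earlier variables keep their monotonicity under further thinning.\<close>

lemma dickson: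
  fixes a :: "nat \<Rightarrow> 'b multiset"
  assumes "finite J" "\<And>n. set_mset (a n) \<subseteq> J"
  shows "\<exists>r :: nat \<Rightarrow> nat. strict_mono r \<and> (\<forall>i j. i \<le> j \<longrightarrow> a (r i) \<subseteq># a (r j))"
proof -
  have "\<exists>r :: nat \<Rightarrow> nat. strict_mono r \<and> (\<forall>x\<in>J. incseq (\<lambda>n. count (a (r n)) x))"
    using assms(1)
  proof (induction J rule: finite_induct)
    case empty
    then show ?case by (auto intro: strict_mono_id)
  next
    case (insert x J)
    then obtain r where r: "strict_mono r" "\<forall>x\<in>J. incseq (\<lambda>n. count (a (r n)) x)" by blast
    obtain q where q: "strict_mono q" "incseq (\<lambda>n. count (a (r (q n))) x)"
      using nat_seq_incseq_subseq[of "\<lambda>n. count (a (r n)) x"] by blast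
    have "strict_mono (\<lambda>n. r (q n))" using r(1) q(1) by (simp add: strict_mono_def)
    moreover have "incseq (\<lambda>n. count (a (r (q n))) y)" if "y \<in> J" for y
    proof -
      have "incseq (\<lambda>n. count (a (r n)) y)" using r(2) that by blast
      then show ?thesis using strict_mono_less_eq[OF q(1)] by (simp add: incseq_def)
    qed
    ultimately show ?case using q(2) by (intro exI[of _ "\<lambda>n. r (q n)"]) blast
  qed
  then obtain r where r: "strict_mono r" "\<And>x. x \<in> J \<Longrightarrow> incseq (\<lambda>n. count (a (r n)) x)" by blast
  have "a (r i) \<subseteq># a (r j)" if "i \<le> j" for i j
  proof (rule mset_subset_eqI)
    fix x show "count (a (r i)) x \<le> count (a (r j)) x"
    proof (cases "x \<in> J")
      case True then show ?thesis using incseqD[OF r(2)] that by blast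
    next
      case False then show ?thesis using assms(2)[of "r i"] by (metis le0 not_in_iff subsetD)
    qed
  qed
  then have "\<forall>i j. i \<le> j \<longrightarrow> a (r i) \<subseteq># a (r j)" by simp
  with r(1) show ?thesis by blast
qed

text \<open>The least positive integer \<open>d\<close> occurring anywhere in the chain appears at
  some stage; division with remainder makes every element of a later stage a multiple of
  \<open>d\<close>. If no positive integer occurs, all stages are trivial.\<close>

lemma int_subgroup_chain_stabilizes:
  fixes I :: "nat \<Rightarrow> int set"
  assumes zero: "\<And>n. 0 \<in> I n" and diff: "\<And>n a b. a \<in> I n \<Longrightarrow> b \<in> I n \<Longrightarrow> a - b \<in> I n"
    and mono: "incseq I"
  shows "\<exists>n. \<forall>m\<ge>n. I m = I n"
proof -
  have neg: "- a \<in> I n" if "a \<in> I n" for a n using diff[OF zero that] by simp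
  have add: "a + b \<in> I n" if "a \<in> I n" "b \<in> I n" for a b n using diff[OF that(1) neg[OF that(2)]] by simp
  have mult_nat: "a * int k \<in> I n" if "a \<in> I n" for a n k
    by (induction k) (use zero add that in \<open>auto simp: algebra_simps\<close>)
  have mult: "a * k \<in> I n" if "a \<in> I n" for a n k
  proof (cases "k \<ge> 0")
    case True then show ?thesis using mult_nat[OF that, of "nat k"] by simp
  next
    case False then show ?thesis using neg[OF mult_nat[OF that, of "nat (- k)"]] by simp
  qed
  have sub: "I n \<subseteq> I m" if "n \<le> m" for n m using mono that by (simp add: incseqD)
  show ?thesis
  proof (cases "\<exists>n. \<exists>a\<in>I n. a > 0")
    case False
    have "I n = {0}" for n
      using False zero[of n] neg[of _ n] by (force simp: not_less)
    then show ?thesis by auto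
  next
    case True
    then have "\<exists>d::nat. d > 0 \<and> (\<exists>n. int d \<in> I n)" by (metis zero_less_imp_eq_int)
    then obtain d :: nat where d: "d > 0" "\<exists>n. int d \<in> I n"
      and least: "\<And>e::nat. e > 0 \<and> (\<exists>n. int e \<in> I n) \<Longrightarrow> d \<le> e"
      using ex_has_least_nat[of "\<lambda>d. d > 0 \<and> (\<exists>n. int d \<in> I n)" _ "\<lambda>d. d"] by blast
    obtain n where n: "int d \<in> I n" using d by blast
    have "a \<in> I n" if a: "a \<in> I m" and "m \<ge> n" for a m
    proof -
      have "int d \<in> I m" using n sub[OF \<open>m \<ge> n\<close>] by blast
      then have "a - int d * (a div int d) \<in> I m" using diff[OF a mult] by blast
      then have mem: "a mod int d \<in> I m" by (simp add: minus_mult_div_eq_mod)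
      have "a mod int d = 0"
      proof (rule ccontr)
        assume "a mod int d \<noteq> 0"
        moreover have range: "0 \<le> a mod int d" "a mod int d < int d" using d(1) by simp_all
        ultimately have "nat (a mod int d) > 0" by linarith
        moreover have "int (nat (a mod int d)) \<in> I m" using mem range(1) by simp
        ultimately have "d \<le> nat (a mod int d)" using least by blast
        then show False using range by linarith
      qed
      then have "a = int d * (a div int d)" by (metis add.right_neutral mult_div_mod_eq)
      then show ?thesis using mult[OF n] by metis
    qed
    then show ?thesis using sub by blast
  qed
qed

section \<open>Ascending chains in finitely generated abelian groups\<close>

context comm_group
begin

text \<open>The Noetherian property of finitely generated abelian groups, relative to
  \<open>V\<close> so that no quotient has to be formed. In the induction a chain is controlled by
  its part inside \<open>V <#> generate G F\<close> and by the exponents of the new generator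
  \<open>f\<close>.\<close>

lemma finitely_generated_chain_stabilizes:
  assumes "finite F" "F \<subseteq> carrier G" "subgroup V G"
    and "\<And>n. subgroup (H n) G" "\<And>n. V \<subseteq> H n" "\<And>n::nat. H n \<subseteq> V <#> generate G F" "incseq H"
  shows "\<exists>n. \<forall>m\<ge>n. H m = H n"
  using assms
proof (induction F arbitrary: H rule: finite_induct)
  case empty
  interpret V: subgroup V G by fact
  have "V <#> generate G {} = V" by (auto simp: generate_empty mem_set_mult_iff intro!: bexI[of _ \<one>])
  then have "H n = V" for n using empty by blast
  then show ?case by simp
next
  case (insert f F)
  interpret V: subgroup V G by fact
  have FC: "F \<subseteq> carrier G" and fC: "f \<in> carrier G" using insert.prems by auto
  note H = insert.prems(3-6)
  have HC: "H n \<subseteq> carrier G" for n using subgroup.subset[OF H(1)] .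
  let ?U = "V <#> generate G F"
  have U: "subgroup ?U G" using FC insert.prems(2) by (intro mult_subgroups generate_is_subgroup)
  interpret U: subgroup ?U G by (rule U)
  have VU: "V \<subseteq> ?U"
  proof
    fix v assume "v \<in> V"
    then show "v \<in> ?U" using mem_set_multI[of v V \<one> "generate G F" G] generate.one[of G F] by simp
  qed
  have mono: "H n \<subseteq> H m" if "n \<le> m" for n m using H(4) that by (simp add: incseqD)
  have "\<exists>n. \<forall>m\<ge>n. H m \<inter> ?U = H n \<inter> ?U"
  proof (rule insert.IH)
    show "incseq (\<lambda>n. H n \<inter> ?U)" using mono by (auto simp: incseq_def)
    show "subgroup (H n \<inter> ?U) G" for n using H(1) U by (rule subgroups_Inter_pair)
  qed (use FC insert.prems VU in auto)
  then obtain n1 where n1: "\<And>m. m \<ge> n1 \<Longrightarrow> H m \<inter> ?U = H n1 \<inter> ?U" by blast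
  \<comment> \<open>The integers mapped into the image of \<open>H n\<close> in the cyclic quotient
    by \<open>?U\<close>.\<close>
  define I where "I n = {k::int. \<exists>u\<in>?U. f [^] k \<otimes> u \<in> H n}" for n
  have "\<exists>n. \<forall>m\<ge>n. I m = I n"
  proof (rule int_subgroup_chain_stabilizes)
    fix n
    interpret H: subgroup "H n" G by (rule H(1))
    show "0 \<in> I n" unfolding I_def using U.one_closed by (auto intro!: bexI[of _ \<one>])
    fix a b assume "a \<in> I n" "b \<in> I n"
    then obtain u v where uv: "u \<in> ?U" "v \<in> ?U" "f [^] a \<otimes> u \<in> H n" "f [^] b \<otimes> v \<in> H n"
      unfolding I_def by blast
    have C: "u \<in> carrier G" "v \<in> carrier G" using uv by auto
    have "f [^] (a - b) \<otimes> (u \<otimes> inv v) = (f [^] a \<otimes> u) \<otimes> inv (f [^] b \<otimes> v)"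
      using C fC by (simp add: int_pow_diff inv_mult m_ac)
    moreover have "\<dots> \<in> H n" using uv by blast
    ultimately have "f [^] (a - b) \<otimes> (u \<otimes> inv v) \<in> H n" by simp
    then show "a - b \<in> I n" unfolding I_def using U.m_closed[OF uv(1) U.m_inv_closed[OF uv(2)]] by blast
  next
    show "incseq I" using mono unfolding I_def incseq_def by blast
  qed
  then obtain n2 where n2: "\<And>m. m \<ge> n2 \<Longrightarrow> I m = I n2" by blast
  define n where "n = max n1 n2"
  have "H m \<subseteq> H n" if m: "m \<ge> n" for m
  proof
    fix x assume x: "x \<in> H m"
    interpret Hm: subgroup "H m" G by (rule H(1))
    interpret Hn: subgroup "H n" G by (rule H(1))
    have "x \<in> V <#> generate G (insert f F)" using H(3) x by blast
    then obtain v g where vg: "v \<in> V" "g \<in> generate G (insert f F)" "x = v \<otimes> g" by (rule mem_set_multE)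
    obtain k :: int and h where kh: "h \<in> generate G F" "g = f [^] k \<otimes> h"
      using generate_insert_decomp[OF fC FC vg(2)] by blast
    have hC: "h \<in> carrier G" "v \<in> carrier G" using kh FC generate_in_carrier vg by auto
    have xeq: "x = f [^] k \<otimes> (v \<otimes> h)" using vg kh hC fC by (simp add: m_ac)
    have vh: "v \<otimes> h \<in> ?U" using vg kh by (intro mem_set_multI)
    have "k \<in> I m" unfolding I_def using x xeq vh by auto
    then have "k \<in> I n" using n2[of m] n2[of n] m by (simp add: n_def)
    then obtain u where u: "u \<in> ?U" "f [^] k \<otimes> u \<in> H n" unfolding I_def by blast
    have uC: "u \<in> carrier G" using u by auto
    have "inv (f [^] k \<otimes> u) \<otimes> x = (inv (f [^] k) \<otimes> f [^] k) \<otimes> (inv u \<otimes> (v \<otimes> h))"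
      unfolding xeq inv_mult[OF int_pow_closed[OF fC] uC]
      using uC hC fC by (simp only: m_ac m_closed inv_closed int_pow_closed)
    also have "\<dots> = inv u \<otimes> (v \<otimes> h)" using uC hC fC by simp
    finally have eq: "inv (f [^] k \<otimes> u) \<otimes> x = inv u \<otimes> (v \<otimes> h)" .
    have "inv (f [^] k \<otimes> u) \<otimes> x \<in> H m" using x u mono[OF m] by blast
    moreover have "inv (f [^] k \<otimes> u) \<otimes> x \<in> ?U" unfolding eq using u vh by blast
    ultimately have "inv (f [^] k \<otimes> u) \<otimes> x \<in> H n" using n1[of m] n1[of n] m by (auto simp: n_def)
    then have "(f [^] k \<otimes> u) \<otimes> (inv (f [^] k \<otimes> u) \<otimes> x) \<in> H n" using u by blast
    then show "x \<in> H n" using uC fC x Hm.mem_carrier by (simp flip: m_assoc)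
  qed
  then show ?case using mono by blast
qed

end

section \<open>Abelian groups with an action of monomials\<close>

text \<open>A module over the polynomial ring in the variables \<open>J\<close>, written
  multiplicatively. The coefficient group \<open>U\<close> is not assumed to be stable under
  \<open>T\<close>. Only natural exponents are used, which keeps the degrees well ordered; inverses
  of operators can enter as further variables.\<close>

locale monomial_action = comm_group G for G (structure) +
  fixes J :: "nat set" and T :: "nat multiset \<Rightarrow> 'a \<Rightarrow> 'a" and U :: "'a set"
  assumes finite_J: "finite J"
    and T_hom: "set_mset \<alpha> \<subseteq> J \<Longrightarrow> T \<alpha> \<in> hom G G"
    and T_empty: "x \<in> carrier G \<Longrightarrow> T {#} x = x"
    and T_add: "set_mset \<alpha> \<subseteq> J \<Longrightarrow> set_mset \<beta> \<subseteq> J \<Longrightarrow> x \<in> carrier G \<Longrightarrow> T (\<alpha> + \<beta>) x = T \<alpha> (T \<beta> x)"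
    and U_subgroup: "subgroup U G"
begin

sublocale U: subgroup U G by (rule U_subgroup)

abbreviation monomials :: "nat multiset set" where
  "monomials \<equiv> {\<alpha>. set_mset \<alpha> \<subseteq> J}"

lemma T_group_hom: "\<alpha> \<in> monomials \<Longrightarrow> group_hom G G (T \<alpha>)"
  by unfold_locales (simp add: T_hom)

lemma T_closed [simp]: "\<alpha> \<in> monomials \<Longrightarrow> x \<in> carrier G \<Longrightarrow> T \<alpha> x \<in> carrier G"
  by (rule group_hom.hom_closed[OF T_group_hom])

lemma T_mult: "\<alpha> \<in> monomials \<Longrightarrow> x \<in> carrier G \<Longrightarrow> y \<in> carrier G \<Longrightarrow> T \<alpha> (x \<otimes> y) = T \<alpha> x \<otimes> T \<alpha> y"
  by (rule group_hom.hom_mult[OF T_group_hom])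

lemma T_one: "\<alpha> \<in> monomials \<Longrightarrow> T \<alpha> \<one> = \<one>"
  by (rule group_hom.hom_one[OF T_group_hom])

lemma T_inv: "\<alpha> \<in> monomials \<Longrightarrow> x \<in> carrier G \<Longrightarrow> T \<alpha> (inv x) = inv (T \<alpha> x)"
  by (rule group_hom.hom_inv[OF T_group_hom])

lemma T_add': "\<alpha> \<in> monomials \<Longrightarrow> \<beta> \<in> monomials \<Longrightarrow> x \<in> carrier G \<Longrightarrow> T (\<alpha> + \<beta>) x = T \<alpha> (T \<beta> x)"
  using T_add by simp

text \<open>\<open>low \<alpha>\<close> describes the sums of terms \<open>T \<beta> u\<close> with \<open>u \<in> U\<close> and \<open>\<beta>\<close> below \<open>\<alpha>\<close>, and \<open>lead K \<alpha>\<close> the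
coefficients in \<open>U\<close> of leading terms of degree \<open>\<alpha>\<close> of elements of \<open>K\<close>.\<close>

inductive low :: "nat multiset \<Rightarrow> 'a \<Rightarrow> bool" where
  one: "low \<alpha> \<one>"
| step: "\<beta> \<triangleleft> \<alpha> \<Longrightarrow> \<beta> \<in> monomials \<Longrightarrow> u \<in> U \<Longrightarrow> low \<beta> y \<Longrightarrow> low \<alpha> (T \<beta> u \<otimes> y)"

lemma low_carrier: "low \<alpha> x \<Longrightarrow> x \<in> carrier G"
  by (induction rule: low.induct) (auto intro: T_closed)

lemma low_less: "low \<alpha> x \<Longrightarrow> \<alpha> \<triangleleft> \<gamma> \<Longrightarrow> low \<gamma> x"
  by (erule low.cases) (simp_all add: low.one low.step deglex_trans[of _ \<alpha> \<gamma>])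

lemma low_T: "low \<alpha> x \<Longrightarrow> \<gamma> \<in> monomials \<Longrightarrow> low (\<alpha> + \<gamma>) (T \<gamma> x)"
proof (induction rule: low.induct)
  case (one \<alpha>)
  then show ?case by (simp add: T_one low.one)
next
  case (step \<beta> \<alpha> u y)
  have "T \<gamma> (T \<beta> u \<otimes> y) = T (\<beta> + \<gamma>) u \<otimes> T \<gamma> y"
    using step low_carrier by (simp add: T_mult add.commute[of \<beta>] T_add)
  moreover have "low (\<alpha> + \<gamma>) (T (\<beta> + \<gamma>) u \<otimes> T \<gamma> y)"
    using step by (intro low.step) (auto simp: deglex_add)
  ultimately show ?case by simp
qed

lemma low_monomial: "\<beta> \<triangleleft> \<alpha> \<Longrightarrow> \<beta> \<in> monomials \<Longrightarrow> u \<in> U \<Longrightarrow> low \<alpha> (T \<beta> u)"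
  using low.step[OF _ _ _ low.one, of \<beta> \<alpha> u] by simp

text \<open>Two descending sums are merged at the larger of their leading exponents; at equal
  exponents the coefficients are multiplied in \<open>U\<close>. The induction on
  \<open>\<alpha>\<close> is what the remaining lower parts require.\<close>

lemma low_mult: "low \<alpha> x \<Longrightarrow> low \<alpha> y \<Longrightarrow> low \<alpha> (x \<otimes> y)"
proof (induction \<alpha> arbitrary: x y rule: wfp_induct_rule[OF wfp_deglex])
  case (1 \<alpha>)
  note C = low_carrier[OF 1(2)] low_carrier[OF 1(3)]
  from 1(2) show ?case
  proof cases
    case one
    then show ?thesis using 1(3) C by simp
  next
    case x: (step \<beta> u x')
    have xC: "x' \<in> carrier G" "T \<beta> u \<in> carrier G" using x low_carrier by auto
    from 1(3) show ?thesis
    proof cases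
      case one
      then show ?thesis using 1(2) C by simp
    next
      case y: (step \<gamma> v y')
      have yC: "y' \<in> carrier G" "T \<gamma> v \<in> carrier G" using y low_carrier by auto
      consider "\<beta> \<triangleleft> \<gamma>" | "\<beta> = \<gamma>" | "\<gamma> \<triangleleft> \<beta>" using deglex_linear by blast
      then show ?thesis
      proof cases
        case 1
        have "low \<gamma> x" using x 1 by (auto intro: low.step)
        then have "low \<gamma> (x \<otimes> y')" using "1.IH" y by blast
        then have "low \<alpha> (T \<gamma> v \<otimes> (x \<otimes> y'))" using y by (intro low.step) auto
        moreover have "T \<gamma> v \<otimes> (x \<otimes> y') = x \<otimes> y" using C xC yC y by (simp add: m_ac)
        ultimately show ?thesis by simp
      next
        case 2
        have "low \<alpha> (T \<beta> (u \<otimes> v) \<otimes> (x' \<otimes> y'))" using x y 2 "1.IH" by (intro low.step) auto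
        moreover have "T \<beta> (u \<otimes> v) \<otimes> (x' \<otimes> y') = x \<otimes> y"
          using C xC yC x y 2 by (simp add: T_mult m_ac)
        ultimately show ?thesis by simp
      next
        case 3
        have "low \<beta> y" using y 3 by (auto intro: low.step)
        then have "low \<beta> (x' \<otimes> y)" using "1.IH" x by blast
        then have "low \<alpha> (T \<beta> u \<otimes> (x' \<otimes> y))" using x by (intro low.step) auto
        moreover have "T \<beta> u \<otimes> (x' \<otimes> y) = x \<otimes> y" using C xC yC x by (simp add: m_ac)
        ultimately show ?thesis by simp
      qed
    qed
  qed
qed

lemma low_inv: "low \<alpha> x \<Longrightarrow> low \<alpha> (inv x)"
proof (induction rule: low.induct)
  case (step \<beta> \<alpha> u y)
  have "inv (T \<beta> u \<otimes> y) = T \<beta> (inv u) \<otimes> inv y"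
    using step low_carrier by (simp add: inv_mult T_inv)
  then show ?case using step by (auto intro: low.step)
qed (simp add: low.one)

lemma generate_imp_low:
  assumes "x \<in> generate G (\<Union>\<beta>\<in>monomials. T \<beta> ` U)"
  shows "\<exists>\<alpha>. low \<alpha> x"
proof -
  have "subgroup {x. \<exists>\<alpha>. low \<alpha> x} G"
  proof
    fix x y assume "x \<in> {x. \<exists>\<alpha>. low \<alpha> x}" "y \<in> {x. \<exists>\<alpha>. low \<alpha> x}"
    then obtain \<alpha> \<beta> where "low \<alpha> x" "low \<beta> y" by blast
    then show "x \<otimes> y \<in> {x. \<exists>\<alpha>. low \<alpha> x}"
      using deglex_linear[of \<alpha> \<beta>] low_less low_mult by blast
  qed (use low_carrier low_inv low.one in blast)+
  moreover have "(\<Union>\<beta>\<in>monomials. T \<beta> ` U) \<subseteq> {x. \<exists>\<alpha>. low \<alpha> x}"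
  proof clarify
    fix \<beta> u assume "set_mset \<beta> \<subseteq> J" "u \<in> U"
    \<comment> \<open>Any multiset of larger size will do as a bound: only the exponents of the
      terms must lie in \<open>monomials\<close>, so it is harmless if 0 is not in
      \<open>J\<close>.\<close>
    then have "low (add_mset 0 \<beta>) (T \<beta> u)" by (intro low_monomial) (auto simp: deglex_if_size_less)
    then show "\<exists>\<alpha>. low \<alpha> (T \<beta> u)" by blast
  qed
  ultimately show ?thesis using assms generate_subgroup_incl by blast
qed

section \<open>Leading coefficients and division\<close>

definition lead :: "'a set \<Rightarrow> nat multiset \<Rightarrow> 'a set" where
  "lead K \<alpha> = {u \<in> U. \<exists>y. low \<alpha> y \<and> T \<alpha> u \<otimes> y \<in> K}"

definition invariant_subgroup :: "'a set \<Rightarrow> bool" where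
  "invariant_subgroup K \<longleftrightarrow> subgroup K G \<and> (\<forall>\<alpha>\<in>monomials. T \<alpha> ` K \<subseteq> K)"

lemma subgroup_lead:
  assumes K: "subgroup K G" and \<alpha>: "\<alpha> \<in> monomials"
  shows "subgroup (lead K \<alpha>) G"
proof
  interpret K: subgroup K G by (rule K)
  show "lead K \<alpha> \<subseteq> carrier G" by (auto simp: lead_def)
  show "\<one> \<in> lead K \<alpha>" using \<alpha> low.one by (auto simp: lead_def T_one intro!: exI[of _ \<one>])
  fix u v assume "u \<in> lead K \<alpha>" "v \<in> lead K \<alpha>"
  then obtain x y where xy: "u \<in> U" "v \<in> U" "low \<alpha> x" "low \<alpha> y" "T \<alpha> u \<otimes> x \<in> K" "T \<alpha> v \<otimes> y \<in> K"
    by (auto simp: lead_def)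
  have C: "x \<in> carrier G" "y \<in> carrier G" "T \<alpha> u \<in> carrier G" "T \<alpha> v \<in> carrier G"
    using xy low_carrier \<alpha> by auto
  have "T \<alpha> (u \<otimes> v) \<otimes> (x \<otimes> y) = (T \<alpha> u \<otimes> x) \<otimes> (T \<alpha> v \<otimes> y)"
    using C xy \<alpha> by (simp add: T_mult m_ac)
  also have "\<dots> \<in> K" using xy by blast
  finally have "T \<alpha> (u \<otimes> v) \<otimes> (x \<otimes> y) \<in> K" .
  then show "u \<otimes> v \<in> lead K \<alpha>" unfolding lead_def using xy low_mult[OF xy(3,4)] by blast
  have "T \<alpha> (inv u) \<otimes> inv x = inv (T \<alpha> u \<otimes> x)" using C xy \<alpha> by (simp add: T_inv inv_mult)
  also have "\<dots> \<in> K" using xy by blast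
  finally have "T \<alpha> (inv u) \<otimes> inv x \<in> K" .
  then show "inv u \<in> lead K \<alpha>" unfolding lead_def using xy low_inv[OF xy(3)] by blast
qed

lemma lead_mono: "K \<subseteq> K' \<Longrightarrow> lead K \<alpha> \<subseteq> lead K' \<alpha>"
  by (auto simp: lead_def)

text \<open>The order of exponents is compatible with addition, so \<open>T \<gamma>\<close> moves
  the leading degree and keeps the coefficient. Divisibility of degrees hence gives inclusions of
  coefficient groups, which is where Dickson's lemma can act.\<close>

lemma lead_shift:
  assumes "invariant_subgroup K" "\<alpha> \<in> monomials" "\<gamma> \<in> monomials"
  shows "lead K \<alpha> \<subseteq> lead K (\<alpha> + \<gamma>)"
proof
  fix u assume "u \<in> lead K \<alpha>"
  then obtain y where y: "u \<in> U" "low \<alpha> y" "T \<alpha> u \<otimes> y \<in> K" by (auto simp: lead_def)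
  have "T (\<alpha> + \<gamma>) u \<otimes> T \<gamma> y = T \<gamma> (T \<alpha> u \<otimes> y)"
    using y assms low_carrier by (simp add: T_mult add.commute[of \<alpha>] T_add)
  also have "\<dots> \<in> K" using assms y unfolding invariant_subgroup_def by blast
  finally have "T (\<alpha> + \<gamma>) u \<otimes> T \<gamma> y \<in> K" .
  then show "u \<in> lead K (\<alpha> + \<gamma>)" using y low_T[OF y(2) assms(3)] unfolding lead_def by blast
qed

text \<open>If \<open>\<alpha>\<close> arises from \<open>\<beta>\<close> by adding
  \<open>j\<close>, then \<open>T \<alpha> u\<close> is cancelled by a term of lower degree
  \<open>\<beta>\<close> with coefficient \<open>inv (T {#j#} u)\<close>, which is in
  \<open>U\<close>. So \<open>u\<close> is a leading coefficient of the identity. In degree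
  \<open>{#}\<close> no lower term is available.\<close>

lemma lead_contains:
  assumes "subgroup K G" "\<alpha> \<in> monomials" "\<alpha> \<noteq> {#}"
  shows "{u \<in> U. \<forall>j\<in>J. T {#j#} u \<in> U} \<subseteq> lead K \<alpha>"
proof clarify
  fix u assume u: "u \<in> U" "\<forall>j\<in>J. T {#j#} u \<in> U"
  interpret K: subgroup K G by fact
  obtain j \<beta> where \<alpha>: "\<alpha> = add_mset j \<beta>" using assms(3) by (metis multiset_cases)
  have j: "j \<in> J" "\<beta> \<in> monomials" using \<alpha> assms by auto
  have eq: "T \<alpha> u = T \<beta> (T {#j#} u)" using T_add[of \<beta> "{#j#}" u] j u by (simp add: \<alpha>)
  have "low \<alpha> (T \<beta> (inv (T {#j#} u)))"
    using j u by (intro low_monomial) (auto simp: \<alpha> deglex_if_size_less)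
  moreover have "T \<alpha> u \<otimes> T \<beta> (inv (T {#j#} u)) = \<one>"
    unfolding eq using j u by (simp add: T_inv)
  ultimately show "u \<in> lead K \<alpha>" unfolding lead_def using u K.one_closed by (auto intro!: exI)
qed

text \<open>The division algorithm: an element of \<open>K\<close> with the same leading coefficient
  lowers the degree of \<open>x\<close>, until only a constant term is left. Constant terms are not
  compared, which accounts for the factor \<open>K' \<inter> U\<close>.\<close>

lemma reduce_by_lead:
  assumes K: "subgroup K G" and K': "subgroup K' G" "K \<subseteq> K'"
    and lead: "\<And>\<alpha>. \<alpha> \<in> monomials \<Longrightarrow> \<alpha> \<noteq> {#} \<Longrightarrow> lead K' \<alpha> \<subseteq> lead K \<alpha>"
    and x: "x \<in> K'" "low \<alpha> x"
  shows "x \<in> K <#> (K' \<inter> U)"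
  using x
proof (induction \<alpha> arbitrary: x rule: wfp_induct_rule[OF wfp_deglex])
  case (1 \<alpha>)
  interpret K: subgroup K G by (rule K)
  interpret K': subgroup K' G by (rule K')
  from 1(3) show ?case
  proof cases
    case one
    then show ?thesis using mem_set_multI[of \<one> K \<one> "K' \<inter> U" G] by simp
  next
    case (step \<beta> u y)
    have yC: "y \<in> carrier G" using step low_carrier by auto
    show ?thesis
    proof (cases "\<beta> = {#}")
      case True
      have "y = \<one>" using step(5) unfolding True by (cases rule: low.cases) (auto simp: not_deglex_empty)
      then have "x = u" using step True by (simp add: T_empty)
      then show ?thesis using mem_set_multI[of \<one> K x "K' \<inter> U" G] 1(2) step by simp
    next
      case False
      have "u \<in> lead K' \<beta>" unfolding lead_def using step 1(2) by blast
      then have "u \<in> lead K \<beta>" using lead[OF _ False] step by blast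
      then obtain z where z: "low \<beta> z" "T \<beta> u \<otimes> z \<in> K" unfolding lead_def by blast
      have C: "z \<in> carrier G" "T \<beta> u \<in> carrier G" using z low_carrier step by auto
      have "inv (T \<beta> u \<otimes> z) \<otimes> x = (inv (T \<beta> u) \<otimes> T \<beta> u) \<otimes> (inv z \<otimes> y)"
        unfolding step(1) inv_mult[OF C(2,1)] using C yC by (simp only: m_ac m_closed inv_closed)
      then have eq: "inv (T \<beta> u \<otimes> z) \<otimes> x = inv z \<otimes> y" using C yC by simp
      have "inv (T \<beta> u \<otimes> z) \<otimes> x \<in> K'" using z(2) K'(2) 1(2) by blast
      moreover have "low \<beta> (inv (T \<beta> u \<otimes> z) \<otimes> x)"
        unfolding eq using step z by (intro low_mult low_inv)
      ultimately have "inv (T \<beta> u \<otimes> z) \<otimes> x \<in> K <#> (K' \<inter> U)" using 1(1) step by blast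
      then obtain k v where kv: "k \<in> K" "v \<in> K' \<inter> U" "inv (T \<beta> u \<otimes> z) \<otimes> x = k \<otimes> v"
        by (rule mem_set_multE)
      have xC: "x \<in> carrier G" using 1(2) by simp
      have "x = (T \<beta> u \<otimes> z) \<otimes> (inv (T \<beta> u \<otimes> z) \<otimes> x)" using C xC by (simp flip: m_assoc)
      also have "\<dots> = ((T \<beta> u \<otimes> z) \<otimes> k) \<otimes> v" unfolding kv(3) using C kv by (simp add: m_assoc)
      finally show ?thesis using kv z by (simp add: mem_set_multI)
    qed
  qed
qed

text \<open>The proof of Hilbert's basis theorem for a directed family. The chain condition is asked
  only between the group of \<open>lead_contains\<close> and \<open>U\<close>; as that lemma says
  nothing in degree \<open>{#}\<close>, the conclusion can hold only up to constant terms.\<close>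

theorem noetherian_up_to_U:
  assumes gen: "generate G (\<Union>\<beta>\<in>monomials. T \<beta> ` U) = carrier G"
    and acc: "\<And>H. (\<And>n::nat. subgroup (H n) G \<and> {u \<in> U. \<forall>j\<in>J. T {#j#} u \<in> U} \<subseteq> H n \<and> H n \<subseteq> U)
        \<Longrightarrow> incseq H \<Longrightarrow> \<exists>n. \<forall>m\<ge>n. H m = H n"
    and ne: "\<K> \<noteq> {}" and inv: "\<And>K. K \<in> \<K> \<Longrightarrow> invariant_subgroup K"
    and dir: "\<And>K K'. K \<in> \<K> \<Longrightarrow> K' \<in> \<K> \<Longrightarrow> K <#> K' \<in> \<K>"
  shows "\<exists>K0\<in>\<K>. \<Union>\<K> \<subseteq> K0 <#> (\<Union>\<K> \<inter> U)"
proof (rule ccontr)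
  assume contra: "\<not> ?thesis"
  have sub: "subgroup K G" if "K \<in> \<K>" for K using inv[OF that] by (simp add: invariant_subgroup_def)
  \<comment> \<open>If \<open>K\<close> does not suffice, some \<open>L\<close> is not absorbed; by
    \<open>reduce_by_lead\<close>, passing to \<open>K <#> L\<close> must enlarge a coefficient
    group in positive degree.\<close>
  have "\<forall>K\<in>\<K>. \<exists>K'. \<exists>\<alpha>. K' \<in> \<K> \<and> K \<subseteq> K' \<and> \<alpha> \<in> monomials \<and> \<alpha> \<noteq> {#} \<and> \<not> lead K' \<alpha> \<subseteq> lead K \<alpha>"
  proof
    fix K assume K: "K \<in> \<K>"
    interpret K: subgroup K G by (rule sub[OF K])
    obtain L where L: "L \<in> \<K>" "\<not> L \<subseteq> K <#> (\<Union>\<K> \<inter> U)" using contra K by blast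
    interpret L: subgroup L G by (rule sub[OF L(1)])
    let ?K' = "K <#> L"
    have K': "?K' \<in> \<K>" by (rule dir[OF K L(1)])
    have KK': "K \<subseteq> ?K'" and LK': "L \<subseteq> ?K'"
      using mem_set_multI[of _ K \<one> L G] mem_set_multI[of \<one> K _ L G] by auto
    have "\<exists>\<alpha>. \<alpha> \<in> monomials \<and> \<alpha> \<noteq> {#} \<and> \<not> lead ?K' \<alpha> \<subseteq> lead K \<alpha>"
    proof (rule ccontr)
      assume "\<not> ?thesis"
      then have lead: "\<And>\<alpha>. \<alpha> \<in> monomials \<Longrightarrow> \<alpha> \<noteq> {#} \<Longrightarrow> lead ?K' \<alpha> \<subseteq> lead K \<alpha>" by blast
      have "x \<in> K <#> (\<Union>\<K> \<inter> U)" if x: "x \<in> L" for x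
      proof -
        obtain \<alpha> where \<alpha>: "low \<alpha> x" using generate_imp_low gen L.mem_carrier[OF x] by blast
        have "x \<in> K <#> (?K' \<inter> U)"
          using reduce_by_lead[OF sub[OF K] sub[OF K'] KK' lead _ \<alpha>] x LK' by blast
        also have "\<dots> \<subseteq> K <#> (\<Union>\<K> \<inter> U)" using K' by (intro mono_set_mult) auto
        finally show ?thesis .
      qed
      then show False using L(2) by blast
    qed
    then show "\<exists>K'. \<exists>\<alpha>. K' \<in> \<K> \<and> K \<subseteq> K' \<and> \<alpha> \<in> monomials \<and> \<alpha> \<noteq> {#} \<and> \<not> lead K' \<alpha> \<subseteq> lead K \<alpha>"
      using K' KK' by blast
  qed
  then obtain nxt al where nxt: "\<And>K. K \<in> \<K> \<Longrightarrow> nxt K \<in> \<K> \<and> K \<subseteq> nxt K \<and> al K \<in> monomials \<and> al K \<noteq> {#}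
      \<and> \<not> lead (nxt K) (al K) \<subseteq> lead K (al K)"
    by metis
  obtain K0 where K0: "K0 \<in> \<K>" using ne by blast
  define Ks where "Ks n = (nxt ^^ n) K0" for n
  have Ks: "Ks n \<in> \<K>" for n unfolding Ks_def by (induction n) (use K0 nxt in auto)
  have Ks_Suc: "Ks (Suc n) = nxt (Ks n)" for n by (simp add: Ks_def)
  have "incseq Ks" using nxt[OF Ks] by (intro incseq_SucI) (simp add: Ks_Suc)
  then have Ks_mono: "Ks m \<subseteq> Ks n" if "m \<le> n" for m n using that by (simp add: incseqD)
  have al: "al (Ks n) \<in> monomials" "al (Ks n) \<noteq> {#}" for n using nxt[OF Ks] by auto
  obtain r :: "nat \<Rightarrow> nat" where r: "strict_mono r" "\<And>i j. i \<le> j \<Longrightarrow> al (Ks (r i)) \<subseteq># al (Ks (r j))"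
    using dickson[OF finite_J, of "\<lambda>n. al (Ks n)"] al by auto
  \<comment> \<open>Since the degrees chosen along \<open>r\<close> divide one another, the growth
    at stage \<open>r i\<close> is carried by shifting into \<open>H (Suc i)\<close>;
    \<open>H\<close> is therefore a strictly increasing chain.\<close>
  define H where "H i = lead (Ks (r i)) (al (Ks (r i)))" for i
  have H: "subgroup (H n) G \<and> {u \<in> U. \<forall>j\<in>J. T {#j#} u \<in> U} \<subseteq> H n \<and> H n \<subseteq> U" for n
    unfolding H_def using subgroup_lead[OF sub[OF Ks] al(1)] lead_contains[OF sub[OF Ks] al]
    by (auto simp: lead_def)
  have step: "lead (Ks (Suc (r i))) (al (Ks (r i))) \<subseteq> H (Suc i)" for i
  proof -
    have "Suc (r i) \<le> r (Suc i)" using strict_monoD[OF r(1), of i "Suc i"] by simp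
    then have "lead (Ks (Suc (r i))) (al (Ks (r i))) \<subseteq> lead (Ks (r (Suc i))) (al (Ks (r i)))"
      by (intro lead_mono Ks_mono)
    also have "\<dots> \<subseteq> lead (Ks (r (Suc i))) (al (Ks (r i)) + (al (Ks (r (Suc i))) - al (Ks (r i))))"
      using al(1) by (intro lead_shift inv Ks) (auto dest: in_diffD)
    also have "al (Ks (r i)) + (al (Ks (r (Suc i))) - al (Ks (r i))) = al (Ks (r (Suc i)))"
      using r(2)[of i "Suc i"] by simp
    finally show ?thesis unfolding H_def .
  qed
  have strict: "\<not> lead (Ks (Suc (r i))) (al (Ks (r i))) \<subseteq> H i" for i
    unfolding H_def Ks_Suc using nxt[OF Ks] by blast
  have "H i \<subseteq> lead (Ks (Suc (r i))) (al (Ks (r i)))" for i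
    unfolding H_def by (intro lead_mono Ks_mono) simp
  then have "incseq H" using step by (intro incseq_SucI) blast
  then obtain n where n: "\<forall>m\<ge>n. H m = H n" using acc[of H, OF H] by blast
  have "H (Suc n) = H n" by (rule n[rule_format]) simp
  then show False using step[of n] strict[of n] by blast
qed

section \<open>Trailing coefficients and successive approximation\<close>

text \<open>Dual to leading coefficients: an element of \<open>below \<alpha>\<close> has trivial coordinates \<open>T \<beta> x\<close> modulo \<open>U\<close> below
\<open>\<alpha>\<close>, and \<open>tail \<alpha>\<close> collects its possible coordinates at \<open>\<alpha>\<close>. These shrink as \<open>\<alpha>\<close> grows.\<close>

definition below :: "nat multiset \<Rightarrow> 'a set" where
  "below \<alpha> = {x \<in> carrier G. \<forall>\<beta>\<in>monomials. \<beta> \<triangleleft> \<alpha> \<longrightarrow> T \<beta> x \<in> U}"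

definition tail :: "nat multiset \<Rightarrow> 'a set" where
  "tail \<alpha> = T \<alpha> ` below \<alpha> <#> U"

lemma subgroup_below: "subgroup (below \<alpha>) G"
  by standard (auto simp: below_def T_mult T_one T_inv)

lemma below_mono: "\<alpha> \<triangleleft> \<beta> \<Longrightarrow> below \<beta> \<subseteq> below \<alpha>"
  unfolding below_def using deglex_trans by blast

lemma below_subset_U: "\<alpha> \<noteq> {#} \<Longrightarrow> below \<alpha> \<subseteq> U"
proof
  fix x assume "\<alpha> \<noteq> {#}" "x \<in> below \<alpha>"
  moreover from this have "{#} \<triangleleft> \<alpha>" by (simp add: deglex_if_size_less nonempty_has_size)
  ultimately have "x \<in> carrier G" "T {#} x \<in> U" by (auto simp: below_def)
  then show "x \<in> U" by (simp add: T_empty)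
qed

lemma subgroup_tail:
  assumes "\<alpha> \<in> monomials"
  shows "subgroup (tail \<alpha>) G"
  unfolding tail_def
  using group_hom.subgroup_img_is_subgroup[OF T_group_hom[OF assms] subgroup_below] U_subgroup
  by (rule mult_subgroups)

lemma U_subset_tail:
  assumes "\<alpha> \<in> monomials"
  shows "U \<subseteq> tail \<alpha>"
proof
  fix u assume u: "u \<in> U"
  have "T \<alpha> \<one> \<in> T \<alpha> ` below \<alpha>" using subgroup.one_closed[OF subgroup_below] by blast
  then show "u \<in> tail \<alpha>" unfolding tail_def using mem_set_multI[of \<one> _ u U G] u assms by (simp add: T_one)
qed

lemma T_below:
  assumes "\<alpha> \<in> monomials" "\<gamma> \<in> monomials" "x \<in> below (\<alpha> + \<gamma>)"
  shows "T \<gamma> x \<in> below \<alpha>"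
proof -
  have x: "x \<in> carrier G" using assms by (simp add: below_def)
  have "T \<beta> (T \<gamma> x) \<in> U" if "\<beta> \<in> monomials" "\<beta> \<triangleleft> \<alpha>" for \<beta>
  proof -
    have "T (\<beta> + \<gamma>) x \<in> U" using assms that deglex_add[OF that(2)] unfolding below_def by auto
    then show ?thesis using T_add that assms x by simp
  qed
  then show ?thesis using assms x by (simp add: below_def)
qed

text \<open>Shifting \<open>x\<close> by \<open>T \<gamma>\<close> turns a coordinate at
  \<open>\<alpha> + \<gamma>\<close> into one at \<open>\<alpha>\<close>, and \<open>T_below\<close>
  keeps the earlier coordinates trivial. The inclusion runs opposite to that of
  \<open>lead_shift\<close>.\<close>

lemma tail_shift:
  assumes "\<alpha> \<in> monomials" "\<gamma> \<in> monomials"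
  shows "tail (\<alpha> + \<gamma>) \<subseteq> tail \<alpha>"
proof -
  have "T (\<alpha> + \<gamma>) ` below (\<alpha> + \<gamma>) \<subseteq> T \<alpha> ` below \<alpha>"
  proof clarify
    fix x assume x: "x \<in> below (\<alpha> + \<gamma>)"
    then have "T (\<alpha> + \<gamma>) x = T \<alpha> (T \<gamma> x)" using assms T_add by (simp add: below_def)
    then show "T (\<alpha> + \<gamma>) x \<in> T \<alpha> ` below \<alpha>" using T_below[OF assms x] by blast
  qed
  then show ?thesis unfolding tail_def by (rule mono_set_mult) simp
qed

text \<open>In positive degree the elements of \<open>below\<close> lie in \<open>U\<close> itself,
  so tails are no larger than a product of \<open>U\<close> with one of its images. This is the
  source of finiteness modulo \<open>U\<close>.\<close>

lemma tail_bounded: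
  assumes "\<alpha> \<in> monomials" "\<alpha> \<noteq> {#}"
  obtains j where "j \<in> J" "tail \<alpha> \<subseteq> T {#j#} ` U <#> U"
proof -
  obtain j \<beta> where \<alpha>: "\<alpha> = add_mset j \<beta>" using assms(2) by (metis multiset_cases)
  have j: "j \<in> J" "\<beta> \<in> monomials" "{#j#} \<in> monomials" using \<alpha> assms by auto
  have "tail \<alpha> \<subseteq> tail {#j#}" using tail_shift[OF j(3,2)] by (simp add: \<alpha>)
  also have "\<dots> \<subseteq> T {#j#} ` U <#> U"
    unfolding tail_def using below_subset_U[of "{#j#}"] by (intro mono_set_mult image_mono) auto
  finally show ?thesis using that j by blast
qed

text \<open>Otherwise there are degrees of unbounded size at which every single variable shrinks the
  tail. Along a subsequence increasing for divisibility the tails then decrease strictly, although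
  they all contain \<open>U\<close> and the first meets only finitely many cosets of
  \<open>U\<close>.\<close>

lemma tail_eventually_constant:
  assumes fin: "\<And>j. j \<in> J \<Longrightarrow> \<exists>F. finite F \<and> F \<subseteq> carrier G \<and> T {#j#} ` U \<subseteq> F <#> U"
  shows "\<exists>n0>0. \<forall>\<alpha>\<in>monomials. size \<alpha> \<ge> n0 \<longrightarrow> (\<exists>j\<in>J. tail (\<alpha> + {#j#}) = tail \<alpha>)"
proof (rule ccontr)
  assume contra: "\<not> ?thesis"
  define bad where "bad \<alpha> \<longleftrightarrow> \<alpha> \<in> monomials \<and> \<alpha> \<noteq> {#} \<and> (\<forall>j\<in>J. tail (\<alpha> + {#j#}) \<noteq> tail \<alpha>)" for \<alpha>
  have bad_ex: "\<exists>\<alpha>. bad \<alpha> \<and> size \<alpha> > n" for n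
  proof -
    obtain \<alpha> where "\<alpha> \<in> monomials" "size \<alpha> \<ge> Suc n" "\<forall>j\<in>J. tail (\<alpha> + {#j#}) \<noteq> tail \<alpha>"
      using contra by blast
    then show ?thesis unfolding bad_def by (intro exI[of _ \<alpha>]) auto
  qed
  \<comment> \<open>Strictly growing sizes ensure that comparable degrees in the subsequence differ,
    so that at least one variable separates them.\<close>
  have "\<exists>a. \<forall>n::nat. bad (a n) \<and> size (a n) < size (a (Suc n))"
    by (rule dependent_nat_choice) (use bad_ex in blast)+
  then obtain a where a: "\<And>n::nat. bad (a n)" "\<And>n. size (a n) < size (a (Suc n))" by blast
  have size_mono: "strict_mono (\<lambda>n. size (a n))" using a(2) by (simp add: strict_mono_Suc_iff)
  obtain r :: "nat \<Rightarrow> nat" where r: "strict_mono r" "\<And>i j. i \<le> j \<Longrightarrow> a (r i) \<subseteq># a (r j)"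
    using dickson[OF finite_J, of a] a(1) unfolding bad_def by blast
  define H where "H i = tail (a (r i))" for i
  have amon: "a n \<in> monomials" "a n \<noteq> {#}" for n using a(1) by (auto simp: bad_def)
  have H: "subgroup (H i) G" "U \<subseteq> H i" for i unfolding H_def using subgroup_tail U_subset_tail amon by blast+
  have strict: "H (Suc i) \<subset> H i" for i
  proof -
    let ?d = "a (r (Suc i)) - a (r i)"
    have eq: "a (r i) + ?d = a (r (Suc i))" using r(2)[of i "Suc i"] by simp
    have "size (a (r i)) < size (a (r (Suc i)))"
      using strict_monoD[OF size_mono strict_monoD[OF r(1), of i "Suc i"]] by simp
    then have "?d \<noteq> {#}" using eq by (metis add.right_neutral less_irrefl)
    then obtain j \<delta> where \<delta>: "?d = add_mset j \<delta>" by (metis multiset_cases)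
    have "set_mset ?d \<subseteq> J" using amon(1)[of "r (Suc i)"] by (auto dest: in_diffD)
    then have j: "j \<in> J" "\<delta> \<in> monomials" using \<delta> by auto
    have "a (r (Suc i)) = (a (r i) + {#j#}) + \<delta>" using eq \<delta> by simp
    moreover have mon: "a (r i) + {#j#} \<in> monomials" using amon j by simp
    ultimately have "H (Suc i) \<subseteq> tail (a (r i) + {#j#})"
      unfolding H_def using tail_shift[OF mon j(2)] by simp
    moreover have "tail (a (r i) + {#j#}) \<subseteq> H i"
      unfolding H_def using j amon by (intro tail_shift) auto
    moreover have "tail (a (r i) + {#j#}) \<noteq> H i" unfolding H_def using a(1) j by (auto simp: bad_def)
    ultimately show ?thesis by blast
  qed
  obtain j where j: "j \<in> J" "H 0 \<subseteq> T {#j#} ` U <#> U" unfolding H_def using tail_bounded[OF amon] by blast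
  obtain F where F: "finite F" "F \<subseteq> carrier G" "T {#j#} ` U \<subseteq> F <#> U" using fin[OF j(1)] by blast
  have "H 0 \<subseteq> (F <#> U) <#> U" using j(2) mono_set_mult[OF F(3) order_refl, of G U] by blast
  also have "\<dots> = F <#> U" using set_mult_assoc[OF F(2) U.subset U.subset] subgroup_mult_id[OF U_subgroup] by simp
  finally have H0: "H 0 \<subseteq> F <#> U" .
  have dec: "H i \<subseteq> H 0" for i by (induction i) (use strict in blast)+
  \<comment> \<open>The center \<open>f\<close> of a coset of \<open>U\<close> belongs to the same
    groups \<open>H\<close> as the whole coset, so strict descent is visible on the finite set
    \<open>F\<close>.\<close>
  have "H (Suc i) \<inter> F \<subset> H i \<inter> F" for i
  proof -
    obtain x where x: "x \<in> H i" "x \<notin> H (Suc i)" using strict by blast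
    interpret Hi: subgroup "H i" G by (rule H)
    interpret HS: subgroup "H (Suc i)" G by (rule H)
    obtain f u where fu: "f \<in> F" "u \<in> U" "x = f \<otimes> u" using x dec H0 by (blast elim: mem_set_multE)
    have C: "f \<in> carrier G" "u \<in> carrier G" using fu F by auto
    have "f = x \<otimes> inv u" using fu C by (simp add: m_assoc)
    then have "f \<in> H i" using x fu H(2) by blast
    moreover have "f \<notin> H (Suc i)" using x fu H(2) by blast
    ultimately show ?thesis using fu strict by blast
  qed
  then have card: "card (H (Suc i) \<inter> F) < card (H i \<inter> F)" for i using F(1) by (intro psubset_card_mono) auto
  have "card (H i \<inter> F) + i \<le> card (H 0 \<inter> F)" for i
  proof (induction i)
    case (Suc i) then show ?case using card[of i] by simp
  qed simp
  from this[of "Suc (card (H 0 \<inter> F))"] show False by simp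
qed

text \<open>Constancy of the tail provides \<open>v\<close> in
  \<open>below (\<alpha> + {#j#})\<close> such that \<open>T {#j#} v\<close> has the same coordinate
  at \<open>\<alpha>\<close> as \<open>u\<close>. Division by
  \<open>T {#j#} v \<otimes> inv v\<close> leaves the coordinate
  \<open>s \<otimes> T \<alpha> v\<close>, and \<open>T \<alpha> v\<close> is in \<open>U\<close>
  because \<open>\<alpha>\<close> precedes \<open>\<alpha> + {#j#}\<close>.\<close>

lemma below_step:
  assumes \<alpha>: "\<alpha> \<in> monomials" "\<alpha> \<noteq> {#}" and j: "j \<in> J" and eq: "tail (\<alpha> + {#j#}) = tail \<alpha>"
    and u: "u \<in> below \<alpha>"
  obtains v w where "v \<in> U" "T {#j#} v \<in> U" "w \<in> below \<alpha>" "T \<alpha> w \<in> U" "u = (T {#j#} v \<otimes> inv v) \<otimes> w"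
proof -
  interpret bel: subgroup "below \<alpha>" G by (rule subgroup_below)
  have jm: "{#j#} \<in> monomials" using j by simp
  have lt: "\<alpha> \<triangleleft> \<alpha> + {#j#}" "{#} \<triangleleft> \<alpha> + {#j#}" "{#j#} \<triangleleft> \<alpha> + {#j#}"
    using \<alpha>(2) by (simp_all add: deglex_if_size_less nonempty_has_size)
  have uC: "u \<in> carrier G" using u by simp
  have "T \<alpha> u \<otimes> \<one> \<in> tail \<alpha>" unfolding tail_def using u by (intro mem_set_multI) auto
  then have "T \<alpha> u \<in> tail (\<alpha> + {#j#})" using eq uC \<alpha> by simp
  then obtain t s where ts: "t \<in> T (\<alpha> + {#j#}) ` below (\<alpha> + {#j#})" "s \<in> U" "T \<alpha> u = t \<otimes> s"
    unfolding tail_def by (rule mem_set_multE)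
  then obtain v where v: "v \<in> below (\<alpha> + {#j#})" "T \<alpha> u = T (\<alpha> + {#j#}) v \<otimes> s" by blast
  have vC: "v \<in> carrier G" using v(1) unfolding below_def by blast
  have vb: "v \<in> below \<alpha>" using v(1) below_mono[OF lt(1)] by blast
  have Tv: "T {#j#} v \<in> below \<alpha>" using T_below[OF \<alpha>(1) jm v(1)] .
  have vU: "T \<alpha> v \<in> U" "v \<in> U" "T {#j#} v \<in> U"
    using v(1) lt \<alpha>(1) jm below_subset_U[of "\<alpha> + {#j#}"] unfolding below_def by auto
  have TC: "T {#j#} v \<in> carrier G" by (rule T_closed[OF jm vC])
  have aj: "\<alpha> + {#j#} \<in> monomials" using \<alpha>(1) j by simp
  have TC': "T (\<alpha> + {#j#}) v \<in> carrier G" "s \<in> carrier G" "T \<alpha> v \<in> carrier G"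
    using T_closed[OF aj vC] T_closed[OF \<alpha>(1) vC] ts(2) by simp_all
  define w where "w = u \<otimes> inv (T {#j#} v) \<otimes> v"
  have "w \<in> below \<alpha>" unfolding w_def using u vb Tv by blast
  moreover have "T \<alpha> w \<in> U"
  proof -
    have "T \<alpha> w = T \<alpha> u \<otimes> inv (T \<alpha> (T {#j#} v)) \<otimes> T \<alpha> v"
      unfolding w_def using uC vC TC \<alpha>(1) by (simp add: T_mult T_inv)
    also have "T \<alpha> (T {#j#} v) = T (\<alpha> + {#j#}) v" using T_add'[OF \<alpha>(1) jm vC] by simp
    also have "T \<alpha> u \<otimes> inv (T (\<alpha> + {#j#}) v) \<otimes> T \<alpha> v
        = (T (\<alpha> + {#j#}) v \<otimes> inv (T (\<alpha> + {#j#}) v)) \<otimes> (s \<otimes> T \<alpha> v)"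
      unfolding v(2) using TC' by (simp only: m_ac m_closed inv_closed)
    also have "\<dots> = s \<otimes> T \<alpha> v" using TC' by simp
    finally show ?thesis using ts(2) vU(1) by auto
  qed
  moreover have "u = (T {#j#} v \<otimes> inv v) \<otimes> w"
  proof -
    have "(T {#j#} v \<otimes> inv v) \<otimes> w = u \<otimes> (T {#j#} v \<otimes> inv (T {#j#} v)) \<otimes> (v \<otimes> inv v)"
      unfolding w_def using uC vC TC by (simp only: m_ac m_closed inv_closed)
    then show ?thesis using uC vC TC by simp
  qed
  ultimately show thesis using that vU by blast
qed

text \<open>Coordinates are made trivial one after another in the graded order, each at the cost of
  a factor in \<open>I\<close>. Those of size below \<open>n0\<close> are trivial from the start,
  and for the others \<open>below_step\<close> is available.\<close>

theorem below_approximation: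
  assumes n0: "n0 > 0" "\<And>\<alpha>. \<alpha> \<in> monomials \<Longrightarrow> size \<alpha> \<ge> n0 \<Longrightarrow> \<exists>j\<in>J. tail (\<alpha> + {#j#}) = tail \<alpha>"
    and I: "subgroup I G" "\<And>j v. j \<in> J \<Longrightarrow> v \<in> U \<Longrightarrow> T {#j#} v \<in> U \<Longrightarrow> T {#j#} v \<otimes> inv v \<in> I"
    and x: "x \<in> carrier G" "\<And>\<beta>. \<beta> \<in> monomials \<Longrightarrow> size \<beta> < n0 \<Longrightarrow> T \<beta> x \<in> U"
  shows "x \<in> I <#> below \<alpha>"
proof (induction \<alpha> rule: wfp_induct_rule[OF wfp_deglex])
  case (1 \<alpha>)
  interpret I: subgroup I G by (rule I)
  let ?P = "{\<beta>. set_mset \<beta> \<subseteq> J \<and> \<beta> \<triangleleft> \<alpha>}"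
  show ?case
  proof (cases "\<forall>\<beta>\<in>?P. size \<beta> < n0")
    case True
    then have "x \<in> below \<alpha>" unfolding below_def using x by blast
    then show ?thesis using mem_set_multI[of \<one> I x _ G] x(1) by simp
  next
    case False
    \<comment> \<open>Only finitely many monomials precede \<open>\<alpha>\<close>, so there is a
      last one; its coordinate is the only one still to be treated.\<close>
    then have "?P \<noteq> {}" by blast
    moreover have asym: "asymp_on ?P (\<triangleleft>)" using deglex_irrefl deglex_trans by (blast intro: asymp_onI)
    moreover have trans: "transp_on ?P (\<triangleleft>)" using deglex_trans by (blast intro: transp_onI)
    ultimately obtain \<beta> where \<beta>: "\<beta> \<in> ?P" "\<And>\<gamma>. \<gamma> \<in> ?P \<Longrightarrow> \<gamma> \<noteq> \<beta> \<Longrightarrow> \<not> \<beta> \<triangleleft> \<gamma>"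
      using Finite_Set.bex_max_element[OF finite_deglex_below[OF finite_J, of \<alpha>] asym trans] by blast
    then have max: "\<gamma> = \<beta> \<or> \<gamma> \<triangleleft> \<beta>" if "\<gamma> \<in> ?P" for \<gamma> using that deglex_linear by blast
    obtain \<gamma> where \<gamma>: "\<gamma> \<in> ?P" "size \<gamma> \<ge> n0" using False by (auto simp: not_less)
    then have sz: "size \<beta> \<ge> n0" using max[OF \<gamma>(1)] by (auto simp: deglex_def)
    have \<beta>m: "\<beta> \<in> monomials" "\<beta> \<noteq> {#}" using \<beta> sz n0(1) by auto
    obtain j where j: "j \<in> J" "tail (\<beta> + {#j#}) = tail \<beta>" using n0(2)[OF \<beta>m(1) sz] by blast
    have "x \<in> I <#> below \<beta>" using 1 \<beta> by blast
    then obtain i y where iy: "i \<in> I" "y \<in> below \<beta>" "x = i \<otimes> y" by (rule mem_set_multE)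
    obtain v w where vw: "v \<in> U" "T {#j#} v \<in> U" "w \<in> below \<beta>" "T \<beta> w \<in> U" "y = (T {#j#} v \<otimes> inv v) \<otimes> w"
      using below_step[OF \<beta>m j iy(2)] by blast
    have wC: "w \<in> carrier G" using vw(3) by (simp add: below_def)
    have "w \<in> below \<alpha>" unfolding below_def
    proof (intro CollectI conjI ballI impI wC)
      fix \<gamma> assume "\<gamma> \<in> monomials" "\<gamma> \<triangleleft> \<alpha>"
      then show "T \<gamma> w \<in> U" using max[of \<gamma>] vw(3,4) unfolding below_def by blast
    qed
    moreover have "x = (i \<otimes> (T {#j#} v \<otimes> inv v)) \<otimes> w"
      unfolding iy(3) vw(5) using iy(1) vw wC by (simp add: m_assoc)
    moreover have "i \<otimes> (T {#j#} v \<otimes> inv v) \<in> I" using iy(1) I(2)[OF j(1) vw(1,2)] by blast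
    ultimately show ?thesis by (simp add: mem_set_multI)
  qed
qed

end

section \<open>Topological groups\<close>

lemma prod_topology_open_rectangle:
  assumes "openin (prod_topology S S') W" "(x, y) \<in> W"
  obtains U V where "openin S U" "openin S' V" "x \<in> U" "y \<in> V" "U \<times> V \<subseteq> W"
  using assms by (force simp: openin_prod_topology_alt)

locale topo_group = group G for G (structure) +
  fixes T :: "'a topology"
  assumes topspace_eq: "topspace T = carrier G"
    and cont_mult: "continuous_map (prod_topology T T) T (\<lambda>(x, y). x \<otimes> y)"
    and cont_inv: "continuous_map T T (m_inv G)"
begin

lemma continuous_mult:
  assumes "continuous_map S T f" "continuous_map S T g"
  shows "continuous_map S T (\<lambda>x. f x \<otimes> g x)"
  using continuous_map_compose[OF continuous_map_pairedI[OF assms] cont_mult] by (simp add: o_def)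

lemma continuous_inv:
  assumes "continuous_map S T f"
  shows "continuous_map S T (\<lambda>x. inv (f x))"
  using continuous_map_compose[OF assms cont_inv] by (simp add: o_def)

lemma continuous_const: "c \<in> carrier G \<Longrightarrow> continuous_map S T (\<lambda>x. c)"
  by (simp add: topspace_eq)

lemma compact_carrier: "compactin T K \<Longrightarrow> K \<subseteq> carrier G"
  using compactin_subset_topspace topspace_eq by blast

lemma open_carrier: "openin T O' \<Longrightarrow> O' \<subseteq> carrier G"
  using openin_subset topspace_eq by blast

lemma closed_carrier: "closedin T C \<Longrightarrow> C \<subseteq> carrier G"
  using closedin_subset topspace_eq by blast

lemma open_left_preimage:
  assumes "openin T O'" "g \<in> carrier G"
  shows "openin T {x \<in> carrier G. g \<otimes> x \<in> O'}"
proof -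
  have "continuous_map T T (\<lambda>x. g \<otimes> x)" using assms by (intro continuous_mult continuous_const) auto
  from openin_continuous_map_preimage[OF this assms(1)] show ?thesis by (simp add: topspace_eq)
qed

lemma open_set_mult:
  assumes "openin T O'" "A \<subseteq> carrier G"
  shows "openin T (A <#> O')"
proof -
  have "A <#> O' = (\<Union>a\<in>A. {x \<in> carrier G. inv a \<otimes> x \<in> O'})" (is "_ = ?R")
  proof (intro equalityI subsetI)
    fix x assume "x \<in> A <#> O'"
    then obtain a b where ab: "a \<in> A" "b \<in> O'" "x = a \<otimes> b" by (rule mem_set_multE)
    then have "a \<in> carrier G" "b \<in> carrier G" using assms open_carrier by auto
    then have "x \<in> carrier G" "inv a \<otimes> x = b" using ab by (simp_all flip: m_assoc)
    then show "x \<in> ?R" using ab by blast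
  next
    fix x assume "x \<in> ?R"
    then obtain a where a: "a \<in> A" "x \<in> carrier G" "inv a \<otimes> x \<in> O'" by blast
    then have "x = a \<otimes> (inv a \<otimes> x)" using assms by (auto simp flip: m_assoc)
    then show "x \<in> A <#> O'" using a mem_set_multI[of a A "inv a \<otimes> x" O' G] by simp
  qed
  moreover have "openin T ?R" using assms by (intro openin_Union) (auto intro!: open_left_preimage)
  ultimately show ?thesis by simp
qed

lemma compact_set_mult:
  assumes "compactin T K" "compactin T L"
  shows "compactin T (K <#> L)"
proof -
  have "compactin (prod_topology T T) (K \<times> L)" using assms by (simp add: compactin_Times)
  from image_compactin[OF this cont_mult] have "compactin T ((\<lambda>(x, y). x \<otimes> y) ` (K \<times> L))" .
  moreover have "(\<lambda>(x, y). x \<otimes> y) ` (K \<times> L) = K <#> L" by (auto simp: set_mult_def)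
  ultimately show ?thesis by simp
qed

lemma compact_set_inv: "compactin T K \<Longrightarrow> compactin T (m_inv G ` K)"
  using cont_inv image_compactin by blast

lemma nbhd_quotient:
  assumes "openin T O'" "\<one> \<in> O'"
  obtains V where "openin T V" "\<one> \<in> V" "\<And>x y. x \<in> V \<Longrightarrow> y \<in> V \<Longrightarrow> inv x \<otimes> y \<in> O'"
proof -
  let ?W = "{p \<in> topspace (prod_topology T T). inv (fst p) \<otimes> snd p \<in> O'}"
  have "continuous_map (prod_topology T T) T (\<lambda>p. inv (fst p) \<otimes> snd p)"
    by (intro continuous_mult continuous_inv continuous_map_fst continuous_map_snd)
  from openin_continuous_map_preimage[OF this assms(1)] have "openin (prod_topology T T) ?W" .
  moreover have "(\<one>, \<one>) \<in> ?W" using assms by (simp add: topspace_eq)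
  ultimately obtain V1 V2 where V: "openin T V1" "openin T V2" "\<one> \<in> V1" "\<one> \<in> V2" "V1 \<times> V2 \<subseteq> ?W"
    by (rule prod_topology_open_rectangle)
  show thesis
    by (rule that[of "V1 \<inter> V2"]) (use V in auto)
qed

lemma compact_finite_cover:
  assumes K: "compactin T K" and O': "openin T O'" "\<one> \<in> O'"
  obtains F where "finite F" "F \<subseteq> K" "K \<subseteq> F <#> O'"
proof -
  have KC: "K \<subseteq> carrier G" using K compact_carrier by blast
  let ?U = "\<lambda>f. {f} <#> O'"
  have "openin T (?U f)" if "f \<in> K" for f using that KC by (intro open_set_mult O') auto
  moreover have "K \<subseteq> \<Union>(?U ` K)"
  proof
    fix x assume x: "x \<in> K"
    then have "x = x \<otimes> \<one>" using KC by auto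
    then have "x \<in> ?U x" using O'(2) by (metis mem_set_multI singletonI)
    then show "x \<in> \<Union>(?U ` K)" using x by blast
  qed
  ultimately obtain \<F> where \<F>: "finite \<F>" "\<F> \<subseteq> ?U ` K" "K \<subseteq> \<Union>\<F>"
    using K unfolding compactin_def by (metis (no_types, lifting) imageE)
  obtain F where F: "F \<subseteq> K" "finite F" "\<F> = ?U ` F" using finite_subset_image[OF \<F>(1,2)] by blast
  have "K \<subseteq> F <#> O'" using \<F>(3) unfolding F(3) by (auto simp: set_mult_def)
  then show thesis using that F by blast
qed

text \<open>The centers must lie in \<open>S\<close>, which need not be compact. Hence
  \<open>L\<close> is covered by translates of a smaller neighbourhood, and each translate that
  meets \<open>S\<close> is recentered at a point of \<open>S\<close>.\<close>

lemma relatively_compact_finite_cover: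
  assumes L: "compactin T L" "S \<subseteq> L" and O': "openin T O'" "\<one> \<in> O'"
  obtains F where "finite F" "F \<subseteq> S" "S \<subseteq> F <#> O'"
proof -
  obtain V where V: "openin T V" "\<one> \<in> V" "\<And>x y. x \<in> V \<Longrightarrow> y \<in> V \<Longrightarrow> inv x \<otimes> y \<in> O'"
    using nbhd_quotient[OF O'] by blast
  obtain E where E: "finite E" "E \<subseteq> L" "L \<subseteq> E <#> V" using compact_finite_cover[OF L(1) V(1,2)] by blast
  define E' where "E' = {e \<in> E. \<exists>v\<in>V. e \<otimes> v \<in> S}"
  have "\<forall>e\<in>E'. \<exists>v. v \<in> V \<and> e \<otimes> v \<in> S" unfolding E'_def by blast
  from bchoice[OF this] obtain c where c: "\<And>e. e \<in> E' \<Longrightarrow> c e \<in> V \<and> e \<otimes> c e \<in> S" by blast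
  let ?F = "(\<lambda>e. e \<otimes> c e) ` E'"
  have "finite ?F" using E(1) by (simp add: E'_def)
  moreover have "?F \<subseteq> S" using c by blast
  moreover have "S \<subseteq> ?F <#> O'"
  proof
    fix x assume x: "x \<in> S"
    then obtain e v where ev: "e \<in> E" "v \<in> V" "x = e \<otimes> v" using L E by (blast elim: mem_set_multE)
    then have e: "e \<in> E'" using x by (auto simp: E'_def)
    have C: "e \<in> carrier G" "v \<in> carrier G" "c e \<in> carrier G"
      using ev c[OF e] E(2) compact_carrier[OF L(1)] open_carrier[OF V(1)] by auto
    have "e \<otimes> c e \<otimes> (inv (c e) \<otimes> v) = e \<otimes> (c e \<otimes> inv (c e)) \<otimes> v" using C by (simp only: m_assoc m_closed inv_closed)
    then have "x = (e \<otimes> c e) \<otimes> (inv (c e) \<otimes> v)" using ev C by simp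
    then show "x \<in> ?F <#> O'" using e V(3)[of "c e" v] c[OF e] ev by (simp add: mem_set_multI)
  qed
  ultimately show thesis using that by blast
qed

text \<open>The tube lemma at the identity, whose commutators with \<open>K\<close> are all trivial.
  It will show that elements near the identity normalise a subgroup generated by a compact
  set.\<close>

lemma commutator_tube:
  assumes K: "compactin T K" and O': "openin T O'" "\<one> \<in> O'"
  obtains V where "openin T V" "\<one> \<in> V" "\<And>g x. g \<in> V \<Longrightarrow> x \<in> K \<Longrightarrow> g \<otimes> x \<otimes> inv g \<otimes> inv x \<in> O'"
proof -
  have KC: "K \<subseteq> carrier G" using K compact_carrier by blast
  let ?W = "{p \<in> topspace (prod_topology T T). fst p \<otimes> snd p \<otimes> inv (fst p) \<otimes> inv (snd p) \<in> O'}"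
  have "continuous_map (prod_topology T T) T (\<lambda>p. fst p \<otimes> snd p \<otimes> inv (fst p) \<otimes> inv (snd p))"
    by (intro continuous_mult continuous_inv continuous_map_fst continuous_map_snd)
  from openin_continuous_map_preimage[OF this O'(1)] have "openin (prod_topology T T) ?W" .
  moreover have "{\<one>} \<times> K \<subseteq> ?W" using KC O' by (auto simp: topspace_eq)
  ultimately obtain V V' where V: "openin T V" "\<one> \<in> V" "K \<subseteq> V'" "V \<times> V' \<subseteq> ?W"
    using tube_lemma_right[of T T ?W K \<one>] K topspace_eq by (metis (no_types, lifting) one_closed)
  have "g \<otimes> x \<otimes> inv g \<otimes> inv x \<in> O'" if "g \<in> V" "x \<in> K" for g x
  proof -
    have "(g, x) \<in> ?W" using that V(3,4) by blast
    then show ?thesis by simp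
  qed
  then show thesis using that V(1,2) by blast
qed

text \<open>For \<open>x\<close> outside the product, the compact set \<open>K \<times> {x}\<close>
  lies in the open set of pairs \<open>(k, y)\<close> with \<open>inv k \<otimes> y\<close> not in
  \<open>C\<close>; the tube lemma yields a neighbourhood of \<open>x\<close>.\<close>

lemma closed_compact_mult:
  assumes K: "compactin T K" and C: "closedin T C"
  shows "closedin T (K <#> C)"
proof -
  have KC: "K \<subseteq> carrier G" and CC: "C \<subseteq> carrier G" using K compact_carrier C closed_carrier by blast+
  have "openin T (carrier G - (K <#> C))"
  proof (subst openin_subopen, intro ballI)
    fix x assume x: "x \<in> carrier G - (K <#> C)"
    let ?W = "{p \<in> topspace (prod_topology T T). inv (fst p) \<otimes> snd p \<in> carrier G - C}"
    have "continuous_map (prod_topology T T) T (\<lambda>p. inv (fst p) \<otimes> snd p)"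
      by (intro continuous_mult continuous_inv continuous_map_fst continuous_map_snd)
    moreover have "openin T (carrier G - C)" using C topspace_eq by (metis closedin_def)
    ultimately have "openin (prod_topology T T) ?W" by (rule openin_continuous_map_preimage)
    moreover have "K \<times> {x} \<subseteq> ?W"
    proof clarify
      fix k assume k: "k \<in> K"
      then have kC: "k \<in> carrier G" using KC by blast
      have "inv k \<otimes> x \<notin> C"
      proof
        assume "inv k \<otimes> x \<in> C"
        then have "k \<otimes> (inv k \<otimes> x) \<in> K <#> C" using k by (intro mem_set_multI)
        then show False using x kC by (simp flip: m_assoc)
      qed
      then show "(k, x) \<in> topspace (prod_topology T T) \<and> inv (fst (k, x)) \<otimes> snd (k, x) \<in> carrier G - C"
        using x kC by (simp add: topspace_eq)
    qed
    ultimately obtain U V where UV: "openin T V" "K \<subseteq> U" "x \<in> V" "U \<times> V \<subseteq> ?W"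
      using tube_lemma_left[of T T ?W K x] K x topspace_eq by (metis (no_types, lifting) DiffD1)
    have "V \<inter> (K <#> C) = {}"
    proof (rule ccontr)
      assume "V \<inter> (K <#> C) \<noteq> {}"
      then obtain y k c where y: "y \<in> V" "k \<in> K" "c \<in> C" "y = k \<otimes> c" by (blast elim: mem_set_multE)
      then have "(k, y) \<in> ?W" using UV(2,4) by blast
      then have "inv k \<otimes> y \<notin> C" by simp
      moreover have "k \<in> carrier G" "c \<in> carrier G" using y KC CC by auto
      then have "inv k \<otimes> y = c" using y(4) by (simp flip: m_assoc)
      ultimately show False using y by simp
    qed
    then show "\<exists>V. openin T V \<and> x \<in> V \<and> V \<subseteq> carrier G - (K <#> C)"
      using UV(1,3) open_carrier[OF UV(1)] by blast
  qed
  moreover have "K <#> C \<subseteq> carrier G" using KC CC by (rule set_mult_closed)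
  ultimately show ?thesis by (simp add: closedin_def topspace_eq)
qed

section \<open>Closures of subgroups\<close>

lemma subgroup_closure:
  assumes "subgroup H G"
  shows "subgroup (T closure_of H) G"
proof
  interpret H: subgroup H G by fact
  let ?C = "T closure_of H"
  show "?C \<subseteq> carrier G" using closure_of_subset_topspace topspace_eq by metis
  show "\<one> \<in> ?C" using closure_of_subset[of H T] H.subset topspace_eq by auto
  fix x y assume x: "x \<in> ?C" and y: "y \<in> ?C"
  have "(\<lambda>(x, y). x \<otimes> y) ` (?C \<times> ?C) \<subseteq> T closure_of ((\<lambda>(x, y). x \<otimes> y) ` (H \<times> H))"
    using continuous_map_image_closure_subset[OF cont_mult, of "H \<times> H"] by (simp add: closure_of_Times)
  also have "\<dots> \<subseteq> ?C" by (rule closure_of_mono) auto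
  finally show "x \<otimes> y \<in> ?C" using x y by auto
  have "m_inv G ` ?C \<subseteq> T closure_of (m_inv G ` H)" by (rule continuous_map_image_closure_subset[OF cont_inv])
  also have "\<dots> \<subseteq> ?C" by (rule closure_of_mono) auto
  finally show "inv x \<in> ?C" using x by blast
qed

lemma normal_closure:
  assumes "H \<lhd> G"
  shows "(T closure_of H) \<lhd> G"
proof (rule normal_invI)
  interpret H: normal H G by fact
  show "subgroup (T closure_of H) G" using H.subgroup_axioms by (rule subgroup_closure)
  fix x h assume x: "x \<in> carrier G" and h: "h \<in> T closure_of H"
  have "continuous_map T T (\<lambda>h. x \<otimes> h \<otimes> inv x)"
    using x by (intro continuous_mult continuous_inv continuous_const continuous_map_id[unfolded id_def]) auto
  from continuous_map_image_closure_subset[OF this, of H]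
  have "(\<lambda>h. x \<otimes> h \<otimes> inv x) ` (T closure_of H) \<subseteq> T closure_of ((\<lambda>h. x \<otimes> h \<otimes> inv x) ` H)" .
  also have "\<dots> \<subseteq> T closure_of H" using x H.inv_op_closed2 by (intro closure_of_mono) auto
  finally show "x \<otimes> h \<otimes> inv x \<in> T closure_of H" using h by blast
qed

text \<open>Centralisers are closed in a Hausdorff group. The closure is inserted in one argument
  first and then, with that element fixed, in the other.\<close>

lemma commute_closure:
  assumes T2: "Hausdorff_space T" and A: "A \<subseteq> carrier G"
    and comm: "\<And>x y. x \<in> A \<Longrightarrow> y \<in> A \<Longrightarrow> x \<otimes> y = y \<otimes> x"
    and x: "x \<in> T closure_of A" and y: "y \<in> T closure_of A"
  shows "x \<otimes> y = y \<otimes> x"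
proof -
  have cl: "closedin T {x \<in> topspace T. x \<otimes> y = y \<otimes> x}" if "y \<in> carrier G" for y
    using that by (intro closedin_continuous_maps_eq[OF T2] continuous_mult continuous_const continuous_map_id[unfolded id_def])
  have sub: "T closure_of A \<subseteq> carrier G" using closure_of_subset_topspace topspace_eq by metis
  have "T closure_of A \<subseteq> {x \<in> topspace T. x \<otimes> y = y \<otimes> x}" if "y \<in> A" for y
    using that A comm by (intro closure_of_minimal cl) (auto simp: topspace_eq)
  then have "A \<subseteq> {z \<in> topspace T. z \<otimes> x = x \<otimes> z}" using x A topspace_eq by fastforce
  then have "T closure_of A \<subseteq> {z \<in> topspace T. z \<otimes> x = x \<otimes> z}"
    using x sub by (intro closure_of_minimal cl) auto
  then show ?thesis using y by auto
qed

text \<open>An open subgroup is closed; here openness is only relative to the closed subgroup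
  \<open>A\<close>. A limit point \<open>x\<close> has a translate of \<open>O'\<close> meeting
  \<open>M\<close>, and the difference lies in \<open>O' \<inter> A\<close>.\<close>

lemma relatively_open_subgroup_closed:
  assumes A: "closedin T A" "subgroup A G" and M: "subgroup M G" "M \<subseteq> A"
    and O': "openin T O'" "\<one> \<in> O'" "O' \<inter> A \<subseteq> M"
  shows "closedin T M"
proof -
  interpret A: subgroup A G by fact
  interpret M: subgroup M G by fact
  have "T closure_of M \<subseteq> M"
  proof
    fix x assume x: "x \<in> T closure_of M"
    then have xA: "x \<in> A" using closure_of_minimal[OF M(2) A(1)] by blast
    have "openin T ({x} <#> O')" using xA by (intro open_set_mult O') auto
    moreover have "x \<in> {x} <#> O'" using mem_set_multI[of x "{x}" \<one> O' G] O' xA by simp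
    ultimately obtain m where m: "m \<in> M" "m \<in> {x} <#> O'" using x unfolding in_closure_of by blast
    then obtain b where b: "b \<in> O'" "m = x \<otimes> b" by (auto elim: mem_set_multE)
    have bC: "b \<in> carrier G" using b O' open_carrier by blast
    then have "b = inv x \<otimes> m" using b xA by (simp flip: m_assoc)
    then have "b \<in> M" using b xA m M(2) O'(3) by blast
    moreover have "x = m \<otimes> inv b" using b bC xA by (simp add: m_assoc)
    ultimately show "x \<in> M" using m by blast
  qed
  moreover have "M \<subseteq> topspace T" using M.subset topspace_eq by simp
  ultimately show ?thesis using closure_of_subset_eq by blast
qed

end

section \<open>Quotients by compact normal subgroups\<close>

context group
begin

lemma normal_set_mult:
  assumes "H \<lhd> G" "K \<lhd> G"
  shows "H <#> K \<lhd> G"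
proof (rule normal_invI)
  interpret H: normal H G by fact
  interpret K: normal K G by fact
  show "subgroup (H <#> K) G"
    using mult_norm_subgroup[OF assms(1) K.subgroup_axioms] by simp
  fix x y assume x: "x \<in> carrier G" and y: "y \<in> H <#> K"
  then obtain h k where hk: "h \<in> H" "k \<in> K" "y = h \<otimes> k" by (blast elim: mem_set_multE)
  have C: "h \<in> carrier G" "k \<in> carrier G" using hk by auto
  have "(x \<otimes> h \<otimes> inv x) \<otimes> (x \<otimes> k \<otimes> inv x) = x \<otimes> h \<otimes> (inv x \<otimes> x) \<otimes> k \<otimes> inv x"
    using C x by (simp only: m_assoc m_closed inv_closed)
  then have "x \<otimes> y \<otimes> inv x = (x \<otimes> h \<otimes> inv x) \<otimes> (x \<otimes> k \<otimes> inv x)"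
    using C x hk by (simp add: m_assoc)
  then show "x \<otimes> y \<otimes> inv x \<in> H <#> K"
    using H.inv_op_closed2[OF x hk(1)] K.inv_op_closed2[OF x hk(2)] by (simp add: mem_set_multI)
qed

end

lemma (in normal) rcoset_eq_iff:
  assumes "x \<in> carrier G" "y \<in> carrier G"
  shows "H #> x = H #> y \<longleftrightarrow> x \<otimes> inv y \<in> H"
proof
  assume "H #> x = H #> y"
  then have "x \<in> H #> y" using rcos_self[OF assms(1) subgroup_axioms] by simp
  then show "x \<otimes> inv y \<in> H" using rcos_module_imp[OF is_group assms(2)] by blast
next
  assume "x \<otimes> inv y \<in> H"
  then have "x \<in> H #> y" using rcos_module_rev[OF is_group assms(2,1)] by blast
  then show "H #> x = H #> y" using repr_independence[OF _ assms(2) subgroup_axioms] by blast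
qed

lemma (in normal) Union_rcosets_eq:
  assumes "U \<subseteq> rcosets H"
  shows "\<Union>U = {x \<in> carrier G. H #> x \<in> U}"
proof (intro equalityI subsetI)
  fix x assume "x \<in> \<Union>U"
  then obtain C where C: "C \<in> U" "x \<in> C" by blast
  then obtain a where a: "a \<in> carrier G" "C = H #> a" using assms by (auto simp: RCOSETS_def)
  have "x \<in> carrier G" using C a r_coset_subset_G[OF subset a(1)] by blast
  moreover have "H #> x = C" using repr_independence[OF _ a(1) subgroup_axioms] C a by auto
  ultimately show "x \<in> {x \<in> carrier G. H #> x \<in> U}" using C by simp
next
  fix x assume "x \<in> {x \<in> carrier G. H #> x \<in> U}"
  then show "x \<in> \<Union>U" using rcos_self[OF _ subgroup_axioms] by blast
qed

lemma (in normal) Union_rcoset_image: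
  "\<Union>((\<lambda>x. H #> x) ` S) = H <#> S"
  by (auto simp: r_coset_def set_mult_def)

context topo_group
begin

text \<open>The predicate in \<open>quotient_group_topology\<close> describes the open sets only
  once it is known to be a topology. Intersections need that cosets are disjoint.\<close>

lemma openin_quotient:
  assumes "Z \<lhd> G"
  shows "openin (quotient_group_topology G T Z) U \<longleftrightarrow> U \<subseteq> rcosets Z \<and> openin T (\<Union>U)"
proof -
  interpret Z: normal Z G by fact
  let ?P = "\<lambda>U. U \<subseteq> rcosets Z \<and> openin T (\<Union>U)"
  have "istopology ?P" unfolding istopology_def
  proof (intro conjI allI impI)
    fix R S assume R: "?P R" and S: "?P S"
    have "\<Union>(R \<inter> S) = \<Union>R \<inter> \<Union>S"
      using R S Z.Union_rcosets_eq[of R] Z.Union_rcosets_eq[of S] Z.Union_rcosets_eq[of "R \<inter> S"] by auto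
    then show "openin T (\<Union>(R \<inter> S))" using R S by (simp add: openin_Int)
    show "R \<inter> S \<subseteq> rcosets Z" using R by blast
  next
    fix \<K> assume K: "\<forall>S\<in>\<K>. ?P S"
    then show "\<Union>\<K> \<subseteq> rcosets Z" by blast
    have "\<Union>(\<Union>\<K>) = \<Union>((\<lambda>S. \<Union>S) ` \<K>)" by blast
    then show "openin T (\<Union>(\<Union>\<K>))" using K by (metis (no_types, lifting) imageE openin_Union)
  qed
  then show ?thesis by (simp add: quotient_group_topology_def topology_inverse')
qed

lemma topspace_quotient:
  assumes "Z \<lhd> G"
  shows "topspace (quotient_group_topology G T Z) = rcosets Z"
proof -
  interpret Z: normal Z G by fact
  have "openin (quotient_group_topology G T Z) (rcosets Z)"
    using openin_quotient[OF assms] rcosets_part_G[OF Z.subgroup_axioms] openin_topspace[of T]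
    by (simp add: topspace_eq)
  then show ?thesis using openin_quotient[OF assms] openin_subset openin_topspace by blast
qed

lemma rcosets_mem: "x \<in> carrier G \<Longrightarrow> Z #> x \<in> rcosets Z"
  by (auto simp: RCOSETS_def)

lemma continuous_quotient:
  assumes "Z \<lhd> G"
  shows "continuous_map T (quotient_group_topology G T Z) (\<lambda>x. Z #> x)"
proof -
  interpret Z: normal Z G by fact
  show ?thesis
    unfolding continuous_map openin_quotient[OF assms] topspace_quotient[OF assms]
    using Z.Union_rcosets_eq by (auto simp: topspace_eq rcosets_mem)
qed

lemma open_quotient_image:
  assumes "Z \<lhd> G" "openin T O'"
  shows "openin (quotient_group_topology G T Z) ((\<lambda>x. Z #> x) ` O')"
proof -
  interpret Z: normal Z G by fact
  show ?thesis
    using open_set_mult[OF assms(2) Z.subset] open_carrier[OF assms(2)]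
    by (auto simp: openin_quotient[OF assms(1)] Z.Union_rcoset_image rcosets_mem)
qed

text \<open>The projection is open, so open rectangles in \<open>G\<close> are sent to open
  rectangles in the quotient; this gives joint continuity of the product.\<close>

lemma topo_group_quotient:
  assumes "Z \<lhd> G"
  shows "topo_group (G Mod Z) (quotient_group_topology G T Z)"
proof -
  interpret Z: normal Z G by fact
  interpret Q: group "G Mod Z" by (rule Z.factorgroup_is_group)
  let ?T = "quotient_group_topology G T Z"
  note top = topspace_quotient[OF assms]
  note op = openin_quotient[OF assms]
  show ?thesis
  proof
    show "topspace ?T = carrier (G Mod Z)" by (simp add: top FactGroup_def)
    show "continuous_map (prod_topology ?T ?T) ?T (\<lambda>(x, y). x \<otimes>\<^bsub>G Mod Z\<^esub> y)"
      unfolding continuous_map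
    proof (intro conjI allI impI)
      show "(\<lambda>(x, y). x \<otimes>\<^bsub>G Mod Z\<^esub> y) ` topspace (prod_topology ?T ?T) \<subseteq> topspace ?T"
        by (auto simp: top Z.setmult_closed)
      fix W assume W: "openin ?T W"
      then have WR: "W \<subseteq> rcosets Z" and WO: "openin T (\<Union>W)" by (auto simp: op)
      show "openin (prod_topology ?T ?T) {p \<in> topspace (prod_topology ?T ?T). (case p of (x, y) \<Rightarrow> x \<otimes>\<^bsub>G Mod Z\<^esub> y) \<in> W}"
        unfolding openin_prod_topology_alt
      proof (intro allI impI)
        fix A B assume AB: "(A, B) \<in> {p \<in> topspace (prod_topology ?T ?T). (case p of (x, y) \<Rightarrow> x \<otimes>\<^bsub>G Mod Z\<^esub> y) \<in> W}"
        then obtain a b where a: "a \<in> carrier G" "A = Z #> a" and b: "b \<in> carrier G" "B = Z #> b"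
          by (auto simp: top RCOSETS_def)
        let ?M = "{p \<in> topspace (prod_topology T T). (case p of (x, y) \<Rightarrow> x \<otimes> y) \<in> \<Union>W}"
        have "openin (prod_topology T T) ?M" by (rule openin_continuous_map_preimage[OF cont_mult WO])
        moreover have "Z #> (a \<otimes> b) \<in> W" using AB a b by (simp add: Z.rcos_sum)
        then have "(a, b) \<in> ?M" using a b Z.Union_rcosets_eq[OF WR] by (simp add: topspace_eq)
        ultimately obtain O1 O2 where O: "openin T O1" "openin T O2" "a \<in> O1" "b \<in> O2" "O1 \<times> O2 \<subseteq> ?M"
          by (rule prod_topology_open_rectangle)
        let ?S = "{p \<in> topspace (prod_topology ?T ?T). (case p of (x, y) \<Rightarrow> x \<otimes>\<^bsub>G Mod Z\<^esub> y) \<in> W}"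
        have "(Z #> x, Z #> y) \<in> ?S" if xy: "x \<in> O1" "y \<in> O2" for x y
        proof -
          have C: "x \<in> carrier G" "y \<in> carrier G" using xy O open_carrier by auto
          have "(x, y) \<in> ?M" using xy O(5) by blast
          then have "x \<otimes> y \<in> \<Union>W" by simp
          then have "Z #> (x \<otimes> y) \<in> W" using Z.Union_rcosets_eq[OF WR] by auto
          then show ?thesis using C by (simp add: top rcosets_mem Z.rcos_sum)
        qed
        then have "((\<lambda>x. Z #> x) ` O1) \<times> ((\<lambda>x. Z #> x) ` O2) \<subseteq> ?S" by blast
        moreover have "A \<in> (\<lambda>x. Z #> x) ` O1" "B \<in> (\<lambda>x. Z #> x) ` O2" using a b O by auto
        ultimately show "\<exists>U V. openin ?T U \<and> openin ?T V \<and> A \<in> U \<and> B \<in> V \<and> U \<times> V \<subseteq>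
            {p \<in> topspace (prod_topology ?T ?T). (case p of (x, y) \<Rightarrow> x \<otimes>\<^bsub>G Mod Z\<^esub> y) \<in> W}"
          using open_quotient_image[OF assms O(1)] open_quotient_image[OF assms O(2)] by meson
      qed
    qed
    have inv: "inv\<^bsub>G Mod Z\<^esub> (Z #> x) = Z #> inv x" if "x \<in> carrier G" for x
      using that Z.inv_FactGroup[of "Z #> x"] Z.rcos_inv[of x] by (auto simp: carrier_FactGroup)
    show "continuous_map ?T ?T (m_inv (G Mod Z))"
      unfolding continuous_map
    proof (intro conjI allI impI)
      show "m_inv (G Mod Z) ` topspace ?T \<subseteq> topspace ?T"
        using Q.inv_closed by (auto simp: top FactGroup_def)
      fix W assume W: "openin ?T W"
      then have WR: "W \<subseteq> rcosets Z" and WO: "openin T (\<Union>W)" by (auto simp: op)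
      let ?U = "{A \<in> topspace ?T. inv\<^bsub>G Mod Z\<^esub> A \<in> W}"
      have UR: "?U \<subseteq> rcosets Z" by (auto simp: top)
      have "\<Union>?U = {x \<in> topspace T. inv x \<in> \<Union>W}"
        unfolding Z.Union_rcosets_eq[OF UR] Z.Union_rcosets_eq[OF WR] by (auto simp: top rcosets_mem inv topspace_eq)
      moreover have "openin T {x \<in> topspace T. inv x \<in> \<Union>W}" by (rule openin_continuous_map_preimage[OF cont_inv WO])
      ultimately show "openin ?T ?U" using UR by (simp add: op)
    qed
  qed
qed

lemma Hausdorff_quotient:
  assumes "Z \<lhd> G" "closedin T Z"
  shows "Hausdorff_space (quotient_group_topology G T Z)"
  unfolding Hausdorff_space_def
proof (intro allI impI, elim conjE)
  interpret Z: normal Z G by fact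
  let ?T = "quotient_group_topology G T Z"
  fix A B assume "A \<in> topspace ?T" "B \<in> topspace ?T" "A \<noteq> B"
  then obtain a b where a: "a \<in> carrier G" "A = Z #> a" and b: "b \<in> carrier G" "B = Z #> b"
    by (auto simp: topspace_quotient[OF assms(1)] RCOSETS_def)
  let ?M = "{p \<in> topspace (prod_topology T T). fst p \<otimes> inv (snd p) \<in> carrier G - Z}"
  have "continuous_map (prod_topology T T) T (\<lambda>p. fst p \<otimes> inv (snd p))"
    by (intro continuous_mult continuous_inv continuous_map_fst continuous_map_snd)
  moreover have "openin T (carrier G - Z)" using assms(2) topspace_eq by (metis closedin_def)
  ultimately have "openin (prod_topology T T) ?M" by (rule openin_continuous_map_preimage)
  moreover have "a \<otimes> inv b \<notin> Z" using Z.rcoset_eq_iff[OF a(1) b(1)] \<open>A \<noteq> B\<close> a b by simp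
  then have "(a, b) \<in> ?M" using a b by (simp add: topspace_eq)
  ultimately obtain O1 O2 where O: "openin T O1" "openin T O2" "a \<in> O1" "b \<in> O2" "O1 \<times> O2 \<subseteq> ?M"
    by (rule prod_topology_open_rectangle)
  have "Z #> x \<noteq> Z #> y" if xy: "x \<in> O1" "y \<in> O2" for x y
  proof -
    have "(x, y) \<in> ?M" using xy O(5) by blast
    then show ?thesis using Z.rcoset_eq_iff[of x y] by (simp add: topspace_eq)
  qed
  then have "disjnt ((\<lambda>x. Z #> x) ` O1) ((\<lambda>x. Z #> x) ` O2)" by (auto simp: disjnt_iff)
  moreover have "A \<in> (\<lambda>x. Z #> x) ` O1" "B \<in> (\<lambda>x. Z #> x) ` O2" using a b O by auto
  ultimately show "\<exists>U V. openin ?T U \<and> openin ?T V \<and> A \<in> U \<and> B \<in> V \<and> disjnt U V"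
    using open_quotient_image[OF assms(1) O(1)] open_quotient_image[OF assms(1) O(2)] by meson
qed

lemma locally_compact_quotient:
  assumes "Z \<lhd> G" "locally_compact_space T"
  shows "locally_compact_space (quotient_group_topology G T Z)"
  unfolding locally_compact_space_def
proof
  let ?T = "quotient_group_topology G T Z"
  fix A assume "A \<in> topspace ?T"
  then obtain a where a: "a \<in> carrier G" "A = Z #> a"
    by (auto simp: topspace_quotient[OF assms(1)] RCOSETS_def)
  obtain U K where UK: "openin T U" "compactin T K" "a \<in> U" "U \<subseteq> K"
    using assms(2) a topspace_eq unfolding locally_compact_space_def by metis
  have "openin ?T ((\<lambda>x. Z #> x) ` U)" by (rule open_quotient_image[OF assms(1) UK(1)])
  moreover have "compactin ?T ((\<lambda>x. Z #> x) ` K)" by (rule image_compactin[OF UK(2) continuous_quotient[OF assms(1)]])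
  moreover have "A \<in> (\<lambda>x. Z #> x) ` U" "(\<lambda>x. Z #> x) ` U \<subseteq> (\<lambda>x. Z #> x) ` K" using a UK by auto
  ultimately show "\<exists>U K. openin ?T U \<and> compactin ?T K \<and> A \<in> U \<and> U \<subseteq> K" by blast
qed

text \<open>The projection has compact kernel and is proper: \<open>K\<close> is covered by the
  images of finitely many relatively compact open sets, so its preimage lies in \<open>Z\<close>
  times a compact set, and it is closed as the preimage of a closed set.\<close>

lemma compact_Union_quotient:
  assumes Z: "Z \<lhd> G" "compactin T Z" and T: "locally_compact_space T" "Hausdorff_space T"
    and K: "compactin (quotient_group_topology G T Z) K"
  shows "compactin T (\<Union>K)"
proof -
  interpret Z: normal Z G by fact
  let ?T = "quotient_group_topology G T Z"
  have KR: "K \<subseteq> rcosets Z" using compactin_subset_topspace[OF K] topspace_quotient[OF Z(1)] by simp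
  have "\<forall>x\<in>carrier G. \<exists>U. \<exists>L. openin T U \<and> compactin T L \<and> x \<in> U \<and> U \<subseteq> L"
    using T(1) topspace_eq unfolding locally_compact_space_def by metis
  then obtain U L where UL: "\<And>x. x \<in> carrier G \<Longrightarrow> openin T (U x) \<and> compactin T (L x) \<and> x \<in> U x \<and> U x \<subseteq> L x"
    by metis
  let ?V = "\<lambda>x. (\<lambda>x. Z #> x) ` U x"
  have "\<forall>V\<in>?V ` carrier G. openin ?T V" using open_quotient_image[OF Z(1)] UL by blast
  moreover have "K \<subseteq> \<Union>(?V ` carrier G)"
  proof
    fix A assume "A \<in> K"
    then obtain a where "a \<in> carrier G" "A = Z #> a" using KR by (auto simp: RCOSETS_def)
    then show "A \<in> \<Union>(?V ` carrier G)" using UL by blast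
  qed
  ultimately obtain \<F> where \<F>: "finite \<F>" "\<F> \<subseteq> ?V ` carrier G" "K \<subseteq> \<Union>\<F>"
    using K unfolding compactin_def by meson
  obtain F where F: "F \<subseteq> carrier G" "finite F" "\<F> = ?V ` F" using finite_subset_image[OF \<F>(1,2)] by blast
  have "compactin T (\<Union>(L ` F))" using F UL by (intro compactin_Union) auto
  then have comp: "compactin T (Z <#> \<Union>(L ` F))" by (rule compact_set_mult[OF Z(2)])
  have "\<Union>K \<subseteq> Z <#> \<Union>(L ` F)"
  proof
    fix x assume "x \<in> \<Union>K"
    then have x: "x \<in> carrier G" "Z #> x \<in> K" using Z.Union_rcosets_eq[OF KR] by auto
    then obtain f y where fy: "f \<in> F" "y \<in> U f" "Z #> x = Z #> y" using \<F>(3) F(3) by blast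
    have yC: "y \<in> carrier G" using fy UL[of f] F(1) open_carrier by blast
    have "x \<otimes> inv y \<in> Z" using Z.rcoset_eq_iff[OF x(1) yC] fy by simp
    moreover have "x = (x \<otimes> inv y) \<otimes> y" using x yC by (simp add: m_assoc)
    moreover have "y \<in> \<Union>(L ` F)" using fy UL[of f] F(1) by blast
    ultimately show "x \<in> Z <#> \<Union>(L ` F)" by (metis mem_set_multI)
  qed
  moreover have "closedin T (\<Union>K)"
  proof -
    have "closedin ?T K"
      using compactin_imp_closedin[OF Hausdorff_quotient[OF Z(1) compactin_imp_closedin[OF T(2) Z(2)]] K] .
    from closedin_continuous_map_preimage[OF continuous_quotient[OF Z(1)] this]
    show ?thesis using Z.Union_rcosets_eq[OF KR] by (simp add: topspace_eq)
  qed
  ultimately show ?thesis by (rule closed_compactin[OF comp])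
qed

lemma compactly_generated_quotient:
  assumes "Z \<lhd> G" "compactly_generated G T"
  shows "compactly_generated (G Mod Z) (quotient_group_topology G T Z)"
proof -
  interpret Z: normal Z G by fact
  interpret Q: group_hom G "G Mod Z" "\<lambda>x. Z #> x"
    by (intro group_hom.intro group_hom_axioms.intro is_group Z.factorgroup_is_group Z.r_coset_hom_Mod)
  obtain K where K: "K \<subseteq> carrier G" "compactin T K" "generate G K = carrier G"
    using assms(2) by (auto simp: compactly_generated_def)
  let ?K = "(\<lambda>x. Z #> x) ` K"
  have "?K \<subseteq> carrier (G Mod Z)" using K(1) by (auto simp: carrier_FactGroup)
  moreover have "compactin (quotient_group_topology G T Z) ?K" by (rule image_compactin[OF K(2) continuous_quotient[OF assms(1)]])
  moreover have "generate (G Mod Z) ?K = carrier (G Mod Z)"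
    using Q.generate_img[OF K(1)] K(3) by (simp add: carrier_FactGroup)
  ultimately show ?thesis unfolding compactly_generated_def by blast
qed

end

lemma (in normal) derived_FactGroup:
  "derived (G Mod H) (carrier (G Mod H)) = (\<lambda>x. H #> x) ` derived G (carrier G)"
proof -
  interpret Q: group_hom G "G Mod H" "\<lambda>x. H #> x"
    by (intro group_hom.intro group_hom_axioms.intro is_group factorgroup_is_group r_coset_hom_Mod)
  show ?thesis using Q.derived_img[of "carrier G"] by (simp add: carrier_FactGroup)
qed

lemma (in normal) metabelian_FactGroup:
  assumes "metabelian G"
  shows "metabelian (G Mod H)"
  unfolding metabelian_def derived_FactGroup
proof clarify
  fix x y assume xy: "x \<in> derived G (carrier G)" "y \<in> derived G (carrier G)"
  then have "x \<in> carrier G" "y \<in> carrier G" using derived_in_carrier by blast+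
  moreover have "x \<otimes> y = y \<otimes> x" using assms xy by (simp add: metabelian_def)
  ultimately show "(H #> x) \<otimes>\<^bsub>G Mod H\<^esub> (H #> y) = (H #> y) \<otimes>\<^bsub>G Mod H\<^esub> (H #> x)"
    by (simp add: rcos_sum)
qed

section \<open>Conjugation on an abelian normal subgroup\<close>

text \<open>Centralisers are subgroups; this is applied first to a fixed generator and then to a
  fixed element of the generated subgroup.\<close>

lemma (in group) generate_commute:
  assumes "S \<subseteq> carrier G" "\<And>s t. s \<in> S \<Longrightarrow> t \<in> S \<Longrightarrow> s \<otimes> t = t \<otimes> s"
    and x: "x \<in> generate G S" and y: "y \<in> generate G S"
  shows "x \<otimes> y = y \<otimes> x"
proof -
  have cent: "subgroup {x \<in> carrier G. x \<otimes> y = y \<otimes> x} G" if y: "y \<in> carrier G" for y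
  proof
    fix a b assume "a \<in> {x \<in> carrier G. x \<otimes> y = y \<otimes> x}" "b \<in> {x \<in> carrier G. x \<otimes> y = y \<otimes> x}"
    then have a: "a \<in> carrier G" "a \<otimes> y = y \<otimes> a" and b: "b \<in> carrier G" "b \<otimes> y = y \<otimes> b" by auto
    have "a \<otimes> b \<otimes> y = a \<otimes> (y \<otimes> b)" using a b y by (simp add: m_assoc)
    also have "\<dots> = y \<otimes> (a \<otimes> b)" using a b y by (simp flip: m_assoc)
    finally show "a \<otimes> b \<in> {x \<in> carrier G. x \<otimes> y = y \<otimes> x}" using a b by simp
    have "inv a \<otimes> y = inv a \<otimes> (y \<otimes> a) \<otimes> inv a" using a(1) y by (simp add: m_assoc)
    also have "\<dots> = y \<otimes> inv a" unfolding a(2)[symmetric] using a(1) y by (simp flip: m_assoc)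
    finally show "inv a \<in> {x \<in> carrier G. x \<otimes> y = y \<otimes> x}" using a by simp
  qed (use y in auto)
  have 1: "z \<otimes> t = t \<otimes> z" if "t \<in> S" "z \<in> generate G S" for t z
    using generate_subgroup_incl[OF _ cent, of S t] assms that by blast
  have "y \<in> carrier G" "x \<in> carrier G" using x y assms generate_in_carrier by blast+
  then have "S \<subseteq> {x \<in> carrier G. x \<otimes> y = y \<otimes> x}" using 1[OF _ y] assms(1) by auto
  then show ?thesis using generate_subgroup_incl[OF _ cent] x \<open>y \<in> carrier G\<close> by blast
qed

lemma (in normal) comm_group_FactGroup_iff:
  "comm_group (G Mod H) \<longleftrightarrow> derived G (carrier G) \<subseteq> H"
proof
  assume "comm_group (G Mod H)"
  then show "derived G (carrier G) \<subseteq> H" by (rule derived_minimal[OF normal_axioms])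
next
  assume der: "derived G (carrier G) \<subseteq> H"
  show "comm_group (G Mod H)"
  proof (rule group.group_comm_groupI[OF factorgroup_is_group])
    fix P Y assume "P \<in> carrier (G Mod H)" "Y \<in> carrier (G Mod H)"
    then obtain x y where xy: "x \<in> carrier G" "y \<in> carrier G" "P = H #> x" "Y = H #> y"
      by (auto simp: carrier_FactGroup)
    have "x \<otimes> y \<otimes> inv (y \<otimes> x) = x \<otimes> y \<otimes> inv x \<otimes> inv y" using xy by (simp add: inv_mult_group m_assoc)
    moreover have "x \<otimes> y \<otimes> inv x \<otimes> inv y \<in> derived G (carrier G)"
      unfolding derived_def using xy by (intro generate.incl) auto
    ultimately have "H #> (x \<otimes> y) = H #> (y \<otimes> x)" using der xy by (subst rcoset_eq_iff) auto
    then show "P \<otimes>\<^bsub>G Mod H\<^esub> Y = Y \<otimes>\<^bsub>G Mod H\<^esub> P" using xy by (simp add: rcos_sum)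
  qed
qed

text \<open>Normality of \<open>H\<close> is what reduces the test to generators: their images
  commute, so the whole quotient is abelian.\<close>

lemma (in normal) derived_subset_if_generators_commute:
  assumes "S \<subseteq> carrier G" "generate G S = carrier G"
    and comm: "\<And>s t. s \<in> S \<Longrightarrow> t \<in> S \<Longrightarrow> s \<otimes> t \<otimes> inv s \<otimes> inv t \<in> H"
  shows "derived G (carrier G) \<subseteq> H"
proof -
  interpret Q: group_hom G "G Mod H" "\<lambda>x. H #> x"
    by (intro group_hom.intro group_hom_axioms.intro is_group factorgroup_is_group r_coset_hom_Mod)
  let ?S = "(\<lambda>x. H #> x) ` S"
  have gen: "generate (G Mod H) ?S = carrier (G Mod H)"
    using Q.generate_img[OF assms(1)] assms(2) by (simp add: carrier_FactGroup)
  have "comm_group (G Mod H)"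
  proof (rule group.group_comm_groupI[OF factorgroup_is_group])
    fix P Y assume PY: "P \<in> carrier (G Mod H)" "Y \<in> carrier (G Mod H)"
    show "P \<otimes>\<^bsub>G Mod H\<^esub> Y = Y \<otimes>\<^bsub>G Mod H\<^esub> P"
    proof (rule Q.H.generate_commute[of ?S])
      show "?S \<subseteq> carrier (G Mod H)" using assms(1) by (auto simp: carrier_FactGroup)
      fix A B assume "A \<in> ?S" "B \<in> ?S"
      then obtain x y where xy: "x \<in> S" "y \<in> S" "A = H #> x" "B = H #> y" by blast
      then have C: "x \<in> carrier G" "y \<in> carrier G" using assms(1) by auto
      have "x \<otimes> y \<otimes> inv (y \<otimes> x) = x \<otimes> y \<otimes> inv x \<otimes> inv y" using C by (simp add: inv_mult_group m_assoc)
      then have "H #> (x \<otimes> y) = H #> (y \<otimes> x)" using comm xy C by (subst rcoset_eq_iff) auto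
      then show "A \<otimes>\<^bsub>G Mod H\<^esub> B = B \<otimes>\<^bsub>G Mod H\<^esub> A" unfolding xy(3,4) using C by simp
    qed (use PY gen in auto)
  qed
  then show ?thesis by (simp add: comm_group_FactGroup_iff)
qed

locale abelian_normal = group G for G (structure) +
  fixes A :: "'a set"
  assumes A_normal: "A \<lhd> G"
    and A_commute: "x \<in> A \<Longrightarrow> y \<in> A \<Longrightarrow> x \<otimes> y = y \<otimes> x"
    and derived_subset: "derived G (carrier G) \<subseteq> A"
begin

sublocale A: normal A G by (rule A_normal)

lemma comm_group_A: "comm_group (G\<lparr>carrier := A\<rparr>)"
  by (rule group.group_comm_groupI[OF subgroup_imp_group[OF A.subgroup_axioms]]) (auto intro: A_commute)

lemma subgroup_A_iff: "K \<subseteq> A \<Longrightarrow> subgroup K (G\<lparr>carrier := A\<rparr>) \<longleftrightarrow> subgroup K G"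
  using subgroup_incl[OF _ A.subgroup_axioms] incl_subgroup[OF A.subgroup_axioms] by blast

text \<open>Acting as the identity outside \<open>A\<close> makes these maps commute everywhere, as folding over a multiset
requires.\<close>

definition act :: "'a \<Rightarrow> 'a \<Rightarrow> 'a" where
  "act g x = (if x \<in> A then g \<otimes> x \<otimes> inv g else x)"

lemma act_closed: "g \<in> carrier G \<Longrightarrow> x \<in> A \<Longrightarrow> act g x \<in> A"
  by (simp add: act_def A.inv_op_closed2)

lemma act_one: "act \<one> x = x"
  by (simp add: act_def)

lemma act_mult: "g \<in> carrier G \<Longrightarrow> h \<in> carrier G \<Longrightarrow> act (g \<otimes> h) x = act g (act h x)"
  using A.inv_op_closed2[of h x] by (simp add: act_def inv_mult_group m_assoc)

lemma act_A: "a \<in> A \<Longrightarrow> act a x = x"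
  using A_commute[of a x] by (simp add: act_def m_assoc)

text \<open>The elements \<open>g \<otimes> h\<close> and \<open>h \<otimes> g\<close> differ by a
  commutator, which lies in \<open>A\<close> and acts trivially on the abelian group
  \<open>A\<close>.\<close>

lemma act_act_commute:
  assumes "g \<in> carrier G" "h \<in> carrier G"
  shows "act g (act h x) = act h (act g x)"
proof -
  let ?k = "g \<otimes> h \<otimes> inv g \<otimes> inv h"
  have k: "?k \<in> A" using derived_subset assms unfolding derived_def by (auto intro!: generate.incl)
  have "g \<otimes> h = ?k \<otimes> (h \<otimes> g)"
  proof -
    have "?k \<otimes> (h \<otimes> g) = g \<otimes> h \<otimes> inv g \<otimes> (inv h \<otimes> h) \<otimes> g"
      using assms by (simp only: m_assoc m_closed inv_closed)
    then show ?thesis using assms by (simp add: m_assoc)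
  qed
  then have "act (g \<otimes> h) x = act ?k (act (h \<otimes> g) x)" using assms act_mult[of ?k "h \<otimes> g"] by simp
  then show ?thesis using act_A[OF k] assms by (simp add: act_mult)
qed

lemma act_hom: "g \<in> carrier G \<Longrightarrow> act g \<in> hom (G\<lparr>carrier := A\<rparr>) (G\<lparr>carrier := A\<rparr>)"
proof (rule homI)
  fix x y assume g: "g \<in> carrier G" and "x \<in> carrier (G\<lparr>carrier := A\<rparr>)" "y \<in> carrier (G\<lparr>carrier := A\<rparr>)"
  then have xy: "x \<in> A" "y \<in> A" by auto
  have "(g \<otimes> x \<otimes> inv g) \<otimes> (g \<otimes> y \<otimes> inv g) = g \<otimes> x \<otimes> (inv g \<otimes> g) \<otimes> y \<otimes> inv g"
    using g xy by (simp only: m_assoc m_closed inv_closed A.mem_carrier)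
  also have "\<dots> = g \<otimes> (x \<otimes> y) \<otimes> inv g" using g xy by (simp add: m_assoc)
  finally show "act g (x \<otimes>\<^bsub>G\<lparr>carrier := A\<rparr>\<^esub> y) = act g x \<otimes>\<^bsub>G\<lparr>carrier := A\<rparr>\<^esub> act g y"
    using xy by (simp add: act_def)
qed (simp add: act_closed)

lemma act_inverse: "g \<in> carrier G \<Longrightarrow> act g (act (inv g) x) = x" "g \<in> carrier G \<Longrightarrow> act (inv g) (act g x) = x"
  by (simp_all add: act_one flip: act_mult)

section \<open>Monomials acting by conjugation\<close>

definition mact :: "(nat \<Rightarrow> 'a) \<Rightarrow> nat multiset \<Rightarrow> 'a \<Rightarrow> 'a" where
  "mact t \<alpha> x = fold_mset (\<lambda>i. act (t i)) x \<alpha>"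

context
  fixes t :: "nat \<Rightarrow> 'a"
  assumes t: "\<And>i. t i \<in> carrier G"
begin

lemma comp_fun_commute_act: "comp_fun_commute (\<lambda>i. act (t i))"
  by standard (simp add: fun_eq_iff act_act_commute t)

lemma mact_empty: "mact t {#} x = x"
  by (simp add: mact_def)

lemma mact_single: "mact t {#j#} x = act (t j) x"
  by (simp add: mact_def)

lemma mact_add_mset: "mact t (add_mset j \<alpha>) x = act (t j) (mact t \<alpha> x)"
  unfolding mact_def by (rule comp_fun_commute.fold_mset_add_mset[OF comp_fun_commute_act])

text \<open>Through this, facts about single conjugations, such as closedness of preimages or
  invariance of normal subgroups, apply to monomials without an induction.\<close>

lemma mact_eq_act: "\<exists>g\<in>carrier G. \<forall>x. mact t \<alpha> x = act g x"
proof (induction \<alpha>)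
  case empty
  show ?case by (intro bexI[of _ \<one>]) (simp_all add: mact_empty act_one)
next
  case (add j \<alpha>)
  then obtain g where "g \<in> carrier G" "\<And>x. mact t \<alpha> x = act g x" by blast
  then show ?case by (intro bexI[of _ "t j \<otimes> g"]) (simp_all add: mact_add_mset act_mult t)
qed

lemma mact_add: "mact t (\<alpha> + \<beta>) x = mact t \<alpha> (mact t \<beta> x)"
  by (induction \<alpha>) (simp_all add: mact_empty mact_add_mset)

lemma act_mact_commute: "g \<in> carrier G \<Longrightarrow> act g (mact t \<alpha> x) = mact t \<alpha> (act g x)"
  using mact_eq_act[of \<alpha>] act_act_commute by metis

lemma monomial_action_A:
  assumes "finite J" "subgroup U G" "U \<subseteq> A"
  shows "monomial_action (G\<lparr>carrier := A\<rparr>) J (mact t) U"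
proof -
  interpret C: comm_group "G\<lparr>carrier := A\<rparr>" by (rule comm_group_A)
  show ?thesis
  proof (intro monomial_action.intro comm_group_A monomial_action_axioms.intro)
    show "mact t \<alpha> \<in> hom (G\<lparr>carrier := A\<rparr>) (G\<lparr>carrier := A\<rparr>)" for \<alpha>
    proof -
      obtain g where "g \<in> carrier G" "\<And>x. mact t \<alpha> x = act g x" using mact_eq_act by blast
      moreover from this have "mact t \<alpha> = act g" by blast
      ultimately show ?thesis using act_hom by simp
    qed
    show "subgroup U (G\<lparr>carrier := A\<rparr>)" using assms subgroup_A_iff by blast
  qed (use assms in \<open>simp_all add: mact_empty mact_add\<close>)
qed

end

lemma act_image_subgroup:
  assumes "g \<in> carrier G" "U = generate G S" "S \<subseteq> A" "\<And>x. x \<in> S \<Longrightarrow> act g x \<in> U"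
  shows "act g ` U \<subseteq> U"
proof -
  interpret C: comm_group "G\<lparr>carrier := A\<rparr>" by (rule comm_group_A)
  interpret h: group_hom "G\<lparr>carrier := A\<rparr>" "G\<lparr>carrier := A\<rparr>" "act g"
    using act_hom[OF assms(1)] by unfold_locales
  have UA: "U \<subseteq> A" using assms generate_subgroup_incl[OF _ A.subgroup_axioms] by blast
  have U: "subgroup U G" using assms A.subset generate_is_subgroup by auto
  have "act g ` generate (G\<lparr>carrier := A\<rparr>) S = generate (G\<lparr>carrier := A\<rparr>) (act g ` S)"
    using h.generate_img assms(3) by simp
  also have "\<dots> \<subseteq> U" using assms(4) U UA subgroup_A_iff by (intro C.generate_subgroup_incl) auto
  finally show ?thesis using generate_consistent[OF assms(3) A.subgroup_axioms] assms(2) by simp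
qed

end

section \<open>Compact normal subgroups inside an abelian normal subgroup\<close>

lemma (in group) commutator_in_derived:
  "x \<in> carrier G \<Longrightarrow> y \<in> carrier G \<Longrightarrow> x \<otimes> y \<otimes> inv x \<otimes> inv y \<in> derived G (carrier G)"
  unfolding derived_def by (rule generate.incl) blast

section \<open>Bornologies on subgroups and quotients; compact normal subgroups\<close>

context topo_group
begin

text \<open>Boundedness refers to compact subsets of \<open>G\<close>, not of \<open>H\<close>, so
  that \<open>H\<close> need not be closed. Since the centers of a covering are in \<open>H\<close>,
  the remaining factors from \<open>O'\<close> are automatically in \<open>H\<close>.\<close>

lemma bornological_abelian_subgroup:
  assumes H: "subgroup H G" "\<And>x y. x \<in> H \<Longrightarrow> y \<in> H \<Longrightarrow> x \<otimes> y = y \<otimes> x"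
    and O': "openin T O'" "\<one> \<in> O'" "O' \<subseteq> C" "compactin T C"
  shows "bornological_group (G\<lparr>carrier := H\<rparr>) {Y. Y \<subseteq> H \<and> (\<exists>L. compactin T L \<and> Y \<subseteq> L)} (O' \<inter> H)"
proof -
  interpret H: subgroup H G by (rule H)
  have inv: "inv\<^bsub>G\<lparr>carrier := H\<rparr>\<^esub> x = inv x" if "x \<in> H" for x using m_inv_consistent[OF H(1) that] .
  have cg: "comm_group (G\<lparr>carrier := H\<rparr>)"
    by (rule group.group_comm_groupI[OF subgroup_imp_group[OF H(1)]]) (auto intro: H(2))
  let ?B = "{Y. Y \<subseteq> H \<and> (\<exists>L. compactin T L \<and> Y \<subseteq> L)}"
  show ?thesis
  proof (intro bornological_group.intro cg bornological_group_axioms.intro)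
    fix F assume F: "finite F" "F \<subseteq> carrier (G\<lparr>carrier := H\<rparr>)"
    then have "compactin T F" using H.subset topspace_eq by (intro finite_imp_compactin) auto
    then show "F \<in> ?B" using F by auto
  next
    fix S Y assume "S \<in> ?B" "Y \<in> ?B"
    then obtain L M where LM: "compactin T L" "S \<subseteq> L" "compactin T M" "Y \<subseteq> M" and SY: "S \<subseteq> H" "Y \<subseteq> H" by blast
    have "compactin T (L <#> M)" using LM by (intro compact_set_mult)
    moreover have "S <#> Y \<subseteq> L <#> M" using LM by (intro mono_set_mult)
    moreover have "S <#> Y \<subseteq> H" using SY by (auto simp: set_mult_def)
    ultimately show "S <#>\<^bsub>G\<lparr>carrier := H\<rparr>\<^esub> Y \<in> ?B" by auto
    have "compactin T (L \<union> M)" using LM by (intro compactin_Un)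
    then show "S \<union> Y \<in> ?B" using LM SY by blast
  next
    fix S assume "S \<in> ?B"
    then obtain L where L: "compactin T L" "S \<subseteq> L" and S: "S \<subseteq> H" by blast
    have "m_inv (G\<lparr>carrier := H\<rparr>) ` S = m_inv G ` S" using S inv by (intro image_cong) auto
    moreover have "m_inv G ` S \<subseteq> m_inv G ` L" "m_inv G ` S \<subseteq> H" using L S by auto
    ultimately show "m_inv (G\<lparr>carrier := H\<rparr>) ` S \<in> ?B" using compact_set_inv[OF L(1)] by auto
    obtain F where F: "finite F" "F \<subseteq> S" "S \<subseteq> F <#> O'"
      using relatively_compact_finite_cover[OF L O'(1,2)] by blast
    have "S \<subseteq> F <#> (O' \<inter> H)"
    proof
      fix x assume x: "x \<in> S"
      then obtain f b where fb: "f \<in> F" "b \<in> O'" "x = f \<otimes> b" using F(3) by (blast elim: mem_set_multE)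
      have fH: "f \<in> H" "x \<in> H" using fb F(2) S x by auto
      have "b \<in> carrier G" using fb open_carrier[OF O'(1)] by blast
      then have "b = inv f \<otimes> x" using fb fH by (simp flip: m_assoc)
      then have "b \<in> O' \<inter> H" using fb fH by blast
      then show "x \<in> F <#> (O' \<inter> H)" unfolding fb(3) using fb(1) by (intro mem_set_multI)
    qed
    then show "\<exists>F. finite F \<and> F \<subseteq> S \<and> S \<subseteq> F <#>\<^bsub>G\<lparr>carrier := H\<rparr>\<^esub> (O' \<inter> H)" using F by auto
  qed (use O' in \<open>simp; blast\<close>)+
qed

text \<open>Bounded sets are those inside images of compact sets. No topology on the quotient is
  used and \<open>D\<close> need not be closed; coverings are found upstairs in the part of a
  compact set lying over \<open>S\<close>.\<close>

lemma bornological_abelian_quotient: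
  assumes D: "D \<lhd> G" "derived G (carrier G) \<subseteq> D"
    and O': "openin T O'" "\<one> \<in> O'" "O' \<subseteq> C" "compactin T C"
  shows "bornological_group (G Mod D) {Y. \<exists>L. compactin T L \<and> Y \<subseteq> (\<lambda>x. D #> x) ` L} ((\<lambda>x. D #> x) ` O')"
proof -
  interpret D: normal D G by (rule D)
  let ?p = "\<lambda>x. D #> x"
  let ?B = "{Y. \<exists>L. compactin T L \<and> Y \<subseteq> ?p ` L}"
  have cg: "comm_group (G Mod D)" using D.comm_group_FactGroup_iff D(2) by blast
  have inv: "inv\<^bsub>G Mod D\<^esub> (D #> x) = D #> inv x" if "x \<in> carrier G" for x
    using that D.inv_FactGroup[of "D #> x"] D.rcos_inv[of x] by (auto simp: carrier_FactGroup)
  have mult: "?p ` L <#>\<^bsub>G Mod D\<^esub> ?p ` M = ?p ` (L <#> M)" if "L \<subseteq> carrier G" "M \<subseteq> carrier G" for L M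
    using set_mult_hom[OF D.r_coset_hom_Mod that] by simp
  show ?thesis
  proof (intro bornological_group.intro cg bornological_group_axioms.intro)
    fix S assume "S \<in> ?B"
    then obtain L where L: "compactin T L" "S \<subseteq> ?p ` L" by blast
    have LC: "L \<subseteq> carrier G" by (rule compact_carrier[OF L(1)])
    show "S \<subseteq> carrier (G Mod D)" using L(2) LC by (auto simp: carrier_FactGroup)
    have "m_inv (G Mod D) ` S \<subseteq> ?p ` (m_inv G ` L)"
    proof clarify
      fix Y assume "Y \<in> S"
      then obtain l where l: "l \<in> L" "Y = D #> l" using L(2) by blast
      then have "inv\<^bsub>G Mod D\<^esub> Y = D #> inv l" using inv LC by blast
      then show "inv\<^bsub>G Mod D\<^esub> Y \<in> ?p ` (m_inv G ` L)" using l by blast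
    qed
    then show "m_inv (G Mod D) ` S \<in> ?B" using compact_set_inv[OF L(1)] by blast
    define L' where "L' = {l \<in> L. D #> l \<in> S}"
    have "L' \<subseteq> L" by (auto simp: L'_def)
    then obtain F where F: "finite F" "F \<subseteq> L'" "L' \<subseteq> F <#> O'"
      using relatively_compact_finite_cover[OF L(1) _ O'(1,2)] by blast
    have SL: "S = ?p ` L'" using L(2) by (auto simp: L'_def)
    have "F \<subseteq> carrier G" using F LC by (auto simp: L'_def)
    then have "?p ` F <#>\<^bsub>G Mod D\<^esub> ?p ` O' = ?p ` (F <#> O')" by (rule mult[OF _ open_carrier[OF O'(1)]])
    then have "S \<subseteq> ?p ` F <#>\<^bsub>G Mod D\<^esub> ?p ` O'" using F(3) SL by auto
    then show "\<exists>F. finite F \<and> F \<subseteq> S \<and> S \<subseteq> F <#>\<^bsub>G Mod D\<^esub> ?p ` O'"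
      using F SL by (intro exI[of _ "?p ` F"]) auto
  next
    fix F assume F: "finite F" "F \<subseteq> carrier (G Mod D)"
    then have "F \<subseteq> ?p ` carrier G" by (simp add: carrier_FactGroup)
    then obtain E where E: "E \<subseteq> carrier G" "finite E" "F = ?p ` E" using finite_subset_image[OF F(1)] by metis
    then have "compactin T E" using topspace_eq by (intro finite_imp_compactin) auto
    then show "F \<in> ?B" using E by auto
  next
    fix S Y assume "S \<in> ?B" "Y \<in> ?B"
    then obtain L M where LM: "compactin T L" "S \<subseteq> ?p ` L" "compactin T M" "Y \<subseteq> ?p ` M" by blast
    have "S <#>\<^bsub>G Mod D\<^esub> Y \<subseteq> ?p ` L <#>\<^bsub>G Mod D\<^esub> ?p ` M" using LM by (intro mono_set_mult)
    also have "\<dots> = ?p ` (L <#> M)" using LM by (intro mult compact_carrier)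
    finally show "S <#>\<^bsub>G Mod D\<^esub> Y \<in> ?B" using compact_set_mult[OF LM(1,3)] by blast
    have "compactin T (L \<union> M)" using LM by (intro compactin_Un)
    moreover have "S \<union> Y \<subseteq> ?p ` (L \<union> M)" using LM by blast
    ultimately show "S \<union> Y \<in> ?B" by blast
  next
    fix S Y assume "S \<in> ?B" "Y \<subseteq> S"
    then show "Y \<in> ?B" by blast
  next
    have "?p ` O' \<subseteq> ?p ` C" using O'(3) by (rule image_mono)
    then show "?p ` O' \<in> ?B" using O'(4) by blast
  qed
qed

definition compact_normals :: "'a set \<Rightarrow> 'a set set" where
  "compact_normals A = {K. K \<lhd> G \<and> compactin T K \<and> K \<subseteq> A}"

lemma one_compact_normals: "\<one> \<in> A \<Longrightarrow> {\<one>} \<in> compact_normals A"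
  by (simp add: compact_normals_def one_is_normal topspace_eq)

lemma compact_normals_mult:
  assumes "subgroup A G" "K \<in> compact_normals A" "L \<in> compact_normals A"
  shows "K <#> L \<in> compact_normals A"
proof -
  interpret A: subgroup A G by fact
  have "K <#> L \<subseteq> A" using assms by (auto simp: compact_normals_def set_mult_def)
  then show ?thesis using assms compact_set_mult normal_set_mult by (simp add: compact_normals_def)
qed

lemma normal_Union_compact_normals:
  assumes "subgroup A G"
  shows "\<Union>(compact_normals A) \<lhd> G"
proof (rule normal_invI)
  interpret A: subgroup A G by fact
  have sub: "K \<lhd> G" if "K \<in> compact_normals A" for K using that by (simp add: compact_normals_def)
  show "subgroup (\<Union>(compact_normals A)) G"
  proof
    show "\<Union>(compact_normals A) \<subseteq> carrier G" using A.subset by (auto simp: compact_normals_def)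
    show "\<one> \<in> \<Union>(compact_normals A)" using one_compact_normals[OF A.one_closed] by blast
    fix x y assume "x \<in> \<Union>(compact_normals A)" "y \<in> \<Union>(compact_normals A)"
    then obtain K L where KL: "K \<in> compact_normals A" "L \<in> compact_normals A" "x \<in> K" "y \<in> L" by blast
    have "x \<otimes> y \<in> K <#> L" using KL by (intro mem_set_multI)
    then show "x \<otimes> y \<in> \<Union>(compact_normals A)" using compact_normals_mult[OF assms KL(1,2)] by blast
    show "inv x \<in> \<Union>(compact_normals A)"
      using subgroup.m_inv_closed[OF normal_imp_subgroup[OF sub[OF KL(1)]] KL(3)] KL(1) by blast
  qed
  fix x h assume x: "x \<in> carrier G" and "h \<in> \<Union>(compact_normals A)"
  then obtain K where K: "K \<in> compact_normals A" "h \<in> K" by blast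
  have "x \<otimes> h \<otimes> inv x \<in> K" by (rule normal.inv_op_closed2[OF sub[OF K(1)] x K(2)])
  then show "x \<otimes> h \<otimes> inv x \<in> \<Union>(compact_normals A)" using K(1) by blast
qed

text \<open>The closure of the union is again a compact normal subgroup inside \<open>A\<close>,
  hence one of the sets of which the union is formed.\<close>

lemma Union_compact_normals_mem:
  assumes T2: "Hausdorff_space T" and A: "subgroup A G" "closedin T A"
    and L: "compactin T L" "\<Union>(compact_normals A) \<subseteq> L"
  shows "\<Union>(compact_normals A) \<in> compact_normals A"
proof -
  let ?W = "\<Union>(compact_normals A)"
  have cl: "closedin T L" by (rule compactin_imp_closedin[OF T2 L(1)])
  have "T closure_of ?W \<subseteq> L" by (rule closure_of_minimal[OF L(2) cl])
  then have comp: "compactin T (T closure_of ?W)" by (rule closed_compactin[OF L(1)]) simp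
  have "?W \<subseteq> A" by (auto simp: compact_normals_def)
  then have "T closure_of ?W \<subseteq> A" by (rule closure_of_minimal[OF _ A(2)])
  then have mem: "T closure_of ?W \<in> compact_normals A"
    using comp normal_closure[OF normal_Union_compact_normals[OF A(1)]] by (simp add: compact_normals_def)
  have "?W \<subseteq> T closure_of ?W"
    using \<open>?W \<subseteq> A\<close> closed_carrier[OF A(2)] topspace_eq by (intro closure_of_subset) auto
  then have "T closure_of ?W = ?W" using mem by blast
  then show ?thesis using mem by simp
qed

lemma W_sub_eq: "W_sub G T = \<Union>(compact_normals (carrier G))"
  using compact_carrier by (auto simp: W_sub_def compact_normals_def)

end

section \<open>The module argument for conjugation on \<open>A\<close>\<close>

locale topo_abelian_normal = topo_group G T + abelian_normal G A
  for G (structure) and T :: "'a topology" and A :: "'a set"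
begin

text \<open>Elements near the identity move the generators \<open>P\<close> of \<open>U\<close> only
  within \<open>U\<close>, so they normalise \<open>U\<close>; compactness of \<open>S\<close>
  leaves finitely many generators besides them. As the operators commute on \<open>A\<close>, all
  normalising factors can be collected into a single \<open>n\<close>.\<close>

lemma monomial_generators:
  assumes S: "compactin T S" "generate G S = carrier G"
    and P: "compactin T P" "P \<subseteq> A" "U = generate G P"
    and O': "openin T O'" "\<one> \<in> O'" "O' \<inter> A \<subseteq> U"
  obtains t :: "nat \<Rightarrow> 'a" and m :: nat where "\<And>i. t i \<in> carrier G"
    "\<And>g. g \<in> carrier G \<Longrightarrow> \<exists>n\<in>carrier G. \<exists>\<alpha>. act n ` U = U \<and> set_mset \<alpha> \<subseteq> {..<m} \<and> (\<forall>x. act g x = act n (mact t \<alpha> x))"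
proof -
  have SC: "S \<subseteq> carrier G" by (rule compact_carrier[OF S(1)])
  have PC: "P \<subseteq> carrier G" using P A.subset by blast
  interpret U: subgroup U G using generate_is_subgroup[OF PC] P(3) by simp
  have PU: "P \<subseteq> U" unfolding P(3) by (auto intro: generate.incl)
  obtain V where V: "openin T V" "\<one> \<in> V" "\<And>g x. g \<in> V \<Longrightarrow> x \<in> P \<Longrightarrow> g \<otimes> x \<otimes> inv g \<otimes> inv x \<in> O'"
    using commutator_tube[OF P(1) O'(1,2)] by blast
  \<comment> \<open>A symmetric neighbourhood gives equality, not just inclusion, when it acts on
    \<open>U\<close>.\<close>
  define V' where "V' = V \<inter> {x \<in> carrier G. inv x \<in> V}"
  have V': "openin T V'" "\<one> \<in> V'"
    using openin_continuous_map_preimage[OF cont_inv V(1)] V by (auto simp: V'_def topspace_eq)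
  have V'C: "V' \<subseteq> carrier G" by (auto simp: V'_def)
  have sub: "act g ` U \<subseteq> U" if g: "g \<in> V" for g
  proof (rule act_image_subgroup[OF _ P(3,2)])
    show gC: "g \<in> carrier G" using g open_carrier[OF V(1)] by blast
    fix x assume x: "x \<in> P"
    then have xC: "x \<in> carrier G" "x \<in> A" using PC P by auto
    have "g \<otimes> x \<otimes> inv g \<otimes> inv x \<in> derived G (carrier G)" by (rule commutator_in_derived[OF gC xC(1)])
    then have "g \<otimes> x \<otimes> inv g \<otimes> inv x \<in> U" using V(3)[OF g x] O'(3) derived_subset by blast
    then have "(g \<otimes> x \<otimes> inv g \<otimes> inv x) \<otimes> x \<in> U" using x PU by blast
    then show "act g x \<in> U" using gC xC by (simp add: act_def m_assoc)
  qed
  have N: "act g ` U = U" if g: "g \<in> V'" for g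
  proof
    show "act g ` U \<subseteq> U" using g sub by (auto simp: V'_def)
    have gC: "g \<in> carrier G" using g V'C by blast
    have "act (inv g) ` U \<subseteq> U" using g sub by (auto simp: V'_def)
    then have "act g ` (act (inv g) ` U) \<subseteq> act g ` U" by (rule image_mono)
    then show "U \<subseteq> act g ` U" using act_inverse(1)[OF gC] by (simp add: image_image)
  qed
  obtain F where F: "finite F" "F \<subseteq> S" "S \<subseteq> F <#> V'" using compact_finite_cover[OF S(1) V'] by blast
  \<comment> \<open>Listing the inverses as separate generators allows monomials with natural
    exponents to suffice.\<close>
  obtain xs where xs: "set xs = F \<union> m_inv G ` F" using finite_list[of "F \<union> m_inv G ` F"] F(1) by auto
  define t where "t i = (if i < length xs then xs ! i else \<one>)" for i
  define m where "m = length xs"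
  have FC: "F \<subseteq> carrier G" using F SC by blast
  have t: "t i \<in> carrier G" for i
  proof (cases "i < length xs")
    case True
    then have "t i \<in> F \<union> m_inv G ` F" using xs by (auto simp: t_def)
    then show ?thesis using FC by auto
  qed (simp add: t_def)
  have idx: "\<exists>i<m. t i = f" if "f \<in> F \<union> m_inv G ` F" for f
  proof -
    have "f \<in> set xs" using that xs by simp
    then obtain i where "i < length xs" "xs ! i = f" unfolding in_set_conv_nth by blast
    then show ?thesis by (intro exI[of _ i]) (simp add: t_def m_def)
  qed
  define good where "good g \<longleftrightarrow> (\<exists>n\<in>carrier G. \<exists>\<alpha>. act n ` U = U \<and> set_mset \<alpha> \<subseteq> {..<m} \<and> (\<forall>x. act g x = act n (mact t \<alpha> x)))" for g
  have good1: "good (f \<otimes> v)" if f: "f \<in> F \<union> m_inv G ` F" and v: "v \<in> V'" for f v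
  proof -
    obtain i where i: "i < m" "t i = f" using idx[OF f] by blast
    have C: "f \<in> carrier G" "v \<in> carrier G" using f v FC V'C by auto
    have "act (f \<otimes> v) x = act v (mact t {#i#} x)" for x
      using C i act_act_commute by (simp add: act_mult mact_single[where t = t, OF t])
    then show ?thesis unfolding good_def using N[OF v] C i by (intro bexI[of _ v] exI[of _ "{#i#}"]) auto
  qed
  have "good g" if "g \<in> generate G S" for g
    using that
  proof (induction g rule: generate.induct)
    case one
    show ?case unfolding good_def
      by (intro bexI[of _ \<one>] exI[of _ "{#}"]) (auto simp: act_one mact_empty[where t = t, OF t])
  next
    case (incl s)
    then obtain f v where "f \<in> F" "v \<in> V'" "s = f \<otimes> v" using F(3) by (blast elim: mem_set_multE)
    then show ?case using good1[of f v] by simp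
  next
    case (inv s)
    then obtain f v where fv: "f \<in> F" "v \<in> V'" "s = f \<otimes> v" using F(3) by (blast elim: mem_set_multE)
    then have C: "f \<in> carrier G" "v \<in> carrier G" using FC V'C by auto
    have "inv v \<in> V'" using fv C by (auto simp: V'_def)
    then have g: "good (inv f \<otimes> inv v)" using fv by (intro good1) auto
    have "act (inv s) x = act (inv f \<otimes> inv v) x" for x
      using C fv act_act_commute by (simp add: inv_mult_group act_mult)
    then show ?case using g by (simp add: good_def)
  next
    case (eng g h)
    have C: "g \<in> carrier G" "h \<in> carrier G" using eng generate_in_carrier[OF SC] by auto
    obtain n \<alpha> where n: "n \<in> carrier G" "act n ` U = U" "set_mset \<alpha> \<subseteq> {..<m}" "\<And>x. act g x = act n (mact t \<alpha> x)"
      using eng unfolding good_def by blast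
    obtain k \<beta> where k: "k \<in> carrier G" "act k ` U = U" "set_mset \<beta> \<subseteq> {..<m}" "\<And>x. act h x = act k (mact t \<beta> x)"
      using eng unfolding good_def by blast
    have "act (n \<otimes> k) ` U = act n ` (act k ` U)" using n(1) k(1) by (simp add: image_image act_mult)
    then have "act (n \<otimes> k) ` U = U" using n(2) k(2) by simp
    moreover have "act (g \<otimes> h) x = act (n \<otimes> k) (mact t (\<alpha> + \<beta>) x)" for x
      using C n k by (simp add: act_mult mact_add[where t = t, OF t] act_mact_commute[where t = t, OF t])
    ultimately show ?case unfolding good_def using n k by (intro bexI[of _ "n \<otimes> k"] exI[of _ "\<alpha> + \<beta>"]) auto
  qed
  then show thesis using that[of t m] t S(2) unfolding good_def by blast
qed

lemma finitely_many_mod_relatively_open: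
  assumes P: "compactin T P" "P \<subseteq> A" and V: "subgroup V G" "V \<subseteq> A"
    and O': "openin T O'" "\<one> \<in> O'" "O' \<inter> A \<subseteq> V"
  obtains F where "finite F" "F \<subseteq> P" "P \<subseteq> F <#> V"
proof -
  obtain F where F: "finite F" "F \<subseteq> P" "P \<subseteq> F <#> O'" using compact_finite_cover[OF P(1) O'(1,2)] by blast
  have "P \<subseteq> F <#> V"
  proof
    fix x assume x: "x \<in> P"
    then obtain f b where fb: "f \<in> F" "b \<in> O'" "x = f \<otimes> b" using F(3) by (blast elim: mem_set_multE)
    have fA: "f \<in> A" "x \<in> A" using fb F(2) P x by auto
    have "b \<in> carrier G" using fb open_carrier[OF O'(1)] by blast
    then have "b = inv f \<otimes> x" using fb fA by (simp flip: m_assoc)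
    then have "b \<in> V" using fb fA O'(3) by blast
    then show "x \<in> F <#> V" unfolding fb(3) using fb(1) by (intro mem_set_multI)
  qed
  then show thesis using that F by blast
qed

lemma relatively_open_act_preimage:
  assumes O': "openin T O'" "\<one> \<in> O'" and E: "finite E" "E \<subseteq> carrier G"
  obtains O1 where "openin T O1" "\<one> \<in> O1" "\<And>x g. x \<in> O1 \<inter> A \<Longrightarrow> g \<in> E \<Longrightarrow> act g x \<in> O'"
proof -
  let ?R = "\<lambda>g. {x \<in> topspace T. g \<otimes> x \<otimes> inv g \<in> O'}"
  have op: "openin T (?R g)" if "g \<in> E" for g
  proof (rule openin_continuous_map_preimage[OF _ O'(1)])
    show "continuous_map T T (\<lambda>x. g \<otimes> x \<otimes> inv g)"
      using that E(2) by (intro continuous_mult continuous_inv continuous_const continuous_map_id[unfolded id_def]) auto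
  qed
  \<comment> \<open>Meeting with the whole space takes care of empty \<open>E\<close>, for which the
    intersection alone would be \<open>UNIV\<close>.\<close>
  have "openin T (topspace T \<inter> \<Inter>(?R ` E))"
  proof (cases "E = {}")
    case False
    have "openin T (\<Inter>(?R ` E))" using False E(1) op by (intro openin_Inter) auto
    then show ?thesis by auto
  qed simp
  then show thesis
  proof (rule that)
    show "\<one> \<in> topspace T \<inter> \<Inter>(?R ` E)" using E(2) O' by (auto simp: topspace_eq)
    fix x g assume "x \<in> (topspace T \<inter> \<Inter>(?R ` E)) \<inter> A" "g \<in> E"
    then show "act g x \<in> O'" by (simp add: act_def)
  qed
qed

text \<open>The last hypothesis says that \<open>P\<close> generates \<open>A\<close> topologically as a normal subgroup.\<close>

theorem Union_compact_normals_bounded: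
  assumes lc: "locally_compact_space T" and S: "compactin T S" "generate G S = carrier G"
    and A: "closedin T A" and P: "compactin T P" "P \<subseteq> A"
    and gen: "\<And>M O'. M \<lhd> G \<Longrightarrow> M \<subseteq> A \<Longrightarrow> P \<subseteq> M \<Longrightarrow> openin T O' \<Longrightarrow> \<one> \<in> O' \<Longrightarrow> O' \<inter> A \<subseteq> M \<Longrightarrow> M = A"
  shows "\<exists>L. compactin T L \<and> \<Union>(compact_normals A) \<subseteq> L"
proof -
  obtain O' C where O': "openin T O'" "compactin T C" "\<one> \<in> O'" "O' \<subseteq> C"
    using lc topspace_eq unfolding locally_compact_space_def by (metis one_closed)
  \<comment> \<open>The part \<open>C \<inter> A\<close> makes \<open>U\<close> relatively open in
    \<open>A\<close>; including \<open>P\<close> makes the translates of \<open>U\<close> generate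
    \<open>A\<close>.\<close>
  let ?P = "(C \<inter> A) \<union> P"
  have compP: "compactin T ?P"
    using O'(2) A P by (intro compactin_Un compact_Int_closedin)
  have PA: "?P \<subseteq> A" using P by blast
  define U where "U = generate G ?P"
  have PC: "?P \<subseteq> carrier G" using PA A.subset by blast
  have Usub: "subgroup U G" unfolding U_def by (rule generate_is_subgroup[OF PC])
  interpret U: subgroup U G by (rule Usub)
  have UA: "U \<subseteq> A" unfolding U_def by (rule generate_subgroup_incl[OF PA A.subgroup_axioms])
  have PU: "?P \<subseteq> U" unfolding U_def by (auto intro: generate.incl)
  have OU: "O' \<inter> A \<subseteq> U" using O'(4) PU by blast
  obtain t :: "nat \<Rightarrow> 'a" and m where t: "\<And>i. t i \<in> carrier G"
    and cover: "\<And>g. g \<in> carrier G \<Longrightarrow> \<exists>n\<in>carrier G. \<exists>\<alpha>. act n ` U = U \<and> set_mset \<alpha> \<subseteq> {..<m} \<and> (\<forall>x. act g x = act n (mact t \<alpha> x))"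
    using monomial_generators[OF S compP PA U_def O'(1,3) OU] by blast
  interpret M: monomial_action "G\<lparr>carrier := A\<rparr>" "{..<m}" "mact t" U
    by (rule monomial_action_A[where t = t, OF t _ Usub UA]) simp
  let ?B = "\<Union>\<beta>\<in>M.monomials. mact t \<beta> ` U"
  have macA: "mact t \<alpha> x \<in> A" if "x \<in> A" for \<alpha> x using mact_eq_act[where t = t, OF t, of \<alpha>] act_closed that by metis
  have BA: "?B \<subseteq> A" using macA UA by blast
  \<comment> \<open>The union of the translates is stable under conjugation, because the normalising
    factor \<open>n\<close> is absorbed by \<open>U\<close>. The generated subgroup is thus normal
    and relatively open, and the last hypothesis applies to it.\<close>
  have genB: "generate (G\<lparr>carrier := A\<rparr>) ?B = carrier (G\<lparr>carrier := A\<rparr>)"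
  proof -
    have UB: "U \<subseteq> generate G ?B"
    proof
      fix u assume "u \<in> U"
      then have "u \<in> mact t {#} ` U" by (simp add: mact_empty[where t = t, OF t])
      then have "u \<in> ?B" by (intro UN_I[of "{#}"]) auto
      then show "u \<in> generate G ?B" by (rule generate.incl)
    qed
    have "generate G ?B \<lhd> G"
    proof (rule normal_generateI)
      show "?B \<subseteq> carrier G" using BA A.subset by blast
      fix h g assume h: "h \<in> ?B" and g: "g \<in> carrier G"
      then obtain \<beta> u where \<beta>: "set_mset \<beta> \<subseteq> {..<m}" "u \<in> U" "h = mact t \<beta> u" by blast
      obtain n \<alpha> where n: "n \<in> carrier G" "act n ` U = U" "set_mset \<alpha> \<subseteq> {..<m}" "\<And>x. act g x = act n (mact t \<alpha> x)"
        using cover[OF g] by blast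
      have "h \<in> A" using h BA by blast
      then have "g \<otimes> h \<otimes> inv g = act g h" by (simp add: act_def)
      also have "\<dots> = mact t (\<alpha> + \<beta>) (act n u)"
        using n \<beta> by (simp add: mact_add[where t = t, OF t] act_mact_commute[where t = t, OF t])
      finally have "g \<otimes> h \<otimes> inv g = mact t (\<alpha> + \<beta>) (act n u)" .
      moreover have "act n u \<in> U" using n(2) \<beta>(2) by blast
      ultimately show "g \<otimes> h \<otimes> inv g \<in> ?B" using n(3) \<beta>(1) by (intro UN_I[of "\<alpha> + \<beta>"]) auto
    qed
    then have "generate G ?B = A"
      using generate_subgroup_incl[OF BA A.subgroup_axioms] UB PU OU O'(1,3)
      by (intro gen[of _ O']) auto
    then show ?thesis using generate_consistent[OF BA A.subgroup_axioms] by simp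
  qed
  have acc: "\<exists>n. \<forall>m\<ge>n. H m = H n"
    if H: "\<And>n::nat. subgroup (H n) (G\<lparr>carrier := A\<rparr>) \<and> {u \<in> U. \<forall>j\<in>{..<m}. mact t {#j#} u \<in> U} \<subseteq> H n \<and> H n \<subseteq> U"
      and inc: "incseq H" for H
  proof -
    \<comment> \<open>Being defined by finitely many continuous conditions, \<open>?V\<close> is
      relatively open in \<open>A\<close>. The compact generating set of \<open>U\<close> then meets
      only finitely many of its cosets, so \<open>U\<close> is finitely generated modulo
      \<open>?V\<close>.\<close>
    let ?V = "{u \<in> U. \<forall>j\<in>{..<m}. mact t {#j#} u \<in> U}"
    have V: "subgroup ?V (G\<lparr>carrier := A\<rparr>)"
    proof
      show "?V \<subseteq> carrier (G\<lparr>carrier := A\<rparr>)" using UA by auto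
      show "\<one>\<^bsub>G\<lparr>carrier := A\<rparr>\<^esub> \<in> ?V" using M.T_one by simp
      fix x assume x: "x \<in> ?V"
      then have "x \<in> A" using UA by blast
      then show "inv\<^bsub>G\<lparr>carrier := A\<rparr>\<^esub> x \<in> ?V" using x M.U.m_inv_closed M.T_inv by simp
      fix y assume y: "y \<in> ?V"
      then have "y \<in> A" using UA by blast
      then show "x \<otimes>\<^bsub>G\<lparr>carrier := A\<rparr>\<^esub> y \<in> ?V" using x y \<open>x \<in> A\<close> M.T_mult[of _ x y] by simp
    qed
    then have VG: "subgroup ?V G" using subgroup_A_iff[of ?V] UA by blast
    obtain O1 where O1: "openin T O1" "\<one> \<in> O1" "\<And>x g. x \<in> O1 \<inter> A \<Longrightarrow> g \<in> t ` {..<m} \<Longrightarrow> act g x \<in> O'"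
      using relatively_open_act_preimage[OF O'(1,3), of "t ` {..<m}"] t by blast
    have OV: "(O1 \<inter> O') \<inter> A \<subseteq> ?V"
    proof
      fix x assume x: "x \<in> (O1 \<inter> O') \<inter> A"
      have "act (t j) x \<in> U" if "j < m" for j
        using O1(3)[of x "t j"] x that act_closed[OF t] OU by blast
      then show "x \<in> ?V" using x OU by (auto simp: mact_single[where t = t, OF t])
    qed
    obtain F where F: "finite F" "F \<subseteq> ?P" "?P \<subseteq> F <#> ?V"
      using finitely_many_mod_relatively_open[OF compP PA VG _ _ _ OV] UA O1 O'(1,3) by blast
    have FA: "F \<subseteq> A" using F(2) PA by blast
    let ?W = "?V <#> generate G F"
    have "?P \<subseteq> ?W"
    proof
      fix x assume "x \<in> ?P"
      then obtain f v where fv: "f \<in> F" "v \<in> ?V" "x = f \<otimes> v" using F(3) by (blast elim: mem_set_multE)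
      then have eq: "x = v \<otimes> f" using A_commute FA UA by blast
      show "x \<in> ?W" unfolding eq by (intro mem_set_multI generate.incl fv)
    qed
    moreover have genF: "generate (G\<lparr>carrier := A\<rparr>) F = generate G F"
      by (rule generate_consistent[OF FA A.subgroup_axioms])
    then have "subgroup ?W (G\<lparr>carrier := A\<rparr>)"
      using M.mult_subgroups[OF V M.generate_is_subgroup[of F]] FA by simp
    moreover have "generate (G\<lparr>carrier := A\<rparr>) ?P = U"
      unfolding U_def by (rule generate_consistent[OF PA A.subgroup_axioms])
    ultimately have UW: "U \<subseteq> ?W" using M.generate_subgroup_incl[of ?P ?W] by simp
    show ?thesis
    proof (rule M.finitely_generated_chain_stabilizes[OF F(1) _ V])
      show "H n \<subseteq> ?V <#>\<^bsub>G\<lparr>carrier := A\<rparr>\<^esub> generate (G\<lparr>carrier := A\<rparr>) F" for n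
        using H[of n] UW genF by auto
    qed (use H inc FA in auto)
  qed
  have "\<exists>K0\<in>compact_normals A. \<Union>(compact_normals A) \<subseteq> K0 <#>\<^bsub>G\<lparr>carrier := A\<rparr>\<^esub> (\<Union>(compact_normals A) \<inter> U)"
  proof (rule M.noetherian_up_to_U[OF genB acc])
    show "compact_normals A \<noteq> {}" using one_compact_normals[OF A.one_closed] by blast
    fix K assume K: "K \<in> compact_normals A"
    then have KG: "K \<lhd> G" "K \<subseteq> A" by (auto simp: compact_normals_def)
    have "mact t \<alpha> ` K \<subseteq> K" for \<alpha>
    proof -
      obtain g where "g \<in> carrier G" "\<And>x. mact t \<alpha> x = act g x" using mact_eq_act[where t = t, OF t] by blast
      then show ?thesis using normal.inv_op_closed2[OF KG(1)] KG(2) by (auto simp: act_def)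
    qed
    then show "M.invariant_subgroup K"
      unfolding M.invariant_subgroup_def using subgroup_A_iff[OF KG(2)] normal_imp_subgroup[OF KG(1)] by blast
    fix K' assume "K' \<in> compact_normals A"
    then show "K <#>\<^bsub>G\<lparr>carrier := A\<rparr>\<^esub> K' \<in> compact_normals A"
      using compact_normals_mult[OF A.subgroup_axioms K] by simp
  qed auto
  then obtain K0 where K0: "K0 \<in> compact_normals A" "\<Union>(compact_normals A) \<subseteq> K0 <#> (\<Union>(compact_normals A) \<inter> U)"
    by auto
  \<comment> \<open>Every element of the union lies in a compact subgroup and so has bounded powers;
    for those in the compactly generated group \<open>U\<close> the theorem on bounded elements
    gives one compact set.\<close>
  let ?bdd = "{Y. Y \<subseteq> U \<and> (\<exists>L. compactin T L \<and> Y \<subseteq> L)}"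
  interpret Bo: bornological_group "G\<lparr>carrier := U\<rparr>" ?bdd "O' \<inter> U"
    using UA A_commute by (intro bornological_abelian_subgroup[OF Usub _ O'(1,3,4,2)]) blast
  have "generate (G\<lparr>carrier := U\<rparr>) ?P = carrier (G\<lparr>carrier := U\<rparr>)"
    using generate_consistent[OF PU Usub] by (simp add: U_def)
  moreover have "?P \<in> ?bdd" using PU compP by blast
  ultimately have "{b \<in> carrier (G\<lparr>carrier := U\<rparr>). range (\<lambda>n::nat. b [^]\<^bsub>G\<lparr>carrier := U\<rparr>\<^esub> n) \<in> ?bdd} \<in> ?bdd"
    by (intro Bo.bounded_elements_bounded)
  then obtain L where L: "compactin T L" "{b \<in> U. range (\<lambda>n::nat. b [^] n) \<in> ?bdd} \<subseteq> L"
    by (auto simp: nat_pow_consistent[symmetric])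
  have "\<Union>(compact_normals A) \<inter> U \<subseteq> L"
  proof
    fix x assume x: "x \<in> \<Union>(compact_normals A) \<inter> U"
    then obtain K where K: "K \<lhd> G" "compactin T K" "x \<in> K" by (auto simp: compact_normals_def)
    interpret K: normal K G by (rule K(1))
    have "x [^] (n::nat) \<in> K \<inter> U" for n by (induction n) (use x K(3) in auto)
    then have "range (\<lambda>n::nat. x [^] n) \<subseteq> U" "range (\<lambda>n::nat. x [^] n) \<subseteq> K" by blast+
    then show "x \<in> L" using L(2) x K(2) by blast
  qed
  then have "\<Union>(compact_normals A) \<subseteq> K0 <#> L" using K0(2) mono_set_mult[OF order_refl] by blast
  moreover have "compactin T (K0 <#> L)" using K0(1) L(1) by (intro compact_set_mult) (simp_all add: compact_normals_def)
  ultimately show ?thesis by blast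
qed

end

section \<open>The maximal compact normal subgroup\<close>

context topo_group
begin

lemma topo_abelian_normal_closure_derived:
  assumes "Hausdorff_space T" "metabelian G"
  shows "topo_abelian_normal G T (T closure_of derived G (carrier G))"
proof (intro topo_abelian_normal.intro topo_group_axioms abelian_normal.intro is_group abelian_normal_axioms.intro)
  have sub: "derived G (carrier G) \<subseteq> carrier G" by (rule derived_in_carrier) simp
  show "T closure_of derived G (carrier G) \<lhd> G" by (rule normal_closure[OF derived_self_is_normal])
  show "derived G (carrier G) \<subseteq> T closure_of derived G (carrier G)"
    using sub topspace_eq by (intro closure_of_subset) simp
  show "x \<otimes> y = y \<otimes> x" if "x \<in> T closure_of derived G (carrier G)" "y \<in> T closure_of derived G (carrier G)" for x y
    using commute_closure[OF assms(1) sub _ that] assms(2) unfolding metabelian_def by blast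
qed

lemma compact_commutators:
  assumes "compactin T S"
  shows "compactin T {s \<otimes> t \<otimes> inv s \<otimes> inv t | s t. s \<in> S \<and> t \<in> S}"
proof -
  have "continuous_map (prod_topology T T) T (\<lambda>p. fst p \<otimes> snd p \<otimes> inv (fst p) \<otimes> inv (snd p))"
    by (intro continuous_mult continuous_inv continuous_map_fst continuous_map_snd)
  moreover have "compactin (prod_topology T T) (S \<times> S)" using assms by (simp add: compactin_Times)
  ultimately have "compactin T ((\<lambda>p. fst p \<otimes> snd p \<otimes> inv (fst p) \<otimes> inv (snd p)) ` (S \<times> S))"
    by (intro image_compactin)
  moreover have "(\<lambda>p. fst p \<otimes> snd p \<otimes> inv (fst p) \<otimes> inv (snd p)) ` (S \<times> S)
      = {s \<otimes> t \<otimes> inv s \<otimes> inv t | s t. s \<in> S \<and> t \<in> S}" by force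
  ultimately show ?thesis by simp
qed

text \<open>A relatively open \<open>M\<close> is closed in \<open>G\<close>, so it suffices to
  catch the commutators of generators.\<close>

lemma closure_derived_subset:
  assumes S: "compactin T S" "generate G S = carrier G"
    and A: "closedin T A" "subgroup A G"
    and M: "M \<lhd> G" "M \<subseteq> A" "{s \<otimes> t \<otimes> inv s \<otimes> inv t | s t. s \<in> S \<and> t \<in> S} \<subseteq> M"
    and O': "openin T O'" "\<one> \<in> O'" "O' \<inter> A \<subseteq> M"
  shows "T closure_of derived G (carrier G) \<subseteq> M"
proof -
  have "derived G (carrier G) \<subseteq> M"
    using M(3) by (intro normal.derived_subset_if_generators_commute[OF M(1) compact_carrier[OF S(1)] S(2)]) blast
  moreover have "closedin T M"
    by (rule relatively_open_subgroup_closed[OF A normal_imp_subgroup[OF M(1)] M(2) O'])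
  ultimately show ?thesis by (rule closure_of_minimal)
qed

text \<open>Here \<open>[K, G] \<subseteq> K \<inter> [G, G]\<close> is trivial for every compact normal \<open>K\<close>, so \<open>W(G)\<close> is central.\<close>

lemma W_bounded_if_no_compact_normals:
  assumes T2: "Hausdorff_space T" and lc: "locally_compact_space T" and mb: "metabelian G"
    and S: "compactin T S" "generate G S = carrier G"
    and triv: "compact_normals (T closure_of derived G (carrier G)) \<subseteq> {{\<one>}}"
  shows "\<exists>L. compactin T L \<and> W_sub G T \<subseteq> L"
proof -
  define A where "A = T closure_of derived G (carrier G)"
  interpret A: topo_abelian_normal G T A unfolding A_def by (rule topo_abelian_normal_closure_derived[OF T2 mb])
  have A_closed: "closedin T A" by (simp add: A_def)
  have W: "W_sub G T \<lhd> G" unfolding W_sub_eq by (rule normal_Union_compact_normals[OF subgroup_self])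
  interpret W: normal "W_sub G T" G by (rule W)
  have central: "g \<otimes> w = w \<otimes> g" if w: "w \<in> W_sub G T" and g: "g \<in> carrier G" for w g
  proof -
    obtain K where K: "K \<lhd> G" "compactin T K" "w \<in> K" using w by (auto simp: W_sub_def)
    interpret K: normal K G by (rule K(1))
    have "K \<inter> A \<in> compact_normals A"
      using normal_subgroup_intersect[OF K(1) A.A_normal] compact_Int_closedin[OF K(2) A_closed]
      by (simp add: compact_normals_def)
    then have KA: "K \<inter> A \<subseteq> {\<one>}" using triv unfolding A_def by auto
    have wC: "w \<in> carrier G" using K(3) by simp
    have "(g \<otimes> w \<otimes> inv g) \<otimes> inv w \<in> K" using K.inv_op_closed2[OF g K(3)] K(3) by blast
    moreover have "g \<otimes> w \<otimes> inv g \<otimes> inv w \<in> A"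
      using commutator_in_derived[OF g wC] A.derived_subset by blast
    ultimately have one: "g \<otimes> w \<otimes> inv g \<otimes> inv w = \<one>" using KA by blast
    have "(g \<otimes> w \<otimes> inv g \<otimes> inv w) \<otimes> (w \<otimes> g) = g \<otimes> w \<otimes> inv g \<otimes> (inv w \<otimes> w) \<otimes> g"
      using g wC by (simp only: m_assoc m_closed inv_closed)
    also have "\<dots> = g \<otimes> w" using g wC by (simp add: m_assoc)
    finally show ?thesis using g wC one by simp
  qed
  obtain O' C where O': "openin T O'" "compactin T C" "\<one> \<in> O'" "O' \<subseteq> C"
    using lc topspace_eq unfolding locally_compact_space_def by (metis one_closed)
  let ?p = "\<lambda>x. A #> x"
  let ?B = "{Y. \<exists>L. compactin T L \<and> Y \<subseteq> ?p ` L}"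
  interpret Bo: bornological_group "G Mod A" ?B "?p ` O'"
    by (rule bornological_abelian_quotient[OF A.A_normal A.derived_subset O'(1,3,4,2)])
  interpret p: group_hom G "G Mod A" ?p
    by (intro group_hom.intro group_hom_axioms.intro is_group A.A.factorgroup_is_group A.A.r_coset_hom_Mod)
  have "generate (G Mod A) (?p ` S) = carrier (G Mod A)"
    using p.generate_img[OF compact_carrier[OF S(1)]] S(2) by (simp add: carrier_FactGroup)
  moreover have "?p ` S \<in> ?B" using S(1) by blast
  ultimately have "{b \<in> carrier (G Mod A). range (\<lambda>n::nat. b [^]\<^bsub>G Mod A\<^esub> n) \<in> ?B} \<in> ?B"
    by (intro Bo.bounded_elements_bounded)
  then obtain L where L: "compactin T L"
    "{b \<in> carrier (G Mod A). range (\<lambda>n::nat. b [^]\<^bsub>G Mod A\<^esub> n) \<in> ?B} \<subseteq> ?p ` L" by blast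
  have LC: "L \<subseteq> carrier G" by (rule compact_carrier[OF L(1)])
  \<comment> \<open>Powers of \<open>w\<close> stay in a compact normal subgroup, so its coset is a
    bounded element of the abelian group \<open>G Mod A\<close>; the theorem on bounded elements
    there supplies \<open>L\<close>.\<close>
  have WL: "w \<in> L <#> A" if w: "w \<in> W_sub G T" for w
  proof -
    obtain K where K: "K \<lhd> G" "compactin T K" "w \<in> K" using w by (auto simp: W_sub_def)
    interpret K: normal K G by (rule K(1))
    have wC: "w \<in> carrier G" using K(3) by simp
    have "w [^] (n::nat) \<in> K" for n by (induction n) (use K(3) in auto)
    then have "range (\<lambda>n::nat. (A #> w) [^]\<^bsub>G Mod A\<^esub> n) \<subseteq> ?p ` K"
      using A.A.FactGroup_pow[OF wC] by auto
    then have "range (\<lambda>n::nat. (A #> w) [^]\<^bsub>G Mod A\<^esub> n) \<in> ?B" using K(2) by blast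
    moreover have "A #> w \<in> carrier (G Mod A)" using wC by (auto simp: carrier_FactGroup)
    ultimately have "A #> w \<in> ?p ` L" by (intro subsetD[OF L(2)]) simp
    then obtain l where l: "l \<in> L" "A #> w = A #> l" by blast
    have lC: "l \<in> carrier G" using l LC by blast
    have "w \<otimes> inv l \<in> A" using A.A.rcoset_eq_iff[OF wC lC] l by simp
    then have "inv l \<otimes> (w \<otimes> inv l) \<otimes> l \<in> A" by (rule A.A.inv_op_closed1[OF lC])
    then have "inv l \<otimes> w \<in> A" using wC lC by (simp add: m_assoc)
    then have "l \<otimes> (inv l \<otimes> w) \<in> L <#> A" using l by (intro mem_set_multI)
    then show ?thesis using wC lC by (simp flip: m_assoc)
  qed
  define B where "B = T closure_of (A <#> W_sub G T)"
  have AW: "A <#> W_sub G T \<lhd> G" by (rule normal_set_mult[OF A.A_normal W])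
  then have AWC: "A <#> W_sub G T \<subseteq> carrier G" using normal_imp_subgroup subgroup.subset by blast
  have B_closed: "closedin T B" by (simp add: B_def)
  have AW_sub: "A <#> W_sub G T \<subseteq> B" unfolding B_def using AWC topspace_eq by (intro closure_of_subset) simp
  have WB: "W_sub G T \<subseteq> B"
  proof
    fix w assume w: "w \<in> W_sub G T"
    then have "\<one> \<otimes> w \<in> A <#> W_sub G T" by (intro mem_set_multI) auto
    then show "w \<in> B" using w AW_sub by auto
  qed
  have AB: "A \<subseteq> B"
  proof
    fix a assume a: "a \<in> A"
    then have "a \<otimes> \<one> \<in> A <#> W_sub G T" by (intro mem_set_multI) auto
    then show "a \<in> B" using a AW_sub by auto
  qed
  interpret B: topo_abelian_normal G T B
  proof (intro topo_abelian_normal.intro topo_group_axioms abelian_normal.intro is_group abelian_normal_axioms.intro)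
    show "B \<lhd> G" unfolding B_def by (rule normal_closure[OF AW])
    show "derived G (carrier G) \<subseteq> B" using A.derived_subset AB by blast
    have "x \<otimes> y = y \<otimes> x" if xy: "x \<in> A <#> W_sub G T" "y \<in> A <#> W_sub G T" for x y
    proof -
      obtain a w where x: "a \<in> A" "w \<in> W_sub G T" "x = a \<otimes> w" using xy(1) by (rule mem_set_multE)
      obtain b v where y: "b \<in> A" "v \<in> W_sub G T" "y = b \<otimes> v" using xy(2) by (rule mem_set_multE)
      have C: "a \<in> carrier G" "w \<in> carrier G" "b \<in> carrier G" "v \<in> carrier G" using x y by auto
      have "x \<otimes> y = a \<otimes> (w \<otimes> b) \<otimes> v" using C x y by (simp add: m_assoc)
      also have "w \<otimes> b = b \<otimes> w" using central[OF x(2) C(3)] by simp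
      also have "a \<otimes> (b \<otimes> w) \<otimes> v = (a \<otimes> b) \<otimes> (w \<otimes> v)" using C by (simp add: m_assoc)
      also have "a \<otimes> b = b \<otimes> a" by (rule A.A_commute[OF x(1) y(1)])
      also have "w \<otimes> v = v \<otimes> w" using central[OF y(2) C(2)] .
      also have "(b \<otimes> a) \<otimes> (v \<otimes> w) = b \<otimes> (a \<otimes> v) \<otimes> w" using C by (simp add: m_assoc)
      also have "a \<otimes> v = v \<otimes> a" by (rule central[OF y(2) C(1)])
      finally show ?thesis using C x y by (simp add: m_assoc)
    qed
    then show "x \<otimes> y = y \<otimes> x" if "x \<in> B" "y \<in> B" for x y
      using commute_closure[OF T2 AWC _ that[unfolded B_def]] by blast
  qed
  \<comment> \<open>Modulo \<open>A\<close> the group \<open>B\<close> is covered by the compact set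
    \<open>L\<close>; this yields the compact generating set needed to treat \<open>B\<close> in
    place of \<open>A\<close>.\<close>
  have B_sub: "B \<subseteq> L <#> A" unfolding B_def
  proof (rule closure_of_minimal)
    show "closedin T (L <#> A)" by (rule closed_compact_mult[OF L(1) A_closed])
    show "A <#> W_sub G T \<subseteq> L <#> A"
    proof
      fix x assume "x \<in> A <#> W_sub G T"
      then obtain a w where x: "a \<in> A" "w \<in> W_sub G T" "x = a \<otimes> w" by (rule mem_set_multE)
      obtain l b where lb: "l \<in> L" "b \<in> A" "w = l \<otimes> b" using WL[OF x(2)] by (rule mem_set_multE)
      have C: "a \<in> carrier G" "l \<in> carrier G" "b \<in> carrier G" using x lb LC by auto
      have "x = w \<otimes> a" using central[OF x(2) C(1)] x(3) by simp
      then have "x = l \<otimes> (b \<otimes> a)" using C lb by (simp add: m_assoc)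
      then show "x \<in> L <#> A" using lb x by (auto intro!: mem_set_multI)
    qed
  qed
  let ?c = "{s \<otimes> t \<otimes> inv s \<otimes> inv t | s t. s \<in> S \<and> t \<in> S}"
  have cB: "?c \<subseteq> B" using commutator_in_derived compact_carrier[OF S(1)] B.derived_subset by blast
  have "\<exists>L. compactin T L \<and> \<Union>(compact_normals B) \<subseteq> L"
  proof (rule B.Union_compact_normals_bounded[OF lc S B_closed])
    \<comment> \<open>The commutators force \<open>A\<close> into every admissible \<open>M\<close>,
      and \<open>L \<inter> B\<close> then accounts for the rest of \<open>B\<close>.\<close>
    show "compactin T (?c \<union> (L \<inter> B))"
      by (intro compactin_Un compact_commutators S(1) compact_Int_closedin L(1) B_closed)
    show "?c \<union> (L \<inter> B) \<subseteq> B" using cB by blast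
    fix M O' assume M: "M \<lhd> G" "M \<subseteq> B" "?c \<union> (L \<inter> B) \<subseteq> M" and O': "openin T O'" "\<one> \<in> O'" "O' \<inter> B \<subseteq> M"
    interpret M: normal M G by (rule M(1))
    have AM: "A \<subseteq> M" unfolding A_def
      using M(3) by (intro closure_derived_subset[OF S B_closed B.A.subgroup_axioms M(1,2) _ O']) blast
    have "x \<in> M" if x: "x \<in> B" for x
    proof -
      obtain l a where la: "l \<in> L" "a \<in> A" "x = l \<otimes> a" using B_sub x by (blast elim: mem_set_multE)
      have C: "l \<in> carrier G" "a \<in> carrier G" using la LC by auto
      have "l = x \<otimes> inv a" using C la by (simp add: m_assoc)
      then have "l \<in> B" using x la(2) AB by blast
      then have "l \<in> M" using la(1) M(3) by blast
      then show "x \<in> M" unfolding la(3) using la(2) AM by blast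
    qed
    then show "M = B" using M(2) by blast
  qed
  then obtain L' where L': "compactin T L'" "\<Union>(compact_normals B) \<subseteq> L'" by (elim exE conjE)
  have "W_sub G T \<subseteq> \<Union>(compact_normals B)"
  proof
    fix w assume "w \<in> W_sub G T"
    then obtain K where K: "K \<lhd> G" "compactin T K" "w \<in> K" by (auto simp: W_sub_def)
    then have "K \<subseteq> W_sub G T" by (auto simp: W_sub_def)
    then have "K \<in> compact_normals B" using K WB by (auto simp: compact_normals_def)
    then show "w \<in> \<Union>(compact_normals B)" using K by blast
  qed
  then have "W_sub G T \<subseteq> L'" using L'(2) by (rule subset_trans)
  with L'(1) show ?thesis by (intro exI conjI)
qed

lemma Union_subset_imp_trivial:
  assumes "Z \<lhd> G" "K \<lhd> (G Mod Z)" "\<Union>K \<subseteq> Z"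
  shows "K = {Z}"
proof -
  interpret Z: normal Z G by fact
  interpret K: normal K "G Mod Z" by fact
  have "Y = Z" if Y: "Y \<in> K" for Y
  proof -
    obtain y where y: "y \<in> carrier G" "Y = Z #> y" using K.mem_carrier[OF Y] by (auto simp: carrier_FactGroup)
    have "y \<in> Y" unfolding y(2) by (rule rcos_self[OF y(1) Z.subgroup_axioms])
    then have "y \<in> Z" using Y assms(3) by blast
    then show ?thesis using y coset_join2[OF _ Z.subgroup_axioms] by simp
  qed
  moreover have "Z \<in> K" using subgroup.one_closed[OF K.subgroup_axioms] by simp
  ultimately show ?thesis by blast
qed

theorem W_bounded:
  assumes T2: "Hausdorff_space T" and lc: "locally_compact_space T" and mb: "metabelian G"
    and cg: "compactly_generated G T"
  shows "\<exists>L. compactin T L \<and> W_sub G T \<subseteq> L"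
proof -
  obtain S where S: "compactin T S" "generate G S = carrier G" using cg by (auto simp: compactly_generated_def)
  define A where "A = T closure_of derived G (carrier G)"
  interpret A: topo_abelian_normal G T A unfolding A_def by (rule topo_abelian_normal_closure_derived[OF T2 mb])
  have A_closed: "closedin T A" by (simp add: A_def)
  let ?c = "{s \<otimes> t \<otimes> inv s \<otimes> inv t | s t. s \<in> S \<and> t \<in> S}"
  have cA: "?c \<subseteq> A" using commutator_in_derived compact_carrier[OF S(1)] A.derived_subset by blast
  have "\<exists>L. compactin T L \<and> \<Union>(compact_normals A) \<subseteq> L"
  proof (rule A.Union_compact_normals_bounded[OF lc S A_closed compact_commutators[OF S(1)] cA])
    fix M O' assume M: "M \<lhd> G" "M \<subseteq> A" "?c \<subseteq> M" and O': "openin T O'" "\<one> \<in> O'" "O' \<inter> A \<subseteq> M"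
    have "A \<subseteq> M" using closure_derived_subset[OF S A_closed A.A.subgroup_axioms M O'] by (simp add: A_def)
    then show "M = A" using M(2) by blast
  qed
  then obtain L where L: "compactin T L" "\<Union>(compact_normals A) \<subseteq> L" by (elim exE conjE)
  define Z where "Z = \<Union>(compact_normals A)"
  have Zmem: "Z \<in> compact_normals A"
    unfolding Z_def by (rule Union_compact_normals_mem[OF T2 A.A.subgroup_axioms A_closed L])
  then have Z: "Z \<lhd> G" "compactin T Z" "Z \<subseteq> A" by (auto simp: compact_normals_def)
  interpret Z: normal Z G by (rule Z(1))
  let ?p = "\<lambda>x. Z #> x" and ?TQ = "quotient_group_topology G T Z"
  interpret Q: topo_group "G Mod Z" ?TQ by (rule topo_group_quotient[OF Z(1)])
  interpret p: group_hom G "G Mod Z" ?p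
    by (intro group_hom.intro group_hom_axioms.intro is_group Z.factorgroup_is_group Z.r_coset_hom_Mod)
  have T2Q: "Hausdorff_space ?TQ" by (rule Hausdorff_quotient[OF Z(1) compactin_imp_closedin[OF T2 Z(2)]])
  have lcQ: "locally_compact_space ?TQ" by (rule locally_compact_quotient[OF Z(1) lc])
  have mbQ: "metabelian (G Mod Z)" by (rule Z.metabelian_FactGroup[OF mb])
  obtain S' where S': "compactin ?TQ S'" "generate (G Mod Z) S' = carrier (G Mod Z)"
    using compactly_generated_quotient[OF Z(1) cg] by (auto simp: compactly_generated_def)
  have pA: "?p ` A \<subseteq> rcosets Z" using rcosets_mem by auto
  have UpA: "\<Union>(?p ` A) = A"
  proof -
    have "Z <#> A \<subseteq> A" using Z(3) by (auto simp: set_mult_def)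
    moreover have "A \<subseteq> Z <#> A" using mem_set_multI[of \<one> Z _ A G] by auto
    ultimately show ?thesis by (simp add: Z.Union_rcoset_image)
  qed
  \<comment> \<open>Because \<open>Z\<close> is contained in \<open>A\<close>, the set
    \<open>A\<close> and its complement are unions of cosets of \<open>Z\<close>.\<close>
  have "closedin ?TQ (?p ` A)"
  proof -
    have sub: "rcosets Z - ?p ` A \<subseteq> rcosets Z" by blast
    have "\<Union>(rcosets Z - ?p ` A) = {x \<in> carrier G. ?p x \<notin> ?p ` A}"
      unfolding Z.Union_rcosets_eq[OF sub] by (auto simp: rcosets_mem)
    also have "\<dots> = carrier G - \<Union>(?p ` A)" unfolding Z.Union_rcosets_eq[OF pA] by auto
    finally have "\<Union>(rcosets Z - ?p ` A) = topspace T - A" by (simp only: UpA topspace_eq)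
    moreover have "openin T (topspace T - A)" using A_closed by (simp add: closedin_def)
    ultimately have "openin ?TQ (rcosets Z - ?p ` A)" using openin_quotient[OF Z(1)] by simp
    then show ?thesis unfolding closedin_def topspace_quotient[OF Z(1)] using pA by blast
  qed
  moreover have "derived (G Mod Z) (carrier (G Mod Z)) \<subseteq> ?p ` A"
    unfolding Z.derived_FactGroup using A.derived_subset by (rule image_mono)
  ultimately have clQ: "?TQ closure_of derived (G Mod Z) (carrier (G Mod Z)) \<subseteq> ?p ` A"
    by (intro closure_of_minimal)
  \<comment> \<open>The preimage of a compact normal subgroup is again compact, because
    \<open>Z\<close> is; lying inside \<open>A\<close>, it is contained in \<open>Z\<close> by
    maximality.\<close>
  have triv: "Q.compact_normals (?TQ closure_of derived (G Mod Z) (carrier (G Mod Z))) \<subseteq> {{\<one>\<^bsub>G Mod Z\<^esub>}}"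
  proof
    fix K assume "K \<in> Q.compact_normals (?TQ closure_of derived (G Mod Z) (carrier (G Mod Z)))"
    then have K: "K \<lhd> (G Mod Z)" "compactin ?TQ K" "K \<subseteq> ?p ` A" using clQ by (auto simp: Q.compact_normals_def)
    have "\<Union>K \<subseteq> A" using K(3) UpA by blast
    moreover have "\<Union>K \<lhd> G" by (rule Z.factgroup_subgroup_union_normal[OF K(1)])
    moreover have "compactin T (\<Union>K)" by (rule compact_Union_quotient[OF Z(1,2) lc T2 K(2)])
    ultimately have "\<Union>K \<subseteq> Z" unfolding Z_def by (auto simp: compact_normals_def)
    then show "K \<in> {{\<one>\<^bsub>G Mod Z\<^esub>}}" using Union_subset_imp_trivial[OF Z(1) K(1)] by simp
  qed
  obtain LQ where LQ: "compactin ?TQ LQ" "W_sub (G Mod Z) ?TQ \<subseteq> LQ"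
    using Q.W_bounded_if_no_compact_normals[OF T2Q lcQ mbQ S' triv] by blast
  have "W_sub G T \<subseteq> \<Union>LQ"
  proof
    fix w assume "w \<in> W_sub G T"
    then obtain K where K: "K \<lhd> G" "compactin T K" "w \<in> K" by (auto simp: W_sub_def)
    have "?p ` K \<lhd> (G Mod Z)"
      by (rule normal.surj_hom_normal_subgroup[OF K(1) p.group_hom_axioms]) (simp add: carrier_FactGroup)
    moreover have "compactin ?TQ (?p ` K)" by (rule image_compactin[OF K(2) continuous_quotient[OF Z(1)]])
    ultimately have "?p ` K \<subseteq> LQ" using LQ(2) by (auto simp: W_sub_def)
    then have "Z #> w \<in> LQ" using K(3) by blast
    moreover have "w \<in> Z #> w"
      using rcos_self[OF _ Z.subgroup_axioms] compact_carrier[OF K(2)] K(3) by blast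
    ultimately show "w \<in> \<Union>LQ" by blast
  qed
  then show ?thesis using compact_Union_quotient[OF Z(1,2) lc T2 LQ(1)] by blast
qed

end

section \<open>Totally disconnected groups\<close>

context topo_group
begin

text \<open>In the compact Hausdorff space \<open>K\<close> components and quasi-components agree,
  so the quasi-component of \<open>x\<close> is a point and a clopen subset of \<open>K\<close>
  separates \<open>x\<close> from \<open>K - U\<close>.\<close>

lemma compact_open_neighbourhood:
  assumes T2: "Hausdorff_space T" and lc: "locally_compact_space T" and td: "totally_disconnected_space T"
    and x: "x \<in> topspace T"
  shows "\<exists>P. compactin T P \<and> openin T P \<and> x \<in> P"
proof -
  obtain U K where UK: "openin T U" "compactin T K" "x \<in> U" "U \<subseteq> K"
    using lc x unfolding locally_compact_space_def by metis
  let ?K = "subtopology T K"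
  have KT: "K \<subseteq> topspace T" by (rule compactin_subset_topspace[OF UK(2)])
  have top: "topspace ?K = K" using KT by auto
  have xK: "x \<in> topspace ?K" using UK top by auto
  have cK: "compact_space ?K" using UK(2) compactin_subspace by blast
  have "quasi_components_of ?K = connected_components_of ?K"
    using cK Hausdorff_space_subtopology[OF T2] by (intro quasi_eq_connected_components_of) blast
  moreover have qc: "quasi_component_of_set ?K x \<in> quasi_components_of ?K"
    using xK by (simp add: quasi_component_in_quasi_components_of)
  ultimately have "connectedin ?K (quasi_component_of_set ?K x)"
    using connectedin_connected_components_of by metis
  then have "connectedin T (quasi_component_of_set ?K x)" by (simp add: connectedin_subtopology)
  then obtain a where "quasi_component_of_set ?K x \<subseteq> {a}" using td unfolding totally_disconnected_space_def by blast
  moreover have xq: "x \<in> quasi_component_of_set ?K x" using xK by (simp add: quasi_component_of_refl)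
  ultimately have q: "quasi_component_of_set ?K x = {x}" by blast
  have cl: "closedin T (topspace T - U)" using UK(1) by blast
  have "compactin ?K (K - U)"
  proof -
    have "compactin T (K \<inter> (topspace T - U))" by (rule compact_Int_closedin[OF UK(2) cl])
    moreover have "K \<inter> (topspace T - U) = K - U" using KT by blast
    ultimately show ?thesis by (simp add: compactin_subtopology)
  qed
  moreover have "disjnt {x} (K - U)" using UK(3) by (simp add: disjnt_iff)
  ultimately have "separated_between ?K {x} (K - U)"
    using separated_between_quasi_component_compact[of "{x}" ?K "K - U"] qc q by simp
  then obtain P R where PR: "openin ?K P" "openin ?K R" "P \<union> R = K" "disjnt P R" "x \<in> P" "K - U \<subseteq> R"
    unfolding separated_between_def top by auto
  \<comment> \<open>Containment in the open set \<open>U\<close> is what makes \<open>P\<close> open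
    in the whole space and not only in \<open>K\<close>.\<close>
  have PU: "P \<subseteq> U" using PR by (auto simp: disjnt_iff)
  have "closedin ?K P"
  proof -
    have "P = topspace ?K - R" using PR(3,4) top by (auto simp: disjnt_iff)
    then show ?thesis using PR(2) by blast
  qed
  then have "compactin ?K P" using cK closedin_compact_space by blast
  then have "compactin T P" by (simp add: compactin_subtopology)
  moreover have "openin T P"
  proof -
    obtain O' where O': "openin T O'" "P = O' \<inter> K" using PR(1) by (auto simp: openin_subtopology)
    have "P = O' \<inter> U" using O'(2) PU UK(4) by blast
    then show ?thesis using O'(1) UK(1) by auto
  qed
  ultimately show ?thesis using PR(5) by blast
qed

text \<open>Van Dantzig's theorem. By the tube lemma some symmetric neighbourhood \<open>V'\<close>
  satisfies \<open>P <#> V' \<subseteq> P\<close>, and then the subgroup generated by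
  \<open>V'\<close> cannot leave \<open>P\<close>.\<close>

lemma compact_open_subgroup:
  assumes "Hausdorff_space T" "locally_compact_space T" "totally_disconnected_space T"
  obtains C where "subgroup C G" "compactin T C" "openin T C"
proof -
  obtain P where P: "compactin T P" "openin T P" "\<one> \<in> P"
    using compact_open_neighbourhood[OF assms, of \<one>] topspace_eq by auto
  let ?W = "{p \<in> topspace (prod_topology T T). (case p of (x, y) \<Rightarrow> x \<otimes> y) \<in> P}"
  have W: "openin (prod_topology T T) ?W" by (rule openin_continuous_map_preimage[OF cont_mult P(2)])
  have PC: "P \<subseteq> carrier G" by (rule compact_carrier[OF P(1)])
  have "P \<times> {\<one>} \<subseteq> ?W" using PC by (auto simp: topspace_eq)
  then obtain V0 V where V: "openin T V" "P \<subseteq> V0" "\<one> \<in> V" "V0 \<times> V \<subseteq> ?W"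
    using tube_lemma_left[OF W P(1), of \<one>] topspace_eq by (metis (no_types, lifting) one_closed)
  have PV: "p \<otimes> v \<in> P" if "p \<in> P" "v \<in> V" for p v
  proof -
    have "(p, v) \<in> ?W" using that V(2,4) by blast
    then show ?thesis by simp
  qed
  define V' where "V' = V \<inter> {x \<in> topspace T. inv x \<in> V}"
  have V': "openin T V'" "\<one> \<in> V'"
    using openin_continuous_map_preimage[OF cont_inv V(1)] V by (auto simp: V'_def topspace_eq)
  have V'C: "V' \<subseteq> carrier G" by (auto simp: V'_def topspace_eq)
  let ?H = "generate G V'"
  have H: "subgroup ?H G" by (rule generate_is_subgroup[OF V'C])
  have step: "p \<otimes> h \<in> P" if "h \<in> ?H" "p \<in> P" for h p
    using that
  proof (induction h arbitrary: p rule: generate.induct)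
    case (eng h1 h2)
    have "p \<in> carrier G" "h1 \<in> carrier G" "h2 \<in> carrier G"
      using eng PC generate_in_carrier[OF V'C] by auto
    then have "p \<otimes> (h1 \<otimes> h2) = (p \<otimes> h1) \<otimes> h2" by (simp add: m_assoc)
    then show ?case using eng by simp
  qed (use PC PV in \<open>auto simp: V'_def\<close>)
  have "?H \<subseteq> P"
  proof
    fix h assume h: "h \<in> ?H"
    then have "\<one> \<otimes> h \<in> P" using step P(3) by blast
    then show "h \<in> P" using generate_in_carrier[OF V'C h] by simp
  qed
  moreover have "closedin T ?H"
  proof (rule relatively_open_subgroup_closed[OF _ subgroup_self H _ V'])
    show "closedin T (carrier G)" using closedin_topspace[of T] by (simp add: topspace_eq)
    show "?H \<subseteq> carrier G" by (rule generate_incl[OF V'C])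
    show "V' \<inter> carrier G \<subseteq> ?H" by (auto intro: generate.incl)
  qed
  ultimately have "compactin T ?H" by (rule closed_compactin[OF P(1)])
  moreover have "openin T ?H"
  proof -
    have "openin T (?H <#> V')" by (rule open_set_mult[OF V'(1) generate_incl[OF V'C]])
    moreover have "?H <#> V' = ?H"
    proof
      show "?H <#> V' \<subseteq> ?H" by (auto simp: set_mult_def intro: generate.eng generate.incl)
      show "?H \<subseteq> ?H <#> V'"
      proof
        fix h assume h: "h \<in> ?H"
        then have "h \<otimes> \<one> \<in> ?H <#> V'" using V'(2) by (intro mem_set_multI)
        then show "h \<in> ?H <#> V'" using generate_in_carrier[OF V'C h] by simp
      qed
    qed
    ultimately show ?thesis by simp
  qed
  ultimately show thesis using that H by blast
qed

end

section \<open>Closedness of the derived subgroup\<close>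

context topo_abelian_normal
begin

lemma continuous_act: "g \<in> carrier G \<Longrightarrow> continuous_map T T (\<lambda>x. g \<otimes> x \<otimes> inv g)"
  by (intro continuous_mult continuous_inv continuous_const continuous_map_id[unfolded id_def]) auto

lemma closed_act_preimage:
  assumes "closedin T A" "closedin T U" "g \<in> carrier G"
  shows "closedin T {x \<in> A. act g x \<in> U}"
proof -
  have "closedin T (A \<inter> {x \<in> topspace T. g \<otimes> x \<otimes> inv g \<in> U})"
    using assms by (intro closedin_Int closedin_continuous_map_preimage[OF continuous_act])
  moreover have "A \<inter> {x \<in> topspace T. g \<otimes> x \<otimes> inv g \<in> U} = {x \<in> A. act g x \<in> U}"
    using A.subset topspace_eq by (auto simp: act_def)
  ultimately show ?thesis by simp
qed

text \<open>Since \<open>A\<close> is abelian, \<open>act (t j) v \<otimes> inv v\<close> depends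
  homomorphically on \<open>v\<close>, so its values on a compact subgroup form a compact subgroup.
  One such image is multiplied in for each \<open>j\<close>. Compactness of \<open>I\<close> is
  needed for the limit argument.\<close>

lemma compact_commutator_subgroup:
  assumes T2: "Hausdorff_space T" and A: "closedin T A" and U: "subgroup U G" "compactin T U" "U \<subseteq> A"
    and t: "\<And>j. t j \<in> carrier G"
  shows "\<exists>I. subgroup I G \<and> compactin T I \<and> I \<subseteq> derived G (carrier G)
    \<and> (\<forall>j<m::nat. \<forall>v\<in>U. act (t j) v \<in> U \<longrightarrow> act (t j) v \<otimes> inv v \<in> I)"
proof (induction m)
  case 0
  show ?case
    using triv_subgroup subgroup.one_closed[OF derived_is_subgroup[of "carrier G"]]
    by (intro exI[of _ "{\<one>}"]) (auto simp: topspace_eq)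
next
  case (Suc m)
  interpret U: subgroup U G by (rule U)
  interpret C: comm_group "G\<lparr>carrier := A\<rparr>" by (rule comm_group_A)
  interpret h: group_hom "G\<lparr>carrier := A\<rparr>" "G\<lparr>carrier := A\<rparr>" "act (t m)"
    using act_hom[OF t] by unfold_locales
  obtain I where I: "subgroup I G" "compactin T I" "I \<subseteq> derived G (carrier G)"
    "\<And>j v. j < m \<Longrightarrow> v \<in> U \<Longrightarrow> act (t j) v \<in> U \<Longrightarrow> act (t j) v \<otimes> inv v \<in> I" using Suc.IH by blast
  define V where "V = {v \<in> U. act (t m) v \<in> U}"
  \<comment> \<open>The explicit commutator is continuous on all of \<open>G\<close>, whereas
    \<open>act\<close> is set to the identity outside \<open>A\<close>.\<close>
  define f where "f v = t m \<otimes> v \<otimes> inv (t m) \<otimes> inv v" for v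
  have VA: "V \<subseteq> A" using U by (auto simp: V_def)
  have f: "f v = act (t m) v \<otimes> inv v" if "v \<in> V" for v using that VA by (auto simp: f_def act_def)
  let ?K = "f ` V"
  have Uc: "closedin T U" by (rule compactin_imp_closedin[OF T2 U(2)])
  have "compactin T V"
  proof -
    have "compactin T (U \<inter> {x \<in> A. act (t m) x \<in> U})"
      by (rule compact_Int_closedin[OF U(2) closed_act_preimage[OF A Uc t]])
    moreover have "U \<inter> {x \<in> A. act (t m) x \<in> U} = V" using U by (auto simp: V_def)
    ultimately show ?thesis by simp
  qed
  moreover have "continuous_map T T f" unfolding f_def
    using t by (intro continuous_mult continuous_inv continuous_const continuous_map_id[unfolded id_def]) auto
  ultimately have Kc: "compactin T ?K" by (rule image_compactin)
  have Kd: "?K \<subseteq> derived G (carrier G)"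
    using VA A.subset commutator_in_derived[OF t] by (auto simp: f_def)
  have inv: "inv\<^bsub>G\<lparr>carrier := A\<rparr>\<^esub> x = inv x" if "x \<in> A" for x using m_inv_consistent[OF A.subgroup_axioms that] .
  have am: "act (t m) (x \<otimes> y) = act (t m) x \<otimes> act (t m) y" if "x \<in> A" "y \<in> A" for x y
    using h.hom_mult[of x y] that by simp
  have ai: "act (t m) (inv x) = inv (act (t m) x)" if "x \<in> A" for x
    using h.hom_inv[of x] that inv act_closed[OF t] by simp
  have a1: "act (t m) \<one> = \<one>" using h.hom_one by simp
  have Ks: "subgroup ?K G"
  proof
    show "?K \<subseteq> carrier G" using Kd derived_in_carrier by blast
    have "\<one> \<in> V" by (simp add: V_def a1)
    then show "\<one> \<in> ?K" using f[of \<one>] a1 by force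
    fix x y assume "x \<in> ?K" "y \<in> ?K"
    then obtain u v where uv: "u \<in> V" "v \<in> V" "x = f u" "y = f v" by blast
    have uA: "u \<in> A" "v \<in> A" using uv VA by auto
    have C: "u \<in> carrier G" "v \<in> carrier G" "act (t m) u \<in> carrier G" "act (t m) v \<in> carrier G"
      using uA act_closed[OF t] by auto
    have A': "act (t m) u \<in> A" "act (t m) v \<in> A" "inv u \<in> A" "inv v \<in> A" using uA act_closed[OF t] by auto
    have "u \<otimes> v \<in> V" using uv am uA by (auto simp: V_def)
    moreover have "f (u \<otimes> v) = x \<otimes> y"
    proof -
      have "f (u \<otimes> v) = act (t m) u \<otimes> (act (t m) v \<otimes> inv v) \<otimes> inv u"
        using f[OF \<open>u \<otimes> v \<in> V\<close>] am uA C by (simp add: inv_mult_group m_assoc)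
      also have "\<dots> = act (t m) u \<otimes> (inv u \<otimes> (act (t m) v \<otimes> inv v))"
        using C A_commute[of "act (t m) v \<otimes> inv v" "inv u"] A' by (simp add: m_assoc)
      also have "\<dots> = x \<otimes> y" using uv f C by (simp add: m_assoc)
      finally show ?thesis .
    qed
    ultimately show "x \<otimes> y \<in> ?K" by (metis imageI)
    have "inv u \<in> V" using uv ai uA by (auto simp: V_def)
    moreover have "f (inv u) = inv x"
    proof -
      have "f (inv u) = inv (act (t m) u) \<otimes> u" using f[OF \<open>inv u \<in> V\<close>] ai uA C by simp
      also have "\<dots> = u \<otimes> inv (act (t m) u)" using A_commute uA A' by blast
      also have "\<dots> = inv x" using uv f C by (simp add: inv_mult_group)
      finally show ?thesis .
    qed
    ultimately show "inv x \<in> ?K" by (metis imageI)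
  qed
  have IA: "I \<subseteq> A" "?K \<subseteq> A" using I(3) Kd derived_subset by auto
  have "subgroup (I <#> ?K) (G\<lparr>carrier := A\<rparr>)"
    using C.mult_subgroups[of I ?K] subgroup_A_iff I(1) Ks IA by simp
  moreover have dsub: "I <#> ?K \<subseteq> derived G (carrier G)"
    using I(3) Kd subgroup.m_closed[OF derived_is_subgroup[of "carrier G"]] by (auto simp: set_mult_def)
  ultimately have "subgroup (I <#> ?K) G" using subgroup_A_iff[of "I <#> ?K"] derived_subset by blast
  moreover have "compactin T (I <#> ?K)" by (rule compact_set_mult[OF I(2) Kc])
  moreover have "act (t j) v \<otimes> inv v \<in> I <#> ?K" if "j < Suc m" "v \<in> U" "act (t j) v \<in> U" for j v
  proof (cases "j = m")
    case True
    then have v: "v \<in> V" using that by (simp add: V_def)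
    have "\<one> \<otimes> f v \<in> I <#> ?K" using subgroup.one_closed[OF I(1)] v by (intro mem_set_multI) auto
    moreover have "f v \<in> carrier G" using v Kd derived_in_carrier by blast
    ultimately show ?thesis using f[OF v] True by simp
  next
    case False
    then have i: "act (t j) v \<otimes> inv v \<in> I" using that I(4) by simp
    then have "(act (t j) v \<otimes> inv v) \<otimes> \<one> \<in> I <#> ?K" using subgroup.one_closed[OF Ks] by (intro mem_set_multI)
    moreover have "act (t j) v \<otimes> inv v \<in> carrier G" using i subgroup.subset[OF I(1)] by blast
    ultimately show ?thesis by simp
  qed
  ultimately show ?case using dsub by blast
qed

end

context topo_abelian_normal
begin

theorem closedin_derived:
  assumes T2: "Hausdorff_space T" and lc: "locally_compact_space T" and td: "totally_disconnected_space T"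
    and S: "compactin T S" "generate G S = carrier G" and A: "closedin T A"
    and triv: "W_sub G T = {\<one>}"
  shows "closedin T (derived G (carrier G))"
proof -
  obtain C where C: "subgroup C G" "compactin T C" "openin T C" using compact_open_subgroup[OF T2 lc td] by blast
  have C1: "\<one> \<in> C" by (rule subgroup.one_closed[OF C(1)])
  define U where "U = C \<inter> A"
  have Usub: "subgroup U G" unfolding U_def by (rule subgroups_Inter_pair[OF C(1) A.subgroup_axioms])
  interpret U: subgroup U G by (rule Usub)
  have UA: "U \<subseteq> A" and CU: "C \<inter> A \<subseteq> U" by (auto simp: U_def)
  have Uc: "compactin T U" unfolding U_def by (rule compact_Int_closedin[OF C(2) A])
  have Ucl: "closedin T U" by (rule compactin_imp_closedin[OF T2 Uc])
  have Ugen: "U = generate G U" using generate_subgroup_incl[OF order_refl Usub] by (auto intro: generate.incl)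
  obtain t :: "nat \<Rightarrow> 'a" and m where t: "\<And>i. t i \<in> carrier G"
    and cover: "\<And>g. g \<in> carrier G \<Longrightarrow> \<exists>n\<in>carrier G. \<exists>\<alpha>. act n ` U = U \<and> set_mset \<alpha> \<subseteq> {..<m} \<and> (\<forall>x. act g x = act n (mact t \<alpha> x))"
    using monomial_generators[OF S Uc UA Ugen C(3) C1 CU] by blast
  interpret M: monomial_action "G\<lparr>carrier := A\<rparr>" "{..<m}" "mact t" U
    by (rule monomial_action_A[where t = t, OF t _ Usub UA]) simp
  \<comment> \<open>A conjugate of the compact group \<open>U\<close> meets only finitely many
    cosets of the relatively open \<open>U\<close>; this is the finiteness that stabilises the
    tails.\<close>
  have "\<exists>F. finite F \<and> F \<subseteq> carrier (G\<lparr>carrier := A\<rparr>) \<and> mact t {#j#} ` U \<subseteq> F <#>\<^bsub>G\<lparr>carrier := A\<rparr>\<^esub> U" for j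
  proof -
    let ?P = "act (t j) ` U"
    have "?P = (\<lambda>x. t j \<otimes> x \<otimes> inv (t j)) ` U" using UA by (intro image_cong) (auto simp: act_def)
    then have "compactin T ?P" using image_compactin[OF Uc continuous_act[OF t]] by simp
    moreover have PA: "?P \<subseteq> A" using UA act_closed[OF t] by blast
    ultimately obtain F where "finite F" "F \<subseteq> ?P" "?P \<subseteq> F <#> U"
      using finitely_many_mod_relatively_open[OF _ _ Usub UA C(3) C1 CU] by blast
    then show ?thesis using PA by (intro exI[of _ F]) (auto simp: mact_single[where t = t, OF t])
  qed
  then obtain n0 where n0: "n0 > 0"
    "\<And>\<alpha>. \<alpha> \<in> M.monomials \<Longrightarrow> size \<alpha> \<ge> n0 \<Longrightarrow> \<exists>j\<in>{..<m}. M.tail (\<alpha> + {#j#}) = M.tail \<alpha>"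
    using M.tail_eventually_constant by blast
  obtain I where I: "subgroup I G" "compactin T I" "I \<subseteq> derived G (carrier G)"
    "\<And>j v. j < m \<Longrightarrow> v \<in> U \<Longrightarrow> act (t j) v \<in> U \<Longrightarrow> act (t j) v \<otimes> inv v \<in> I"
    using compact_commutator_subgroup[where t = t and m = m, OF T2 A Usub Uc UA t] by auto
  have IA: "I \<subseteq> A" using I(3) derived_subset by blast
  have inv: "inv\<^bsub>G\<lparr>carrier := A\<rparr>\<^esub> x = inv x" if "x \<in> A" for x using m_inv_consistent[OF A.subgroup_axioms that] .
  have core: "x = \<one>" if x: "x \<in> A" "\<And>\<alpha>. \<alpha> \<in> M.monomials \<Longrightarrow> mact t \<alpha> x \<in> U" for x
  proof -
    \<comment> \<open>The largest normal subgroup of \<open>G\<close> inside \<open>U\<close>. It is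
      compact, hence trivial by assumption, and \<open>cover\<close> reduces membership to the
      monomial coordinates.\<close>
    define K where "K = {x \<in> A. \<forall>g\<in>carrier G. act g x \<in> U}"
    have "K \<lhd> G"
    proof (rule normal_invI)
      have hom: "act g (x \<otimes> y) = act g x \<otimes> act g y" "act g (inv x) = inv (act g x)" "act g \<one> = \<one>"
        if "g \<in> carrier G" "x \<in> A" "y \<in> A" for g x y
      proof -
        interpret h: group_hom "G\<lparr>carrier := A\<rparr>" "G\<lparr>carrier := A\<rparr>" "act g"
          using act_hom[OF that(1)] by unfold_locales
        show "act g (x \<otimes> y) = act g x \<otimes> act g y" using h.hom_mult[of x y] that by simp
        show "act g (inv x) = inv (act g x)" using h.hom_inv[of x] that inv act_closed by simp
        show "act g \<one> = \<one>" using h.hom_one by simp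
      qed
      show "subgroup K G"
      proof
        show "K \<subseteq> carrier G" using A.subset by (auto simp: K_def)
        show "\<one> \<in> K" using hom(3)[OF _ A.one_closed A.one_closed] by (simp add: K_def)
        fix x y assume "x \<in> K" "y \<in> K"
        then show "x \<otimes> y \<in> K" "inv x \<in> K" using hom by (auto simp: K_def)
      qed
      fix g x assume g: "g \<in> carrier G" and x: "x \<in> K"
      then have xA: "x \<in> A" by (simp add: K_def)
      have "g \<otimes> x \<otimes> inv g = act g x" using xA by (simp add: act_def)
      moreover have "act g x \<in> K" unfolding K_def
        using act_closed[OF g xA] x g by (auto simp: K_def simp flip: act_mult)
      ultimately show "g \<otimes> x \<otimes> inv g \<in> K" by simp
    qed
    moreover have "compactin T K"
    proof (rule closed_compactin[OF Uc])
      have "x \<in> U" if "x \<in> K" for x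
      proof -
        have "act \<one> x \<in> U" using that one_closed unfolding K_def by blast
        then show ?thesis by (simp add: act_one)
      qed
      then show "K \<subseteq> U" by blast
      have "K = (\<Inter>g\<in>carrier G. {x \<in> A. act g x \<in> U})" using one_closed by (auto simp: K_def)
      moreover have "closedin T \<dots>" using one_closed closed_act_preimage[OF A Ucl] by (intro closedin_INT) auto
      ultimately show "closedin T K" by simp
    qed
    ultimately have "K \<subseteq> {\<one>}" using triv unfolding W_sub_def by blast
    moreover have "x \<in> K" unfolding K_def
    proof (intro CollectI conjI ballI x(1))
      fix g assume "g \<in> carrier G"
      then obtain n \<alpha> where n: "act n ` U = U" "set_mset \<alpha> \<subseteq> {..<m}" "act g x = act n (mact t \<alpha> x)"
        using cover by blast
      have "mact t \<alpha> x \<in> U" using x(2) n(2) by simp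
      then show "act g x \<in> U" using n(1,3) by blast
    qed
    ultimately show ?thesis by blast
  qed
  have below_closed: "closedin T (M.below \<alpha>)" for \<alpha>
  proof -
    have "M.below \<alpha> = A \<inter> (\<Inter>\<beta>\<in>{\<beta>. set_mset \<beta> \<subseteq> {..<m} \<and> \<beta> \<triangleleft> \<alpha>}. {x \<in> A. mact t \<beta> x \<in> U})"
      by (auto simp: M.below_def)
    moreover have "closedin T {x \<in> A. mact t \<beta> x \<in> U}" for \<beta>
    proof -
      obtain g where "g \<in> carrier G" "\<And>x. mact t \<beta> x = act g x" using mact_eq_act[where t = t, OF t] by blast
      then show ?thesis using closed_act_preimage[OF A Ucl] by simp
    qed
    ultimately show ?thesis using A
      by (cases "{\<beta>. set_mset \<beta> \<subseteq> {..<m} \<and> \<beta> \<triangleleft> \<alpha>} = {}") (auto intro!: closedin_Int closedin_INT)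
  qed
  have small: "x \<in> I" if x: "x \<in> A" "\<And>\<beta>. \<beta> \<in> M.monomials \<Longrightarrow> size \<beta> < n0 \<Longrightarrow> mact t \<beta> x \<in> U" for x
  proof -
    have IAs: "subgroup I (G\<lparr>carrier := A\<rparr>)" using subgroup_A_iff[OF IA] I(1) by blast
    have xC: "x \<in> carrier G" using x(1) by simp
    have approx: "\<exists>i\<in>I. inv i \<otimes> x \<in> M.below \<alpha>" for \<alpha>
    proof -
      have "x \<in> I <#>\<^bsub>G\<lparr>carrier := A\<rparr>\<^esub> M.below \<alpha>"
      proof (rule M.below_approximation[OF n0 IAs])
        fix j v assume "j \<in> {..<m}" "v \<in> U" "mact t {#j#} v \<in> U"
        then show "mact t {#j#} v \<otimes>\<^bsub>G\<lparr>carrier := A\<rparr>\<^esub> inv\<^bsub>G\<lparr>carrier := A\<rparr>\<^esub> v \<in> I"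
          using I(4) UA inv by (auto simp: mact_single[where t = t, OF t])
      qed (use x in auto)
      then have "x \<in> I <#> M.below \<alpha>" by simp
      then obtain i y where iy: "i \<in> I" "y \<in> M.below \<alpha>" "x = i \<otimes> y" by (rule mem_set_multE)
      have iA: "i \<in> A" "y \<in> A" using iy IA by (auto simp: M.below_def)
      then have "inv i \<otimes> x = y" unfolding iy(3) by (simp flip: m_assoc)
      then show ?thesis using iy by blast
    qed
    let ?C = "\<lambda>\<alpha>. {i \<in> topspace T. inv i \<otimes> x \<in> M.below \<alpha>}"
    have "continuous_map T T (\<lambda>i. inv i \<otimes> x)"
      using xC by (intro continuous_mult continuous_inv continuous_const continuous_map_id[unfolded id_def])
    then have closed: "closedin T (?C \<alpha>)" for \<alpha> by (rule closedin_continuous_map_preimage[OF _ below_closed])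
    \<comment> \<open>Each \<open>?C \<alpha>\<close> contains some correction from
      \<open>I\<close>; compactness of \<open>I\<close> yields a single correction that works for
      all \<open>\<alpha>\<close> at once.\<close>
    have "I \<inter> \<Inter>(range ?C) \<noteq> {}"
    proof (rule ccontr)
      assume "\<not> ?thesis"
      then have "\<exists>\<F>. finite \<F> \<and> \<F> \<subseteq> range ?C \<and> I \<inter> \<Inter>\<F> = {}"
        using I(2) closed unfolding compactin_fip by (metis (no_types, lifting) rangeE)
      then obtain \<F> where \<F>: "finite \<F>" "\<F> \<subseteq> range ?C" "I \<inter> \<Inter>\<F> = {}" by blast
      obtain E where E: "finite E" "\<F> = ?C ` E" using finite_subset_image[OF \<F>(1,2)] by blast
      \<comment> \<open>A multiset larger than every index in \<open>E\<close>. It need not use the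
        variables in \<open>{..<m}\<close>, since \<open>below\<close> and \<open>approx\<close>
        admit arbitrary multisets.\<close>
      define \<gamma> where "\<gamma> = replicate_mset (Suc (\<Sum>\<alpha>\<in>E. size \<alpha>)) (0::nat)"
      have less: "\<alpha> \<triangleleft> \<gamma>" if "\<alpha> \<in> E" for \<alpha>
        using member_le_sum[OF that _ E(1), of size] by (intro deglex_if_size_less) (simp add: \<gamma>_def)
      obtain i where i: "i \<in> I" "inv i \<otimes> x \<in> M.below \<gamma>" using approx by blast
      have "i \<in> topspace T" using i(1) subgroup.subset[OF I(1)] topspace_eq by blast
      then have "i \<in> ?C \<alpha>" if "\<alpha> \<in> E" for \<alpha> using i(2) M.below_mono[OF less[OF that]] by blast
      then have "i \<in> I \<inter> \<Inter>\<F>" using i(1) E(2) by blast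
      then show False using \<F>(3) by blast
    qed
    then obtain i where i: "i \<in> I" "\<And>\<alpha>. inv i \<otimes> x \<in> M.below \<alpha>" by blast
    have iA: "i \<in> A" using i(1) IA by blast
    have "inv i \<otimes> x = \<one>"
    proof (rule core)
      show "inv i \<otimes> x \<in> A" using iA x(1) by blast
      fix \<alpha> assume \<alpha>: "\<alpha> \<in> M.monomials"
      have "\<alpha> \<triangleleft> add_mset 0 \<alpha>" by (simp add: deglex_if_size_less)
      then show "mact t \<alpha> (inv i \<otimes> x) \<in> U" using i(2)[of "add_mset 0 \<alpha>"] \<alpha> by (simp add: M.below_def)
    qed
    then have "x = i" using iA xC by (metis A.mem_carrier inv_equality inv_inv inv_closed)
    then show ?thesis using i(1) by simp
  qed
  \<comment> \<open>Only finitely many coordinates have size below \<open>n0\<close>, so by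
    continuity they are all trivial on a neighbourhood of the identity in \<open>A\<close>.\<close>
  have fin: "finite {\<beta>. set_mset \<beta> \<subseteq> {..<m} \<and> size \<beta> < n0}"
  proof (rule finite_subset)
    show "{\<beta>. set_mset \<beta> \<subseteq> {..<m} \<and> size \<beta> < n0} \<subseteq> {\<beta>. set_mset \<beta> \<subseteq> {..<m} \<and> \<beta> \<triangleleft> replicate_mset n0 0}"
      by (auto intro: deglex_if_size_less)
  qed (rule finite_deglex_below, simp)
  have "\<forall>\<beta>. \<exists>g. g \<in> carrier G \<and> (\<forall>x. mact t \<beta> x = act g x)" using mact_eq_act[where t = t, OF t] by blast
  from choice[OF this] obtain g where g: "\<And>\<beta>. g \<beta> \<in> carrier G" "\<And>\<beta> x. mact t \<beta> x = act (g \<beta>) x" by blast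
  let ?E = "g ` {\<beta>. set_mset \<beta> \<subseteq> {..<m} \<and> size \<beta> < n0}"
  have "finite ?E" "?E \<subseteq> carrier G" using fin g(1) by auto
  then obtain O1 where O1: "openin T O1" "\<one> \<in> O1" "\<And>x g. x \<in> O1 \<inter> A \<Longrightarrow> g \<in> ?E \<Longrightarrow> act g x \<in> C"
    using relatively_open_act_preimage[OF C(3) C1] by blast
  have "O1 \<inter> A \<subseteq> derived G (carrier G)"
  proof
    fix x assume x: "x \<in> O1 \<inter> A"
    have "x \<in> I"
    proof (rule small)
      show "x \<in> A" using x by blast
      fix \<beta> assume "\<beta> \<in> M.monomials" "size \<beta> < n0"
      then have "act (g \<beta>) x \<in> C" using O1(3)[OF x, of "g \<beta>"] by blast
      moreover have "act (g \<beta>) x \<in> A" using act_closed[OF g(1)] x by blast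
      ultimately show "mact t \<beta> x \<in> U" using g(2) CU by auto
    qed
    then show "x \<in> derived G (carrier G)" using I(3) by blast
  qed
  then show ?thesis
    using relatively_open_subgroup_closed[OF A A.subgroup_axioms derived_is_subgroup[OF order_refl] derived_subset O1(1,2)] by blast
qed

end

theorem mainTheorem17:
  fixes G :: "('a, 'b) monoid_scheme" and T :: "'a topology"
  assumes "lc_group G T" and "compactly_generated G T" and "metabelian G"
  shows "W_sub G T \<lhd> G \<and> compactin T (W_sub G T)
     \<and> W_sub (G Mod (W_sub G T)) (quotient_group_topology G T (W_sub G T))
         = {\<one>\<^bsub>G Mod (W_sub G T)\<^esub>}
     \<and> (W_sub G T = {\<one>\<^bsub>G\<^esub>} \<and> totally_disconnected_space T
         \<longrightarrow> closedin T (derived G (carrier G)))"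
proof -
  have T2: "Hausdorff_space T" and lc: "locally_compact_space T" and tg: "topological_group G T"
    using assms(1) by (auto simp: lc_group_def)
  interpret topo_group G T
    using tg by (auto simp: topological_group_def topo_group_def topo_group_axioms_def)
  let ?W = "W_sub G T" and ?TQ = "quotient_group_topology G T (W_sub G T)"
  obtain L where L: "compactin T L" "?W \<subseteq> L" using W_bounded[OF T2 lc assms(3,2)] by blast
  have "closedin T (carrier G)" using closedin_topspace[of T] by (simp add: topspace_eq)
  then have "?W \<in> compact_normals (carrier G)"
    using Union_compact_normals_mem[OF T2 subgroup_self _ L(1)] L(2) unfolding W_sub_eq by blast
  then have W: "?W \<lhd> G" "compactin T ?W" by (auto simp: compact_normals_def)
  interpret W: normal ?W G by (rule W(1))
  interpret Q: topo_group "G Mod ?W" ?TQ by (rule topo_group_quotient[OF W(1)])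
  \<comment> \<open>As \<open>W_sub G T\<close> is itself compact, preimages of compact normal
    subgroups of the quotient are compact normal subgroups of \<open>G\<close> and so are already
    contained in it.\<close>
  have QW: "K = {?W}" if K: "K \<lhd> (G Mod ?W)" "compactin ?TQ K" for K
  proof (rule Union_subset_imp_trivial[OF W(1) K(1)])
    have "\<Union>K \<lhd> G" by (rule W.factgroup_subgroup_union_normal[OF K(1)])
    moreover have "compactin T (\<Union>K)" by (rule compact_Union_quotient[OF W lc T2 K(2)])
    ultimately show "\<Union>K \<subseteq> ?W" by (auto simp: W_sub_def)
  qed
  have "W_sub (G Mod ?W) ?TQ = {?W}"
  proof (intro equalityI subsetI)
    fix x assume "x \<in> W_sub (G Mod ?W) ?TQ"
    then obtain K where K: "K \<lhd> (G Mod ?W)" "compactin ?TQ K" "x \<in> K" unfolding W_sub_def[of "G Mod ?W"] by blast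
    then show "x \<in> {?W}" using QW[OF K(1,2)] by simp
  next
    fix x assume "x \<in> {?W}"
    \<comment> \<open>The trivial subgroup shows that the union defining \<open>W_sub\<close> for
      the quotient is not empty.\<close>
    moreover have "{\<one>\<^bsub>G Mod ?W\<^esub>} \<in> Q.compact_normals (carrier (G Mod ?W))"
      by (rule Q.one_compact_normals[OF Q.one_closed])
    ultimately show "x \<in> W_sub (G Mod ?W) ?TQ" unfolding Q.W_sub_eq by (intro UnionI) auto
  qed
  then have "W_sub (G Mod ?W) ?TQ = {\<one>\<^bsub>G Mod ?W\<^esub>}" by simp
  moreover have "closedin T (derived G (carrier G))"
    if triv: "?W = {\<one>\<^bsub>G\<^esub>}" and td: "totally_disconnected_space T"
  proof -
    obtain S where S: "compactin T S" "generate G S = carrier G"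
      using assms(2) by (auto simp: compactly_generated_def)
    show ?thesis
      by (rule topo_abelian_normal.closedin_derived[OF
            topo_abelian_normal_closure_derived[OF T2 assms(3)] T2 lc td S closedin_closure_of triv])
  qed
  ultimately show ?thesis using W by blast
qed

end
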